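(* Let $(G,g,f)$ be a third-type datum and $H=\mathfrak A^3_G(g,f)$. Orient each exact factorization of $H$ by proper Hopf subalgebras so that the rank-one factor is written first. Then two exact factorizations $$H=\mathfrak A^3_{G_{B_1}}(g,f|_{G_{B_1}})\,k[\Gamma_1]\quad\text{and}\quad H=\mathfrak A^3_{G_{B_2}}(g,f|_{G_{B_2}})\,k[\Gamma_2]$$ are equivalent under $\operatorname{Aut}_{\mathrm{Hopf}}(H)$ if and only if there exists $\sigma\in\operatorname{Aut}_{g,f}(G)$ such that $$\sigma(G_{B_1})=G_{B_2},\qquad \sigma(\Gamma_1)=\Gamma_2.$$ Thus equivalence classes of exact factorizations are precisely the $\operatorname{Aut}_{g,f}(G)$-orbits on the set of group exact factorizations $G=G_B\Gamma$ with $G_B\cap\Gamma=\{1\}$, $g\in G_B$, $\Gamma\ne\{1\}$.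
   Context: $k$ is an algebraically closed field of characteristic $p>0$; all algebras, tensor products etc. are over $k$. A third-type datum is a triple $(G,g,f)$ where $G$ is a finite group, $g\in Z(G)$, $f:G\to(k,+)$ is a group homomorphism with $f(g)=1$, and $(f(t)^p-f(t))(1-g^p)=0$ in $k[G]$ for all $t\in G$. The Hopf algebra $\mathfrak A^3_G(g,f)$ is generated as an algebra by the group algebra $k[G]$ and an element $x$ subject to $tx-xt=f(t)\,t(1-g)$ for $t\in G$ and $x^p=x$, with $\Delta(t)=t\otimes t$, $\varepsilon(t)=1$, $S(t)=t^{-1}$ for $t\in G$, and $\Delta(x)=x\otimes 1+g\otimes x$, $\varepsilon(x)=0$, $S(x)=-g^{-1}x$. It has basis $\{tx^i\mid t\in G,\ 0\le i<p\}$. For a subgroup $G_B$ containing $g$, $\mathfrak A^3_{G_B}(g,f|_{G_B})$ is identified with the Hopf subalgebra of $H$ generated by $G_B$ and $x$ (a "rank-one factor"). For Hopf subalgebras $B,T$ of $H$, $H=BT$ is an exact factorization if multiplication $B\otimes T\to H$ is bijective. Up to interchanging factors, every exact factorization of $H$ by proper Hopf subalgebras has the form $H=\mathfrak A^3_{G_B}(g,f|_{G_B})\,k[\Gamma]$ with subgroups $G_B,\Gamma\le G$ such that $G=G_B\Gamma$, $G_B\cap\Gamma=\{1\}$, $g\in G_B$, $\Gamma\neq\{1\}$. Two oriented factorizations $H=B_1T_1=B_2T_2$ are equivalent under $\operatorname{Aut}_{\mathrm{Hopf}}(H)$ if some Hopf algebra automorphism $\Phi$ of $H$ satisfies $\Phi(B_1)=B_2$,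 $\Phi(T_1)=T_2$. $\operatorname{Aut}_{g,f}(G)=\{\sigma\in\operatorname{Aut}(G)\mid\sigma(g)=g,\ f\circ\sigma=f\}$. *)

theory Defs
  imports
    "HOL-Algebra.Group_Action"
    "HOL-Computational_Algebra.Polynomial"
    "HOL-Library.Poly_Mapping"
    "HOL.Hull"
begin

section \<open>Formal linear combinations\<close>

definition fs_scale :: "'k \<Rightarrow> ('i \<Rightarrow>\<^sub>0 'k) \<Rightarrow> ('i \<Rightarrow>\<^sub>0 'k::field)" where
  "fs_scale c u = Poly_Mapping.map (\<lambda>z. c * z) u"

text \<open>The linear extension of \<open>\<phi>\<close> to formal linear combinations, with values in the
  vector space with scalar multiplication \<open>s\<close>.\<close>
definition lin_ext ::
    "('k \<Rightarrow> 'v \<Rightarrow> 'v) \<Rightarrow> ('i \<Rightarrow> 'v) \<Rightarrow> ('i \<Rightarrow>\<^sub>0 'k::field) \<Rightarrow> 'v::ab_group_add" where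
  "lin_ext s \<phi> u = (\<Sum>i\<in>Poly_Mapping.keys u. s (Poly_Mapping.lookup u i) (\<phi> i))"


section \<open>Tensor products\<close>

text \<open>For subspaces \<open>B\<close> and \<open>T\<close> the tensor product of \<open>B\<close> and \<open>T\<close> is the space of formal
  linear combinations of pairs from \<open>B \<times> T\<close>, modulo the span of the bilinearity relations; the
  pair \<open>(b, t)\<close> stands for the pure tensor. Its set of elements is
  \<open>tensor_formal B T // tensor_rel s B T\<close>.\<close>

definition tensor_formal :: "'h set \<Rightarrow> 'h set \<Rightarrow> ('h \<times> 'h \<Rightarrow>\<^sub>0 'k::field) set" where
  "tensor_formal B T = {u. Poly_Mapping.keys u \<subseteq> B \<times> T}"

definition tensor_null ::
    "('k \<Rightarrow> 'h \<Rightarrow> 'h) \<Rightarrow> 'h set \<Rightarrow> 'h set \<Rightarrow> ('h::ab_group_add \<times> 'h \<Rightarrow>\<^sub>0 'k::field) set" where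
  "tensor_null s B T = module.span fs_scale
     ({Poly_Mapping.single (a + a', b) 1 - Poly_Mapping.single (a, b) 1 - Poly_Mapping.single (a', b) 1
         | a a' b. a \<in> B \<and> a' \<in> B \<and> b \<in> T} \<union>
      {Poly_Mapping.single (a, b + b') 1 - Poly_Mapping.single (a, b) 1 - Poly_Mapping.single (a, b') 1
         | a b b'. a \<in> B \<and> b \<in> T \<and> b' \<in> T} \<union>
      {Poly_Mapping.single (s c a, b) 1 - Poly_Mapping.single (a, b) c | a b c. a \<in> B \<and> b \<in> T} \<union>
      {Poly_Mapping.single (a, s c b) 1 - Poly_Mapping.single (a, b) c | a b c. a \<in> B \<and> b \<in> T})"

definition tensor_rel ::
    "('k \<Rightarrow> 'h \<Rightarrow> 'h) \<Rightarrow> 'h set \<Rightarrow> 'h set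
      \<Rightarrow> (('h::ab_group_add \<times> 'h \<Rightarrow>\<^sub>0 'k::field) \<times> ('h \<times> 'h \<Rightarrow>\<^sub>0 'k)) set" where
  "tensor_rel s B T =
     {(u, v). u \<in> tensor_formal B T \<and> v \<in> tensor_formal B T \<and> u - v \<in> tensor_null s B T}"

text \<open>Equality in the two-fold and in the three-fold tensor power of the whole space.\<close>

definition tensor_eq ::
    "('k \<Rightarrow> 'h \<Rightarrow> 'h) \<Rightarrow> ('h::ab_group_add \<times> 'h \<Rightarrow>\<^sub>0 'k::field) \<Rightarrow> ('h \<times> 'h \<Rightarrow>\<^sub>0 'k) \<Rightarrow> bool" where
  "tensor_eq s u v \<longleftrightarrow> (u, v) \<in> tensor_rel s UNIV UNIV"

definition tensor3_eq ::
    "('k \<Rightarrow> 'h \<Rightarrow> 'h)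
      \<Rightarrow> ('h::ab_group_add \<times> 'h \<times> 'h \<Rightarrow>\<^sub>0 'k::field) \<Rightarrow> ('h \<times> 'h \<times> 'h \<Rightarrow>\<^sub>0 'k) \<Rightarrow> bool" where
  "tensor3_eq s u v \<longleftrightarrow> u - v \<in> module.span fs_scale
     (range (\<lambda>(a, a', b, c). Poly_Mapping.single (a + a', b, c) 1
          - Poly_Mapping.single (a, b, c) 1 - Poly_Mapping.single (a', b, c) 1) \<union>
      range (\<lambda>(a, b, b', c). Poly_Mapping.single (a, b + b', c) 1
          - Poly_Mapping.single (a, b, c) 1 - Poly_Mapping.single (a, b', c) 1) \<union>
      range (\<lambda>(a, b, c, c'). Poly_Mapping.single (a, b, c + c') 1
          - Poly_Mapping.single (a, b, c) 1 - Poly_Mapping.single (a, b, c') 1) \<union>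
      range (\<lambda>(z, a, b, c). Poly_Mapping.single (s z a, b, c) 1 - Poly_Mapping.single (a, b, c) z) \<union>
      range (\<lambda>(z, a, b, c). Poly_Mapping.single (a, s z b, c) 1 - Poly_Mapping.single (a, b, c) z) \<union>
      range (\<lambda>(z, a, b, c). Poly_Mapping.single (a, b, s z c) 1 - Poly_Mapping.single (a, b, c) z))"

text \<open>The multiplication of the tensor square of an algebra.\<close>
definition tensor_mult ::
    "('h::ring_1 \<times> 'h \<Rightarrow>\<^sub>0 'k::field) \<Rightarrow> ('h \<times> 'h \<Rightarrow>\<^sub>0 'k) \<Rightarrow> ('h \<times> 'h \<Rightarrow>\<^sub>0 'k)" where
  "tensor_mult u v =
     lin_ext fs_scale (\<lambda>(a, b). lin_ext fs_scale (\<lambda>(c, d). Poly_Mapping.single (a * c, b * d) 1) v) u"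

definition tensor_map ::
    "('h \<Rightarrow> 'h) \<Rightarrow> ('h \<times> 'h \<Rightarrow>\<^sub>0 'k::field) \<Rightarrow> ('h \<times> 'h \<Rightarrow>\<^sub>0 'k)" where
  "tensor_map \<Phi> = lin_ext fs_scale (\<lambda>(a, b). Poly_Mapping.single (\<Phi> a, \<Phi> b) 1)"


section \<open>Hopf algebras\<close>

text \<open>The underlying ring of the Hopf algebra is the type \<open>'h\<close>. The comultiplication takes values
  in the tensor square, so \<open>comult H h\<close> is a formal linear combination representing the coproduct of
  \<open>h\<close>; it enters the definitions below only through its class modulo \<open>tensor_eq\<close>.\<close>
record (overloaded) ('k::zero, 'h) hopf =
  scl :: "'k \<Rightarrow> 'h \<Rightarrow> 'h"
  comult :: "'h \<Rightarrow> ('h \<times> 'h \<Rightarrow>\<^sub>0 'k)"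
  counit :: "'h \<Rightarrow> 'k"
  antipode :: "'h \<Rightarrow> 'h"

locale hopf_algebra = vector_space "scl H"
  for H :: "('k::field, 'h::ring_1) hopf" +
  assumes scl_mult_left: "scl H c a * b = scl H c (a * b)"
    and scl_mult_right: "a * scl H c b = scl H c (a * b)"
    and comult_add: "tensor_eq (scl H) (comult H (a + b)) (comult H a + comult H b)"
    and comult_scl: "tensor_eq (scl H) (comult H (scl H c a)) (fs_scale c (comult H a))"
    and comult_one: "tensor_eq (scl H) (comult H 1) (Poly_Mapping.single (1, 1) 1)"
    and comult_mult: "tensor_eq (scl H) (comult H (a * b)) (tensor_mult (comult H a) (comult H b))"
    and counit_linear: "Vector_Spaces.linear (scl H) (*) (counit H)"
    and counit_one: "counit H 1 = 1"
    and counit_mult: "counit H (a * b) = counit H a * counit H b"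
    and coassoc: "tensor3_eq (scl H)
      (lin_ext fs_scale (\<lambda>(a, b).
         lin_ext fs_scale (\<lambda>(c, d). Poly_Mapping.single (c, d, b) 1) (comult H a)) (comult H h))
      (lin_ext fs_scale (\<lambda>(a, b).
         lin_ext fs_scale (\<lambda>(c, d). Poly_Mapping.single (a, c, d) 1) (comult H b)) (comult H h))"
    and counit_left: "lin_ext (scl H) (\<lambda>(a, b). scl H (counit H a) b) (comult H h) = h"
    and counit_right: "lin_ext (scl H) (\<lambda>(a, b). scl H (counit H b) a) (comult H h) = h"
    and antipode_linear: "Vector_Spaces.linear (scl H) (scl H) (antipode H)"
    and antipode_left:
      "lin_ext (scl H) (\<lambda>(a, b). antipode H a * b) (comult H h) = scl H (counit H h) 1"
    and antipode_right:
      "lin_ext (scl H) (\<lambda>(a, b). a * antipode H b) (comult H h) = scl H (counit H h) 1"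

definition hopf_subalgebra :: "('k::field, 'h::ring_1) hopf \<Rightarrow> 'h set \<Rightarrow> bool" where
  "hopf_subalgebra H B \<longleftrightarrow>
     module.subspace (scl H) B \<and> 1 \<in> B \<and> (\<forall>a\<in>B. \<forall>b\<in>B. a * b \<in> B) \<and>
     (\<forall>b\<in>B. \<exists>u\<in>tensor_formal B B. tensor_eq (scl H) (comult H b) u) \<and>
     antipode H ` B \<subseteq> B"

definition hopf_automorphism :: "('k::field, 'h::ring_1) hopf \<Rightarrow> ('h \<Rightarrow> 'h) \<Rightarrow> bool" where
  "hopf_automorphism H \<Phi> \<longleftrightarrow>
     bij \<Phi> \<and> Vector_Spaces.linear (scl H) (scl H) \<Phi> \<and> \<Phi> 1 = 1 \<and> (\<forall>a b. \<Phi> (a * b) = \<Phi> a * \<Phi> b) \<and>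
     (\<forall>h. tensor_eq (scl H) (comult H (\<Phi> h)) (tensor_map \<Phi> (comult H h))) \<and>
     (\<forall>h. counit H (\<Phi> h) = counit H h) \<and> (\<forall>h. antipode H (\<Phi> h) = \<Phi> (antipode H h))"

text \<open>\<open>H = B T\<close> is an exact factorization if the map from the tensor product of \<open>B\<close> and \<open>T\<close>
  to \<open>H\<close> induced by multiplication is bijective.\<close>
definition exact_factorization :: "('k::field, 'h::ring_1) hopf \<Rightarrow> 'h set \<Rightarrow> 'h set \<Rightarrow> bool" where
  "exact_factorization H B T \<longleftrightarrow> hopf_subalgebra H B \<and> hopf_subalgebra H T \<and>
     bij_betw (\<lambda>X. the_elem (lin_ext (scl H) (\<lambda>(b, t). b * t) ` X))
       (tensor_formal B T // tensor_rel (scl H) B T) UNIV"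


section \<open>Presentations of algebras\<close>

text \<open>With concatenation of words as the (additively written) monoid operation,
  \<open>'i list \<Rightarrow>\<^sub>0 'k\<close> is the free associative algebra on \<open>'i\<close>.\<close>

instantiation list :: (type) monoid_add
begin
definition zero_list :: "'a list" where "zero_list = []"
definition plus_list :: "'a list \<Rightarrow> 'a list \<Rightarrow> 'a list" where "plus_list v w = v @ w"
instance by standard (simp_all add: zero_list_def plus_list_def)
end

definition free_alg :: "'i set \<Rightarrow> ('i list \<Rightarrow>\<^sub>0 'k::field) set" where
  "free_alg A = {u. Poly_Mapping.keys u \<subseteq> lists A}"

definition var :: "'i \<Rightarrow> ('i list \<Rightarrow>\<^sub>0 'k::field)" where
  "var i = Poly_Mapping.single [i] 1"

definition rel_ideal :: "'i set \<Rightarrow> ('i list \<Rightarrow>\<^sub>0 'k::field) set \<Rightarrow> ('i list \<Rightarrow>\<^sub>0 'k) set" where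
  "rel_ideal A R = module.span fs_scale {a * r * b | a r b. a \<in> free_alg A \<and> r \<in> R \<and> b \<in> free_alg A}"

definition eval_free ::
    "('k \<Rightarrow> 'h \<Rightarrow> 'h) \<Rightarrow> ('i \<Rightarrow> 'h) \<Rightarrow> ('i list \<Rightarrow>\<^sub>0 'k::field) \<Rightarrow> 'h::ring_1" where
  "eval_free s \<gamma> = lin_ext s (\<lambda>w. prod_list (map \<gamma> w))"

text \<open>The algebra \<open>'h\<close> is generated by the \<open>\<gamma> i\<close> for \<open>i \<in> A\<close> subject to the relations \<open>R\<close>.\<close>
definition presented_by ::
    "('k \<Rightarrow> 'h \<Rightarrow> 'h::ring_1) \<Rightarrow> ('i \<Rightarrow> 'h) \<Rightarrow> 'i set \<Rightarrow> ('i list \<Rightarrow>\<^sub>0 'k::field) set \<Rightarrow> bool" where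
  "presented_by s \<gamma> A R \<longleftrightarrow>
     eval_free s \<gamma> ` free_alg A = UNIV \<and> {u \<in> free_alg A. eval_free s \<gamma> u = 0} = rel_ideal A R"


section \<open>The Hopf algebra of a third-type datum\<close>

text \<open>The last condition is an equation in the group algebra, whose underlying vector space consists
  of the formal linear combinations of group elements.\<close>
definition third_type_datum :: "('a, 'm) monoid_scheme \<Rightarrow> 'a \<Rightarrow> ('a \<Rightarrow> 'k::field) \<Rightarrow> bool" where
  "third_type_datum G g f \<longleftrightarrow>
     group G \<and> finite (carrier G) \<and>
     g \<in> carrier G \<and> (\<forall>t\<in>carrier G. g \<otimes>\<^bsub>G\<^esub> t = t \<otimes>\<^bsub>G\<^esub> g) \<and>
     f \<in> hom G \<lparr>carrier = UNIV, monoid.mult = (+), one = 0\<rparr> \<and> f g = 1 \<and>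
     (\<forall>t\<in>carrier G. fs_scale (f t ^ CHAR('k) - f t)
        (Poly_Mapping.single \<one>\<^bsub>G\<^esub> 1 - Poly_Mapping.single (g [^]\<^bsub>G\<^esub> CHAR('k)) 1) = 0)"

datatype 'a third_type_gen = Grp 'a | Skew

text \<open>The first two sets are the relations of the group algebra.\<close>
definition third_type_relations ::
    "('a, 'm) monoid_scheme \<Rightarrow> 'a \<Rightarrow> ('a \<Rightarrow> 'k::field) \<Rightarrow> ('a third_type_gen list \<Rightarrow>\<^sub>0 'k) set" where
  "third_type_relations G g f =
     {var (Grp t) * var (Grp t') - var (Grp (t \<otimes>\<^bsub>G\<^esub> t')) | t t'. t \<in> carrier G \<and> t' \<in> carrier G} \<union>
     {var (Grp \<one>\<^bsub>G\<^esub>) - 1} \<union>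
     {var (Grp t) * var Skew - var Skew * var (Grp t)
        - fs_scale (f t) (var (Grp t) * (1 - var (Grp g))) | t. t \<in> carrier G} \<union>
     {var Skew ^ CHAR('k) - var Skew}"

text \<open>\<open>H\<close> is the Hopf algebra attached to \<open>(G, g, f)\<close>, with \<open>\<iota>\<close> sending a group element to the
  corresponding generator and with skew-primitive generator \<open>x\<close>.\<close>
definition third_type_hopf_algebra ::
    "('a, 'm) monoid_scheme \<Rightarrow> 'a \<Rightarrow> ('a \<Rightarrow> 'k::field) \<Rightarrow> ('k, 'h::ring_1) hopf \<Rightarrow> ('a \<Rightarrow> 'h) \<Rightarrow> 'h \<Rightarrow> bool"
    where
  "third_type_hopf_algebra G g f H \<iota> x \<longleftrightarrow>
     hopf_algebra H \<and>
     presented_by (scl H) (case_third_type_gen \<iota> x) (Grp ` carrier G \<union> {Skew})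
       (third_type_relations G g f) \<and>
     (\<forall>t\<in>carrier G. tensor_eq (scl H) (comult H (\<iota> t)) (Poly_Mapping.single (\<iota> t, \<iota> t) 1) \<and>
        counit H (\<iota> t) = 1 \<and> antipode H (\<iota> t) = \<iota> (inv\<^bsub>G\<^esub> t)) \<and>
     tensor_eq (scl H) (comult H x) (Poly_Mapping.single (x, 1) 1 + Poly_Mapping.single (\<iota> g, x) 1) \<and>
     counit H x = 0 \<and> antipode H x = - (\<iota> (inv\<^bsub>G\<^esub> g) * x)"

definition rank_one_factor ::
    "('k::field, 'h::ring_1) hopf \<Rightarrow> ('a \<Rightarrow> 'h) \<Rightarrow> 'h \<Rightarrow> 'a set \<Rightarrow> 'h set" where
  "rank_one_factor H \<iota> x GB = hopf_subalgebra H hull (\<iota> ` GB \<union> {x})"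

definition group_subalgebra ::
    "('k::field, 'h::ring_1) hopf \<Rightarrow> ('a \<Rightarrow> 'h) \<Rightarrow> 'a set \<Rightarrow> 'h set" where
  "group_subalgebra H \<iota> \<Gamma> = module.span (scl H) (\<iota> ` \<Gamma>)"


section \<open>Factorizations and their equivalence\<close>

text \<open>The exact factorizations by proper Hopf subalgebras, oriented by requiring the first factor
  to be the rank-one factor. No condition on the form of the second factor is imposed.\<close>
definition oriented_factorizations ::
    "('a, 'm) monoid_scheme \<Rightarrow> 'a \<Rightarrow> ('k::field, 'h::ring_1) hopf \<Rightarrow> ('a \<Rightarrow> 'h) \<Rightarrow> 'h
      \<Rightarrow> ('h set \<times> 'h set) set" where
  "oriented_factorizations G g H \<iota> x =
     {(B, T). exact_factorization H B T \<and> B \<noteq> UNIV \<and> T \<noteq> UNIV \<and>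
        (\<exists>GB. subgroup GB G \<and> g \<in> GB \<and> B = rank_one_factor H \<iota> x GB)}"

definition hopf_equivalent ::
    "('k::field, 'h::ring_1) hopf \<Rightarrow> 'h set \<times> 'h set \<Rightarrow> 'h set \<times> 'h set \<Rightarrow> bool" where
  "hopf_equivalent H P Q \<longleftrightarrow>
     (\<exists>\<Phi>. hopf_automorphism H \<Phi> \<and> \<Phi> ` fst P = fst Q \<and> \<Phi> ` snd P = snd Q)"

definition factorization_equiv ::
    "('a, 'm) monoid_scheme \<Rightarrow> 'a \<Rightarrow> ('k::field, 'h::ring_1) hopf \<Rightarrow> ('a \<Rightarrow> 'h) \<Rightarrow> 'h
      \<Rightarrow> (('h set \<times> 'h set) \<times> ('h set \<times> 'h set)) set" where
  "factorization_equiv G g H \<iota> x =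
     {(P, Q). P \<in> oriented_factorizations G g H \<iota> x \<and> Q \<in> oriented_factorizations G g H \<iota> x \<and>
        hopf_equivalent H P Q}"

definition group_factorizations ::
    "('a, 'm) monoid_scheme \<Rightarrow> 'a \<Rightarrow> ('a set \<times> 'a set) set" where
  "group_factorizations G g =
     {(GB, \<Gamma>). subgroup GB G \<and> subgroup \<Gamma> G \<and> GB <#>\<^bsub>G\<^esub> \<Gamma> = carrier G \<and> GB \<inter> \<Gamma> = {\<one>\<^bsub>G\<^esub>} \<and>
        g \<in> GB \<and> \<Gamma> \<noteq> {\<one>\<^bsub>G\<^esub>}}"

definition aut_gf :: "('a, 'm) monoid_scheme \<Rightarrow> 'a \<Rightarrow> ('a \<Rightarrow> 'k) \<Rightarrow> ('a \<Rightarrow> 'a) set" where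
  "aut_gf G g f = {\<sigma> \<in> auto G. \<sigma> g = g \<and> (\<forall>t\<in>carrier G. f (\<sigma> t) = f t)}"

definition aut_gf_group ::
    "('a, 'm) monoid_scheme \<Rightarrow> 'a \<Rightarrow> ('a \<Rightarrow> 'k) \<Rightarrow> ('a \<Rightarrow> 'a) monoid" where
  "aut_gf_group G g f = (AutoGroup G)\<lparr>carrier := aut_gf G g f\<rparr>"

end

theory Submission
  imports Defs "HOL-Computational_Algebra.Primes"
begin

text \<open>Let \<open>k[G]\<close> be the span of \<open>\<iota> ` carrier G\<close>. A Hopf automorphism \<open>\<Phi>\<close> maps group-like elements to
  group-like elements and \<open>x\<close> to a skew-primitive element. The group-like elements of \<open>H\<close> are the
  \<open>\<iota> t\<close> (lemma \<open>grouplike_eq_iota\<close>) and the elements \<open>y\<close> with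
  \<open>\<Delta> y = y \<otimes> 1 + h \<otimes> y\<close> have the form \<open>a x + w\<close> with \<open>w\<close> in \<open>k[G]\<close>, where \<open>a \<noteq> 0\<close> forces \<open>h = g\<close>
  (lemma \<open>skew_primitive_form\<close>). So \<open>\<Phi>\<close> induces an automorphism \<open>\<sigma>\<close> of \<open>G\<close> that fixes \<open>g\<close>, and
  comparing coefficients in the image of the commutator relation gives \<open>a f(\<sigma> t) = f t\<close>; here \<open>a = 1\<close>
  because \<open>f g = 1\<close>. Conversely every \<open>\<sigma>\<close> fixing \<open>g\<close> and \<open>f\<close> respects the presentation and extends
  to \<open>H\<close> by \<open>x \<mapsto> x\<close>. Both factors of a factorization determine their groups, as the sets of
  group-like elements they contain, so equivalences of factorizations correspond to such \<open>\<sigma>\<close>.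

  The coalgebra structure is controlled by one operator. The presentation allows a character \<open>\<chi>\<close> of
  \<open>H\<close> with \<open>\<chi>(t) = 1\<close> and \<open>\<chi>(x) = 1\<close>; convolving the identity with it yields the algebra
  endomorphism \<open>\<tau>(z) = \<Sum> \<chi>(z\<^sub>1) z\<^sub>2\<close>, which fixes \<open>G\<close> and sends \<open>x\<close> to \<open>x + 1\<close>. Its fixed
  space is \<open>k[G]\<close>, and \<open>\<tau>\<^sup>p = id\<close>. A group-like \<open>z\<close> satisfies \<open>\<tau> z = \<chi>(z) z\<close>, hence
  \<open>\<chi>(z)\<^sup>p = 1\<close>, hence \<open>\<chi>(z) = 1\<close> and \<open>z\<close> lies in \<open>k[G]\<close>. A skew-primitive \<open>y\<close> satisfies
  \<open>\<tau> y = y + \<chi>(y)\<close>, hence \<open>y - \<chi>(y) x\<close> lies in \<open>k[G]\<close>.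

  That the fixed space is no larger rests on the linear independence of the monomials \<open>t x\<^sup>i\<close> with
  \<open>i < p\<close>, which is not visible in a presentation and needs a module. The functions \<open>\<phi>\<close> on \<open>G\<close> form
  one: \<open>t\<close> acts by translation and \<open>x\<close> by \<open>(\<phi> x)(s) = f(s) (\<phi>(g s) - \<phi>(s))\<close>. The relation
  \<open>x\<^sup>p = x\<close> holds on this module exactly by the condition \<open>(f(t)\<^sup>p - f(t)) (1 - g\<^sup>p) = 0\<close> (lemma
  \<open>skew_op_power\<close>). Evaluating at the neutral element yields functionals that pick the coefficients of
  \<open>x\<^sup>0\<close>, and composing them with the powers of \<open>\<tau>\<close> evaluates the coefficient polynomials at all
  elements of the prime field, which separates points of \<open>H\<close>.

  It remains to match the factorizations themselves. If \<open>H = B T\<close> is exact, then \<open>B\<close> and \<open>T\<close> share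
  only the scalars, so \<open>x\<close> is not in \<open>T\<close>; and a Hopf subalgebra without \<open>x\<close> is a group algebra,
  since applying \<open>\<tau> - id\<close> to an element outside \<open>k[G]\<close> lowers its degree until \<open>x\<close> can be isolated
  (lemma \<open>hopf_subalgebra_without_x\<close>). Conversely a group factorization \<open>G = U \<Gamma>\<close> gives an exact
  one, because an element of \<open>B \<otimes> k[\<Gamma>]\<close> is a sum of \<open>b\<^sub>r \<otimes> r\<close>, and the products \<open>b\<^sub>r r\<close> involve
  pairwise disjoint cosets \<open>U r\<close>.\<close>

section \<open>Formal linear combinations\<close>

lemma lookup_fs_scale [simp]: "Poly_Mapping.lookup (fs_scale c u) i = c * Poly_Mapping.lookup u i"
  by (simp add: fs_scale_def Poly_Mapping.map.rep_eq when_def)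

lemma fs_scale_single [simp]: "fs_scale c (Poly_Mapping.single i a) = Poly_Mapping.single i (c * a)"
  by (rule poly_mapping_eqI) (simp add: lookup_single when_def)

interpretation formal: vector_space "fs_scale :: 'k::field \<Rightarrow> ('i \<Rightarrow>\<^sub>0 'k) \<Rightarrow> ('i \<Rightarrow>\<^sub>0 'k)"
  by unfold_locales (auto intro!: poly_mapping_eqI simp: lookup_add algebra_simps)

interpretation scalars: vector_space "(*) :: 'k::field \<Rightarrow> 'k \<Rightarrow> 'k"
  by unfold_locales (auto simp: algebra_simps)

(* As a rewrite rule on products of scalars this reverses mult.assoc and makes the simplifier loop. *)
declare scalars.scale_scale [simp del]

lemma formal_expand:
  "u = (\<Sum>i\<in>Poly_Mapping.keys u. fs_scale (Poly_Mapping.lookup u i) (Poly_Mapping.single i 1))"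
proof (rule poly_mapping_eqI)
  fix j
  have "(\<Sum>i\<in>Poly_Mapping.keys u. Poly_Mapping.lookup (Poly_Mapping.single i (Poly_Mapping.lookup u i)) j) =
      (\<Sum>i\<in>Poly_Mapping.keys u. if i = j then Poly_Mapping.lookup u i else 0)"
    by (intro sum.cong) (auto simp: lookup_single when_def)
  also have "\<dots> = Poly_Mapping.lookup u j"
    by (auto simp: sum.delta in_keys_iff)
  finally show "Poly_Mapping.lookup u j = Poly_Mapping.lookup
      (\<Sum>i\<in>Poly_Mapping.keys u. fs_scale (Poly_Mapping.lookup u i) (Poly_Mapping.single i 1)) j"
    by (simp add: lookup_sum)
qed

lemma formal_in_subspace:
  assumes "module.subspace fs_scale W" "\<And>i. i \<in> Poly_Mapping.keys u \<Longrightarrow> Poly_Mapping.single i 1 \<in> W"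
  shows "u \<in> W"
  by (subst formal_expand, intro formal.subspace_sum formal.subspace_scale) (use assms in auto)

lemma subspace_keys_within: "module.subspace fs_scale {u :: 'i \<Rightarrow>\<^sub>0 'k::field. Poly_Mapping.keys u \<subseteq> A}"
proof (rule formal.subspaceI)
  fix u v :: "'i \<Rightarrow>\<^sub>0 'k" and c :: 'k
  assume u: "u \<in> {u. Poly_Mapping.keys u \<subseteq> A}" and v: "v \<in> {u. Poly_Mapping.keys u \<subseteq> A}"
  show "u + v \<in> {u. Poly_Mapping.keys u \<subseteq> A}"
    using u v Poly_Mapping.keys_add[of u v] by blast
  show "fs_scale c u \<in> {u. Poly_Mapping.keys u \<subseteq> A}"
    using u by (auto simp: in_keys_iff)
qed simp

context vector_space
begin

lemma lin_ext_eq_sum: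
  assumes "finite K" "Poly_Mapping.keys u \<subseteq> K"
  shows "lin_ext scale \<phi> u = (\<Sum>i\<in>K. scale (Poly_Mapping.lookup u i) (\<phi> i))"
  unfolding lin_ext_def
  by (rule sum.mono_neutral_left) (use assms in \<open>auto simp: in_keys_iff\<close>)

lemma linear_lin_ext: "Vector_Spaces.linear fs_scale scale (lin_ext scale \<phi>)"
proof -
  have "lin_ext scale \<phi> (u + v) = lin_ext scale \<phi> u + lin_ext scale \<phi> v" for u v
  proof -
    let ?K = "Poly_Mapping.keys u \<union> Poly_Mapping.keys v"
    have "lin_ext scale \<phi> (u + v) = (\<Sum>i\<in>?K. scale (Poly_Mapping.lookup (u + v) i) (\<phi> i))"
      using Poly_Mapping.keys_add[of u v] by (intro lin_ext_eq_sum) auto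
    also have "\<dots> = (\<Sum>i\<in>?K. scale (Poly_Mapping.lookup u i) (\<phi> i)) + (\<Sum>i\<in>?K. scale (Poly_Mapping.lookup v i) (\<phi> i))"
      by (simp add: lookup_add scale_left_distrib sum.distrib)
    also have "\<dots> = lin_ext scale \<phi> u + lin_ext scale \<phi> v"
      by (subst (1 2) lin_ext_eq_sum[where K = ?K]) auto
    finally show ?thesis .
  qed
  moreover have "lin_ext scale \<phi> (fs_scale c u) = scale c (lin_ext scale \<phi> u)" for c u
  proof -
    have "lin_ext scale \<phi> (fs_scale c u) = (\<Sum>i\<in>Poly_Mapping.keys u. scale (Poly_Mapping.lookup (fs_scale c u) i) (\<phi> i))"
      by (intro lin_ext_eq_sum) (auto simp: in_keys_iff)
    then show ?thesis by (simp only: lin_ext_def scale_sum_right lookup_fs_scale scale_scale)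
  qed
  ultimately show ?thesis
    by (simp add: linear_iff_module_hom module_hom_iff formal.module_axioms module_axioms)
qed

lemmas lin_ext_add = module_hom.add[OF module_hom_linearI[OF linear_lin_ext]]
  and lin_ext_scale = module_hom.scale[OF module_hom_linearI[OF linear_lin_ext]]
  and lin_ext_diff = module_hom.diff[OF module_hom_linearI[OF linear_lin_ext]]
  and lin_ext_zero [simp] = module_hom.zero[OF module_hom_linearI[OF linear_lin_ext]]
  and lin_ext_sum = module_hom.sum[OF module_hom_linearI[OF linear_lin_ext]]

lemma lin_ext_single [simp]: "lin_ext scale \<phi> (Poly_Mapping.single i c) = scale c (\<phi> i)"
  by (cases "c = 0") (auto simp: lin_ext_def)

lemma lin_ext_map_add: "lin_ext scale (\<lambda>i. \<phi> i + \<psi> i) u = lin_ext scale \<phi> u + lin_ext scale \<psi> u"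
  by (simp add: lin_ext_def scale_right_distrib sum.distrib)

lemma lin_ext_map_diff: "lin_ext scale (\<lambda>i. \<phi> i - \<psi> i) u = lin_ext scale \<phi> u - lin_ext scale \<psi> u"
  by (simp add: lin_ext_def scale_right_diff_distrib sum_subtractf)

lemma lin_ext_map_scale: "lin_ext scale (\<lambda>i. scale c (\<phi> i)) u = scale c (lin_ext scale \<phi> u)"
  by (simp add: lin_ext_def scale_sum_right mult.commute)

lemma lin_ext_in_subspace:
  "subspace W \<Longrightarrow> (\<And>i. i \<in> Poly_Mapping.keys u \<Longrightarrow> \<phi> i \<in> W) \<Longrightarrow> lin_ext scale \<phi> u \<in> W"
  unfolding lin_ext_def by (intro subspace_sum subspace_scale)

lemma linear_lin_ext_compose:
  assumes "Vector_Spaces.linear scale s' L"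
  shows "L (lin_ext scale \<phi> u) = lin_ext s' (\<lambda>i. L (\<phi> i)) u"
proof -
  interpret L: Vector_Spaces.linear scale s' L by fact
  show ?thesis by (simp add: lin_ext_def L.sum L.scale)
qed

lemma lin_ext_lin_ext:
  "lin_ext scale \<phi> (lin_ext fs_scale \<psi> u) = lin_ext scale (\<lambda>i. lin_ext scale \<phi> (\<psi> i)) u"
  by (rule formal.linear_lin_ext_compose[OF linear_lin_ext])

lemma linear_formal_eq:
  assumes "Vector_Spaces.linear fs_scale scale F" "Vector_Spaces.linear fs_scale scale F'"
    and "\<And>i. i \<in> Poly_Mapping.keys u \<Longrightarrow> F (Poly_Mapping.single i 1) = F' (Poly_Mapping.single i 1)"
  shows "F u = F' u"
proof -
  interpret F: Vector_Spaces.linear fs_scale scale F by fact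
  interpret F': Vector_Spaces.linear fs_scale scale F' by fact
  show ?thesis
    by (subst (1 2) formal_expand) (simp add: F.sum F'.sum F.scale F'.scale assms(3) del: fs_scale_single)
qed

end

lemma lin_ext_commute:
  fixes \<phi> :: "'i \<Rightarrow> 'j \<Rightarrow> 'v::ab_group_add"
  assumes "vector_space s"
  shows "lin_ext s (\<lambda>i. lin_ext s (\<lambda>j. \<phi> i j) v) u = lin_ext s (\<lambda>j. lin_ext s (\<lambda>i. \<phi> i j) u) v"
proof -
  interpret vector_space s by fact
  show ?thesis
    unfolding lin_ext_def
    by (simp only: scale_sum_right scale_left_commute[of "Poly_Mapping.lookup u _"])
      (rule sum.swap)
qed

lemma linearI:
  assumes "vector_space s" "vector_space s'"
    and "\<And>a b. F (a + b) = F a + F b" "\<And>c a. F (s c a) = s' c (F a)"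
  shows "Vector_Spaces.linear s s' F"
  using assms by (simp add: linear_iff_module_hom module_hom_iff module_iff_vector_space)

lemma linear_compose:
  "Vector_Spaces.linear s s' F \<Longrightarrow> Vector_Spaces.linear s' s'' F' \<Longrightarrow> Vector_Spaces.linear s s'' (\<lambda>a. F' (F a))"
  using module_hom_compose[of s s' F s'' F'] by (simp add: linear_iff_module_hom o_def)

section \<open>Algebras and presentations\<close>

locale assoc_algebra = vector_space s
  for s :: "'k::field \<Rightarrow> 'r::ring_1 \<Rightarrow> 'r" +
  assumes scale_mult_left: "s c a * b = s c (a * b)"
    and scale_mult_right: "a * s c b = s c (a * b)"

interpretation scalars: assoc_algebra "(*) :: 'k::field \<Rightarrow> 'k \<Rightarrow> 'k"
  by unfold_locales auto

definition alg_hom :: "('k::field \<Rightarrow> 'r::ring_1 \<Rightarrow> 'r) \<Rightarrow> ('k \<Rightarrow> 'q::ring_1 \<Rightarrow> 'q) \<Rightarrow> ('r \<Rightarrow> 'q) \<Rightarrow> bool" where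
  "alg_hom s s' \<psi> \<longleftrightarrow>
     Vector_Spaces.linear s s' \<psi> \<and> \<psi> 1 = 1 \<and> (\<forall>a b. \<psi> (a * b) = \<psi> a * \<psi> b)"

lemma alg_hom_linear: "alg_hom s s' \<psi> \<Longrightarrow> Vector_Spaces.linear s s' \<psi>"
  and alg_hom_one: "alg_hom s s' \<psi> \<Longrightarrow> \<psi> 1 = 1"
  and alg_hom_mult: "alg_hom s s' \<psi> \<Longrightarrow> \<psi> (a * b) = \<psi> a * \<psi> b"
  by (auto simp: alg_hom_def)

lemma alg_hom_add: "alg_hom s s' \<psi> \<Longrightarrow> \<psi> (a + b) = \<psi> a + \<psi> b"
  and alg_hom_scale: "alg_hom s s' \<psi> \<Longrightarrow> \<psi> (s c a) = s' c (\<psi> a)"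
  and alg_hom_diff: "alg_hom s s' \<psi> \<Longrightarrow> \<psi> (a - b) = \<psi> a - \<psi> b"
  and alg_hom_zero: "alg_hom s s' \<psi> \<Longrightarrow> \<psi> 0 = 0"
  using module_hom_linearI[OF alg_hom_linear]
  by (metis module_hom.add module_hom.scale module_hom.diff module_hom.zero)+

lemma alg_hom_power: "alg_hom s s' \<psi> \<Longrightarrow> \<psi> (a ^ n) = \<psi> a ^ n"
  by (induction n) (auto simp: alg_hom_one alg_hom_mult)

lemma alg_hom_compose: "alg_hom s s' \<psi> \<Longrightarrow> alg_hom s' s'' \<psi>' \<Longrightarrow> alg_hom s s'' (\<lambda>a. \<psi>' (\<psi> a))"
  using module_hom_compose[of s s' \<psi> s'' \<psi>']
  by (auto simp: alg_hom_def linear_iff_module_hom o_def)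

lemma subspace_free_alg: "module.subspace fs_scale (free_alg A)"
  unfolding free_alg_def by (rule subspace_keys_within)

lemma free_alg_mult: "u \<in> free_alg A \<Longrightarrow> v \<in> free_alg A \<Longrightarrow> u * v \<in> free_alg A"
  using keys_mult[of u v] by (fastforce simp: free_alg_def plus_list_def)

lemma free_alg_one: "1 \<in> free_alg A"
  by (simp add: free_alg_def zero_list_def)

lemma free_alg_var: "i \<in> A \<Longrightarrow> var i \<in> free_alg A"
  by (simp add: free_alg_def var_def)

context assoc_algebra
begin

lemma lin_ext_mult_left: "a * lin_ext s \<phi> u = lin_ext s (\<lambda>i. a * \<phi> i) u"
  by (simp add: lin_ext_def sum_distrib_left scale_mult_right)

lemma lin_ext_mult_right: "lin_ext s \<phi> u * a = lin_ext s (\<lambda>i. \<phi> i * a) u"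
  by (simp add: lin_ext_def sum_distrib_right scale_mult_left)

lemma linear_mult_left: "Vector_Spaces.linear s s (\<lambda>b. a * b)"
  by (rule linearI) (auto simp: vector_space_axioms distrib_left scale_mult_right)

lemma linear_mult_right: "Vector_Spaces.linear s s (\<lambda>a. a * b)"
  by (rule linearI) (auto simp: vector_space_axioms distrib_right scale_mult_left)

lemma mult_in_subspace:
  assumes W: "subspace W" and ab: "a \<in> span S" "b \<in> span T" and ST: "\<And>p q. p \<in> S \<Longrightarrow> q \<in> T \<Longrightarrow> p * q \<in> W"
  shows "a * b \<in> W"
proof -
  have "p * b \<in> W" if "p \<in> S" for p
    using span_subspace_induct[OF ab(2), of "{b. p * b \<in> W}"] that ST
      module_hom.subspace_linear_preimage[OF module_hom_linearI[OF linear_mult_left] W] by auto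
  then show ?thesis
    using span_subspace_induct[OF ab(1), of "{a. a * b \<in> W}"]
      module_hom.subspace_linear_preimage[OF module_hom_linearI[OF linear_mult_right] W] by auto
qed

end

interpretation formal_alg: assoc_algebra
  "fs_scale :: 'k::field \<Rightarrow> ('i::monoid_add \<Rightarrow>\<^sub>0 'k) \<Rightarrow> ('i \<Rightarrow>\<^sub>0 'k)"
proof
  have mult_expand: "u * v = (\<Sum>i\<in>K. \<Sum>j\<in>L.
      Poly_Mapping.single (i + j) (Poly_Mapping.lookup u i * Poly_Mapping.lookup v j))"
    if "finite K" "finite L" "Poly_Mapping.keys u \<subseteq> K" "Poly_Mapping.keys v \<subseteq> L"
    for u v :: "'i \<Rightarrow>\<^sub>0 'k" and K L
  proof -
    have "u = (\<Sum>i\<in>K. Poly_Mapping.single i (Poly_Mapping.lookup u i))"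
      using formal.lin_ext_eq_sum[OF that(1,3), of "\<lambda>i. Poly_Mapping.single i 1"] formal_expand[of u]
      by (simp add: lin_ext_def)
    moreover have "v = (\<Sum>j\<in>L. Poly_Mapping.single j (Poly_Mapping.lookup v j))"
      using formal.lin_ext_eq_sum[OF that(2,4), of "\<lambda>i. Poly_Mapping.single i 1"] formal_expand[of v]
      by (simp add: lin_ext_def)
    ultimately have "u * v = (\<Sum>i\<in>K. Poly_Mapping.single i (Poly_Mapping.lookup u i)) *
        (\<Sum>j\<in>L. Poly_Mapping.single j (Poly_Mapping.lookup v j))"
      by metis
    then show ?thesis by (simp add: sum_product mult_single)
  qed
  fix c :: 'k and u v :: "'i \<Rightarrow>\<^sub>0 'k"
  have keys: "Poly_Mapping.keys (fs_scale c w) \<subseteq> Poly_Mapping.keys w" for w :: "'i \<Rightarrow>\<^sub>0 'k"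
    by (auto simp: in_keys_iff)
  let ?K = "Poly_Mapping.keys u" and ?L = "Poly_Mapping.keys v"
  have "fs_scale c u * v = (\<Sum>i\<in>?K. \<Sum>j\<in>?L.
      fs_scale c (Poly_Mapping.single (i + j) (Poly_Mapping.lookup u i * Poly_Mapping.lookup v j)))"
    by (subst mult_expand[of ?K ?L]) (simp_all add: keys mult.assoc)
  also have "\<dots> = fs_scale c (u * v)"
    by (subst mult_expand[of ?K ?L]) (simp_all only: formal.scale_sum_right finite_keys subset_refl)
  finally show "fs_scale c u * v = fs_scale c (u * v)" .
  have "u * fs_scale c v = (\<Sum>i\<in>?K. \<Sum>j\<in>?L.
      fs_scale c (Poly_Mapping.single (i + j) (Poly_Mapping.lookup u i * Poly_Mapping.lookup v j)))"
    by (subst mult_expand[of ?K ?L]) (simp_all add: keys mult.left_commute[of _ c])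
  also have "\<dots> = fs_scale c (u * v)"
    by (subst mult_expand[of ?K ?L]) (simp_all only: formal.scale_sum_right finite_keys subset_refl)
  finally show "u * fs_scale c v = fs_scale c (u * v)" .
qed

context assoc_algebra
begin

lemma eval_free_single [simp]:
  "eval_free s \<gamma> (Poly_Mapping.single w c) = s c (prod_list (map \<gamma> w))"
  by (simp add: eval_free_def)

lemma alg_hom_eval_free: "alg_hom fs_scale s (eval_free s \<gamma>)"
proof -
  have lin: "Vector_Spaces.linear fs_scale s (eval_free s \<gamma>)"
    unfolding eval_free_def by (rule linear_lin_ext)
  have left: "eval_free s \<gamma> (Poly_Mapping.single w 1 * v) = eval_free s \<gamma> (Poly_Mapping.single w 1) * eval_free s \<gamma> v"
    for w v
    by (rule linear_formal_eq[OF linear_compose[OF formal_alg.linear_mult_left lin] linear_compose[OF lin linear_mult_left]])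
      (simp add: mult_single plus_list_def)
  have "eval_free s \<gamma> (u * v) = eval_free s \<gamma> u * eval_free s \<gamma> v" for u v
    by (rule linear_formal_eq[OF linear_compose[OF formal_alg.linear_mult_right lin] linear_compose[OF lin linear_mult_right]])
      (rule left)
  moreover have "eval_free s \<gamma> 1 = 1"
    by (simp flip: single_one add: zero_list_def)
  ultimately show ?thesis
    using lin by (simp add: alg_hom_def)
qed

lemma eval_free_var [simp]: "eval_free s \<gamma> (var i) = \<gamma> i"
  by (simp add: var_def)

lemma eval_free_rel_ideal:
  assumes "\<And>r. r \<in> R \<Longrightarrow> eval_free s \<gamma> r = 0" "u \<in> rel_ideal A R"
  shows "eval_free s \<gamma> u = 0"
proof -
  note hom = alg_hom_eval_free[of \<gamma>]
  have "eval_free s \<gamma> v = 0"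
    if "v \<in> {a * r * b |a r b. a \<in> free_alg A \<and> r \<in> R \<and> b \<in> free_alg A}" for v
    using that assms(1) by (auto simp: alg_hom_mult[OF hom])
  then show ?thesis
    using module_hom.eq_0_on_span[OF module_hom_linearI[OF alg_hom_linear[OF hom]]] assms(2)
    unfolding rel_ideal_def by blast
qed

text \<open>The words in the generators span the algebra, and a word is built by multiplication with
  generators from the left.\<close>
lemma presented_induct [consumes 1, case_names one add scale gen]:
  assumes "presented_by s \<gamma> A R"
    and "P 1" and add: "\<And>a b. P a \<Longrightarrow> P b \<Longrightarrow> P (a + b)" and scale: "\<And>c a. P a \<Longrightarrow> P (s c a)"
    and gen: "\<And>i a. i \<in> A \<Longrightarrow> P a \<Longrightarrow> P (\<gamma> i * a)"
  shows "P z"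
proof -
  have "z \<in> eval_free s \<gamma> ` free_alg A"
    using assms(1) unfolding presented_by_def by simp
  then obtain u where u: "u \<in> free_alg A" and z: "z = eval_free s \<gamma> u" by blast
  have words: "P (prod_list (map \<gamma> w))" if "w \<in> lists A" for w
    using that by (induction w) (auto intro: gen \<open>P 1\<close>)
  have "P 0" using scale[OF \<open>P 1\<close>, of 0] by simp
  then have sub: "subspace {a. P a}"
    by (intro subspaceI) (auto intro: add scale)
  have "z \<in> {a. P a}"
    unfolding z eval_free_def
    by (rule lin_ext_in_subspace[OF sub]) (use u words in \<open>auto simp: free_alg_def subset_iff\<close>)
  then show ?thesis by simp
qed

end

text \<open>The universal property: two representatives of an element differ by an element of the ideal of
  relations, on which evaluation in the second algebra vanishes.\<close>
lemma presented_lift: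
  assumes "assoc_algebra s" "assoc_algebra s'" and pres: "presented_by s \<gamma> A R"
    and rel: "\<And>r. r \<in> R \<Longrightarrow> eval_free s' \<gamma>' r = 0"
  obtains \<psi> where "alg_hom s s' \<psi>" "\<And>i. i \<in> A \<Longrightarrow> \<psi> (\<gamma> i) = \<gamma>' i"
proof -
  interpret S: assoc_algebra s by fact
  interpret S': assoc_algebra s' by fact
  define E where "E = eval_free s \<gamma>"
  define E' where "E' = eval_free s' \<gamma>'"
  have E: "alg_hom fs_scale s E" and E': "alg_hom fs_scale s' E'"
    unfolding E_def E'_def by (rule S.alg_hom_eval_free S'.alg_hom_eval_free)+
  define lift where "lift z = (SOME u. u \<in> free_alg A \<and> E u = z)" for z
  have lift: "lift z \<in> free_alg A" "E (lift z) = z" for z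
  proof -
    have "z \<in> E ` free_alg A"
      using pres unfolding presented_by_def E_def by simp
    then have "\<exists>u. u \<in> free_alg A \<and> E u = z" by blast
    from someI_ex[OF this] show "lift z \<in> free_alg A" "E (lift z) = z" unfolding lift_def by auto
  qed
  define \<psi> where "\<psi> z = E' (lift z)" for z
  have \<psi>: "\<psi> (E u) = E' u" if "u \<in> free_alg A" for u
  proof -
    have "u - lift (E u) \<in> {u \<in> free_alg A. E u = 0}"
      using that lift[of "E u"] formal.subspace_diff[OF subspace_free_alg]
      by (auto simp: alg_hom_diff[OF E])
    then have "u - lift (E u) \<in> rel_ideal A R"
      using pres unfolding presented_by_def E_def by simp
    then have "E' (u - lift (E u)) = 0"
      unfolding E'_def using rel by (rule S'.eval_free_rel_ideal[rotated])
    then show ?thesis by (simp add: \<psi>_def alg_hom_diff[OF E'])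
  qed
  have sub: "u + v \<in> free_alg A" "fs_scale c u \<in> free_alg A" if "u \<in> free_alg A" "v \<in> free_alg A"
    for u v and c
    using that by (auto intro: formal.subspace_add[OF subspace_free_alg] formal.subspace_scale[OF subspace_free_alg])
  have "\<psi> (a + b) = \<psi> a + \<psi> b" for a b
    using \<psi>[OF sub(1)[OF lift(1)[of a] lift(1)[of b]]]
    by (simp add: alg_hom_add[OF E] alg_hom_add[OF E'] lift(2) \<psi>_def)
  moreover have "\<psi> (s c a) = s' c (\<psi> a)" for c a
    using \<psi>[OF sub(2)[OF lift(1)[of a] lift(1)[of a]], of c]
    by (simp add: alg_hom_scale[OF E] alg_hom_scale[OF E'] lift(2) \<psi>_def)
  moreover have "\<psi> (a * b) = \<psi> a * \<psi> b" for a b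
    using \<psi>[OF free_alg_mult[OF lift(1)[of a] lift(1)[of b]]]
    by (simp add: alg_hom_mult[OF E] alg_hom_mult[OF E'] lift(2) \<psi>_def)
  moreover have "\<psi> 1 = 1"
    using \<psi>[OF free_alg_one] by (simp add: alg_hom_one[OF E] alg_hom_one[OF E'])
  ultimately have "alg_hom s s' \<psi>"
    by (auto simp: alg_hom_def intro!: linearI S.vector_space_axioms S'.vector_space_axioms)
  moreover have "\<psi> (\<gamma> i) = \<gamma>' i" if "i \<in> A" for i
    using \<psi>[OF free_alg_var[OF that]] by (simp add: E_def E'_def)
  ultimately show ?thesis by (rule that)
qed

section \<open>Tensor squares\<close>

abbreviation tens :: "'h \<Rightarrow> 'h \<Rightarrow> ('h \<times> 'h \<Rightarrow>\<^sub>0 'k::field)" where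
  "tens a b \<equiv> Poly_Mapping.single (a, b) 1"

text \<open>Bilinearity modulo a subspace \<open>W\<close>. The case \<open>W = {0}\<close> serves for maps out of the tensor square
  into a vector space; for maps between tensor squares \<open>W\<close> is the space of bilinearity relations, so
  that representatives can be manipulated without passing to the quotient.\<close>
definition bilinear_mod ::
    "('k::field \<Rightarrow> 'h \<Rightarrow> 'h) \<Rightarrow> ('k \<Rightarrow> 'v \<Rightarrow> 'v) \<Rightarrow> 'v set \<Rightarrow> ('h::ab_group_add \<Rightarrow> 'h \<Rightarrow> 'v::ab_group_add) \<Rightarrow> bool" where
  "bilinear_mod s s' W \<beta> \<longleftrightarrow>
     (\<forall>a a' b. \<beta> (a + a') b - \<beta> a b - \<beta> a' b \<in> W) \<and>
     (\<forall>a b b'. \<beta> a (b + b') - \<beta> a b - \<beta> a b' \<in> W) \<and>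
     (\<forall>c a b. \<beta> (s c a) b - s' c (\<beta> a b) \<in> W) \<and>
     (\<forall>c a b. \<beta> a (s c b) - s' c (\<beta> a b) \<in> W)"

lemma subspace_tensor_null: "module.subspace fs_scale (tensor_null s B T)"
  unfolding tensor_null_def by (rule formal.subspace_span)

lemma tens_add_left_null:
    "a \<in> B \<Longrightarrow> a' \<in> B \<Longrightarrow> b \<in> T \<Longrightarrow> tens (a + a') b - tens a b - tens a' b \<in> tensor_null s B T"
  and tens_add_right_null:
    "a \<in> B \<Longrightarrow> b \<in> T \<Longrightarrow> b' \<in> T \<Longrightarrow> tens a (b + b') - tens a b - tens a b' \<in> tensor_null s B T"
  and tens_scale_left_null:
    "a \<in> B \<Longrightarrow> b \<in> T \<Longrightarrow> tens (s c a) b - fs_scale c (tens a b) \<in> tensor_null s B T"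
  and tens_scale_right_null:
    "a \<in> B \<Longrightarrow> b \<in> T \<Longrightarrow> tens a (s c b) - fs_scale c (tens a b) \<in> tensor_null s B T"
  unfolding tensor_null_def fs_scale_single mult_1_right
  by (rule formal.span_base; blast)+

lemma bilinear_mod_tens: "bilinear_mod s fs_scale (tensor_null s UNIV UNIV) tens"
  unfolding bilinear_mod_def
  by (intro conjI allI tens_add_left_null tens_add_right_null tens_scale_left_null tens_scale_right_null UNIV_I)

text \<open>The universal property of the tensor product, on representatives.\<close>
lemma tensor_null_lin_ext_mod:
  assumes "vector_space s'" and W: "module.subspace s' W" and \<beta>: "bilinear_mod s s' W \<beta>"
    and u: "u \<in> tensor_null s B T"
  shows "lin_ext s' (\<lambda>(a, b). \<beta> a b) u \<in> W"
proof -
  interpret V: vector_space s' by fact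
  let ?L = "lin_ext s' (\<lambda>(a, b). \<beta> a b)"
  have sub: "formal.subspace {u. ?L u \<in> W}"
    by (rule module_hom.subspace_linear_preimage[OF module_hom_linearI[OF V.linear_lin_ext] W])
  have scl: "?L (Poly_Mapping.single (a, b) c) = s' c (\<beta> a b)" for a b c
    by simp
  have "u \<in> {u. ?L u \<in> W}"
    by (rule formal.span_subspace_induct[OF u[unfolded tensor_null_def] sub])
      (use \<beta> in \<open>auto simp: bilinear_mod_def V.lin_ext_diff\<close>)
  then show ?thesis by simp
qed

lemma tensor_eq_iff: "tensor_eq s u v \<longleftrightarrow> u - v \<in> tensor_null s UNIV UNIV"
  by (simp add: tensor_eq_def tensor_rel_def tensor_formal_def)

lemma tensor_eq_refl [simp]: "tensor_eq s u u"
  by (simp add: tensor_eq_iff formal.subspace_0[OF subspace_tensor_null])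

lemma tensor_eq_sym: "tensor_eq s u v \<Longrightarrow> tensor_eq s v u"
  unfolding tensor_eq_iff using formal.subspace_neg[OF subspace_tensor_null] by fastforce

lemma tensor_eq_trans [trans]: "tensor_eq s u v \<Longrightarrow> tensor_eq s v w \<Longrightarrow> tensor_eq s u w"
  unfolding tensor_eq_iff using formal.subspace_add[OF subspace_tensor_null, of "u - v" s _ _ "v - w"] by simp

lemma tensor_eq_add: "tensor_eq s u v \<Longrightarrow> tensor_eq s u' v' \<Longrightarrow> tensor_eq s (u + u') (v + v')"
  unfolding tensor_eq_iff
  using formal.subspace_add[OF subspace_tensor_null, of "u - v" s _ _ "u' - v'"] by (simp add: algebra_simps)

lemma tensor_eq_scale: "tensor_eq s u v \<Longrightarrow> tensor_eq s (fs_scale c u) (fs_scale c v)"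
  unfolding tensor_eq_iff formal.scale_right_diff_distrib[symmetric]
  by (rule formal.subspace_scale[OF subspace_tensor_null])

lemma tensor_eq_lin_ext_mod:
  assumes "bilinear_mod s fs_scale (tensor_null s UNIV UNIV) \<beta>" "tensor_eq s u v"
  shows "tensor_eq s (lin_ext fs_scale (\<lambda>(a, b). \<beta> a b) u) (lin_ext fs_scale (\<lambda>(a, b). \<beta> a b) v)"
  using tensor_null_lin_ext_mod[OF formal.vector_space_axioms subspace_tensor_null assms(1)] assms(2)
  unfolding tensor_eq_iff formal.lin_ext_diff[symmetric] by blast

lemma tensor_null_lin_ext:
  assumes "vector_space s'" "bilinear_mod s s' {0} \<beta>" "u \<in> tensor_null s B T"
  shows "lin_ext s' (\<lambda>(a, b). \<beta> a b) u = 0"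
  using tensor_null_lin_ext_mod[OF assms(1) module.subspace_single_0 assms(2,3)] assms(1)
  by (simp add: module_iff_vector_space)

lemma tensor_eq_lin_ext:
  assumes "vector_space s'" "bilinear_mod s s' {0} \<beta>" "tensor_eq s u v"
  shows "lin_ext s' (\<lambda>(a, b). \<beta> a b) u = lin_ext s' (\<lambda>(a, b). \<beta> a b) v"
proof -
  interpret V: vector_space s' by fact
  show ?thesis
    using tensor_null_lin_ext[OF assms(1,2)] assms(3) unfolding tensor_eq_iff
    by (metis V.lin_ext_diff eq_iff_diff_eq_0)
qed

lemma bilinearI:
  assumes "\<And>a a' b. \<beta> (a + a') b = \<beta> a b + \<beta> a' b" "\<And>a b b'. \<beta> a (b + b') = \<beta> a b + \<beta> a b'"
    and "\<And>c a b. \<beta> (s c a) b = s' c (\<beta> a b)" "\<And>c a b. \<beta> a (s c b) = s' c (\<beta> a b)"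
  shows "bilinear_mod s s' {0} \<beta>"
  using assms by (simp add: bilinear_mod_def)

lemma subspace_tensor_formal: "module.subspace fs_scale (tensor_formal B T)"
  unfolding tensor_formal_def by (rule subspace_keys_within)

lemma (in vector_space) lin_ext_tensor_mult:
  "lin_ext scale (\<lambda>(a, b). \<beta> a b) (tensor_mult u v) =
     lin_ext scale (\<lambda>(a, b). lin_ext scale (\<lambda>(c, d). \<beta> (a * c) (b * d)) v) u"
  by (simp add: tensor_mult_def lin_ext_lin_ext case_prod_unfold)

lemma tensor_mult_tens [simp]: "tensor_mult (tens a b) (tens c d) = tens (a * c) (b * d)"
  by (simp add: tensor_mult_def)

lemma tensor_mult_in_formal:
  assumes "u \<in> tensor_formal B T" "v \<in> tensor_formal B T"
    and "\<And>a b. a \<in> B \<Longrightarrow> b \<in> B \<Longrightarrow> a * b \<in> B" "\<And>a b. a \<in> T \<Longrightarrow> b \<in> T \<Longrightarrow> a * b \<in> T"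
  shows "tensor_mult u v \<in> tensor_formal B T"
  unfolding tensor_mult_def case_prod_unfold
  by (intro formal.lin_ext_in_subspace subspace_tensor_formal)
    (use assms in \<open>auto simp: tensor_formal_def subset_iff\<close>)

lemma tensor_map_add: "tensor_map \<Phi> (u + v) = tensor_map \<Phi> u + tensor_map \<Phi> v"
  and tensor_map_scale: "tensor_map \<Phi> (fs_scale c u) = fs_scale c (tensor_map \<Phi> u)"
  and tensor_map_single [simp]: "tensor_map \<Phi> (Poly_Mapping.single (a, b) c) = Poly_Mapping.single (\<Phi> a, \<Phi> b) c"
  by (simp_all add: tensor_map_def formal.lin_ext_add formal.lin_ext_scale)

lemma tensor_map_mult:
  assumes "\<And>a b. \<Phi> (a * b) = \<Phi> a * \<Phi> b"
  shows "tensor_map \<Phi> (tensor_mult u v) = tensor_mult (tensor_map \<Phi> u) (tensor_map \<Phi> v)"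
  by (simp add: tensor_mult_def tensor_map_def formal.lin_ext_lin_ext case_prod_unfold assms)

lemma tensor_map_cong:
  assumes \<Phi>: "Vector_Spaces.linear s s \<Phi>" and "tensor_eq s u v"
  shows "tensor_eq s (tensor_map \<Phi> u) (tensor_map \<Phi> v)"
  unfolding tensor_map_def
proof (rule tensor_eq_lin_ext_mod[OF _ assms(2)])
  interpret \<Phi>: Vector_Spaces.linear s s \<Phi> by fact
  show "bilinear_mod s fs_scale (tensor_null s UNIV UNIV) (\<lambda>a b. tens (\<Phi> a) (\<Phi> b))"
    using bilinear_mod_tens[of s] by (simp only: bilinear_mod_def \<Phi>.add \<Phi>.scale simp_thms)
qed

context assoc_algebra
begin

lemma bilinear_mod_tens_mult:
  "bilinear_mod s fs_scale (tensor_null s UNIV UNIV) (\<lambda>a b. tens (a * c) (b * d))"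
  "bilinear_mod s fs_scale (tensor_null s UNIV UNIV) (\<lambda>a b. tens (c * a) (d * b))"
  using bilinear_mod_tens[of s]
  by (simp_all only: bilinear_mod_def distrib_left distrib_right scale_mult_left scale_mult_right simp_thms)

lemma bilinear_mod_lin_ext:
  assumes "\<And>i. bilinear_mod s fs_scale W (\<beta> i)" "formal.subspace W"
  shows "bilinear_mod s fs_scale W (\<lambda>a b. lin_ext fs_scale (\<lambda>i. \<beta> i a b) v)"
  unfolding bilinear_mod_def formal.lin_ext_map_diff[symmetric] formal.lin_ext_map_scale[symmetric]
  by (intro conjI allI formal.lin_ext_in_subspace[OF assms(2)])
    (use assms(1) in \<open>auto simp only: bilinear_mod_def\<close>)

text \<open>In each argument the product is a linear combination of maps that are bilinear up to the
  bilinearity relations.\<close>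
lemma tensor_mult_cong:
  assumes "tensor_eq s u u'" "tensor_eq s v v'"
  shows "tensor_eq s (tensor_mult u v) (tensor_mult u' v')"
proof -
  have "tensor_eq s (tensor_mult u v) (tensor_mult u' v)"
    unfolding tensor_mult_def case_prod_unfold
    by (rule tensor_eq_lin_ext_mod[OF _ assms(1), unfolded case_prod_unfold])
      (intro bilinear_mod_lin_ext bilinear_mod_tens_mult subspace_tensor_null)
  moreover have "tensor_eq s (tensor_mult u' v) (tensor_mult u' v')"
    unfolding tensor_mult_def case_prod_unfold
    by (subst (1 2) lin_ext_commute[OF formal.vector_space_axioms],
        rule tensor_eq_lin_ext_mod[OF _ assms(2), unfolded case_prod_unfold])
      (intro bilinear_mod_lin_ext bilinear_mod_tens_mult subspace_tensor_null)
  ultimately show ?thesis by (rule tensor_eq_trans)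
qed

end

lemma tensor3_eq_lin_ext:
  assumes "vector_space s'" "tensor3_eq s u v"
    and "\<And>b c. Vector_Spaces.linear s s' (\<lambda>a. \<beta> a b c)"
    and "\<And>a c. Vector_Spaces.linear s s' (\<lambda>b. \<beta> a b c)"
    and "\<And>a b. Vector_Spaces.linear s s' (\<lambda>c. \<beta> a b c)"
  shows "lin_ext s' (\<lambda>(a, b, c). \<beta> a b c) u = lin_ext s' (\<lambda>(a, b, c). \<beta> a b c) v"
proof -
  interpret V: vector_space s' by fact
  let ?L = "lin_ext s' (\<lambda>(a, b, c). \<beta> a b c)"
  have mult: "\<beta> (a + a') b c = \<beta> a b c + \<beta> a' b c" "\<beta> a (b + b') c = \<beta> a b c + \<beta> a b' c"
    "\<beta> a b (c + c') = \<beta> a b c + \<beta> a b c'"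
    "\<beta> (s z a) b c = s' z (\<beta> a b c)" "\<beta> a (s z b) c = s' z (\<beta> a b c)" "\<beta> a b (s z c) = s' z (\<beta> a b c)"
    for a a' b b' c c' z
    using assms(3-5)[THEN module_hom_linearI, THEN module_hom.add]
      assms(3-5)[THEN module_hom_linearI, THEN module_hom.scale] by auto
  have "?L (u - v) = 0"
    by (rule module_hom.eq_0_on_span[OF module_hom_linearI[OF V.linear_lin_ext] _ assms(2)[unfolded tensor3_eq_def]])
      (auto simp: V.lin_ext_diff mult)
  then show ?thesis by (simp add: V.lin_ext_diff)
qed

section \<open>Hopf algebras\<close>

context hopf_algebra
begin

sublocale assoc_algebra "scl H"
  by unfold_locales (fact scl_mult_left scl_mult_right)+

lemma counit_alg_hom: "alg_hom (scl H) (*) (counit H)"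
  using counit_linear counit_one counit_mult by (simp add: alg_hom_def)

lemma antipode_add: "antipode H (a + b) = antipode H a + antipode H b"
  and antipode_scale: "antipode H (scl H c a) = scl H c (antipode H a)"
  using antipode_linear[THEN module_hom_linearI, THEN module_hom.add]
    antipode_linear[THEN module_hom_linearI, THEN module_hom.scale] by auto

text \<open>The identity map is invertible under convolution, with inverse the antipode; so convolution
  with it can be cancelled. Written out, \<open>F h = \<Sum> F(h\<^sub>1) h\<^sub>2 S(h\<^sub>3)\<close>. This yields the values of the
  antipode on products, for products with a group-like or skew-primitive left factor.\<close>
lemma convolution_identity_cancel:
  assumes F: "Vector_Spaces.linear (scl H) (scl H) F"
    and zero: "\<And>h. lin_ext (scl H) (\<lambda>(a, b). F a * b) (comult H h) = 0"
  shows "F h = 0"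
proof -
  interpret F: Vector_Spaces.linear "scl H" "scl H" F by fact
  let ?\<Delta> = "comult H"
  let ?E = "lin_ext (scl H) (\<lambda>(a, b, c). F a * b * antipode H c)"
  have "?E (lin_ext fs_scale (\<lambda>(a, b). lin_ext fs_scale (\<lambda>(c, d). Poly_Mapping.single (c, d, b) 1) (?\<Delta> a)) (?\<Delta> h))
      = ?E (lin_ext fs_scale (\<lambda>(a, b). lin_ext fs_scale (\<lambda>(c, d). Poly_Mapping.single (a, c, d) 1) (?\<Delta> b)) (?\<Delta> h))"
    by (rule tensor3_eq_lin_ext[OF vector_space_axioms coassoc]; rule linearI[OF vector_space_axioms vector_space_axioms])
      (simp_all add: F.add F.scale antipode_add antipode_scale algebra_simps scale_mult_left scale_mult_right)
  moreover have "?E (lin_ext fs_scale (\<lambda>(a, b). lin_ext fs_scale (\<lambda>(c, d). Poly_Mapping.single (c, d, b) 1) (?\<Delta> a)) (?\<Delta> h))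
      = lin_ext (scl H) (\<lambda>(a, b). lin_ext (scl H) (\<lambda>(c, d). F c * d) (?\<Delta> a) * antipode H b) (?\<Delta> h)"
    by (simp add: lin_ext_lin_ext case_prod_unfold lin_ext_mult_right)
  moreover have "\<dots> = 0"
    by (simp only: zero) (simp add: lin_ext_def case_prod_unfold)
  moreover have "?E (lin_ext fs_scale (\<lambda>(a, b). lin_ext fs_scale (\<lambda>(c, d). Poly_Mapping.single (a, c, d) 1) (?\<Delta> b)) (?\<Delta> h))
      = lin_ext (scl H) (\<lambda>(a, b). F a * lin_ext (scl H) (\<lambda>(c, d). c * antipode H d) (?\<Delta> b)) (?\<Delta> h)"
    by (simp add: lin_ext_lin_ext case_prod_unfold lin_ext_mult_left mult.assoc)
  moreover have "\<dots> = lin_ext (scl H) (\<lambda>(a, b). F (scl H (counit H b) a)) (?\<Delta> h)"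
    by (simp add: antipode_right scale_mult_right F.scale)
  moreover have "\<dots> = F h"
    using linear_lin_ext_compose[OF F, of "\<lambda>(a, b). scl H (counit H b) a" "?\<Delta> h"]
    by (simp add: counit_right[unfolded case_prod_unfold] case_prod_unfold)
  ultimately show ?thesis by simp
qed

lemma bilinear_antipode_left: "bilinear_mod (scl H) (scl H) {0} (\<lambda>a b. antipode H a * b)"
  by (rule bilinearI)
    (simp_all add: antipode_add antipode_scale distrib_left distrib_right scale_mult_left scale_mult_right)

lemma lin_ext_comult_mult:
  assumes "vector_space s'" "bilinear_mod (scl H) s' {0} \<beta>" "tensor_eq (scl H) (comult H a) u"
  shows "lin_ext s' (\<lambda>(a, b). \<beta> a b) (comult H (a * z)) =
    lin_ext s' (\<lambda>(a, b). lin_ext s' (\<lambda>(c, d). \<beta> (a * c) (b * d)) (comult H z)) u"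
proof -
  have "tensor_eq (scl H) (comult H (a * z)) (tensor_mult u (comult H z))"
    using comult_mult tensor_mult_cong[OF assms(3) tensor_eq_refl] by (rule tensor_eq_trans)
  from tensor_eq_lin_ext[OF assms(1,2) this] show ?thesis
    by (simp add: vector_space.lin_ext_tensor_mult[OF assms(1)])
qed

lemma antipode_grouplike_mult:
  assumes t: "tensor_eq (scl H) (comult H t) (tens t t)" "counit H t = 1"
  shows "antipode H (t * z) * t = antipode H z"
proof -
  \<comment> \<open>Both terms are left inverse to the identity under convolution.\<close>
  define F where "F z = antipode H (t * z) * t - antipode H z" for z
  have "Vector_Spaces.linear (scl H) (scl H) F"
    by (rule linearI[OF vector_space_axioms vector_space_axioms])
      (simp_all add: F_def antipode_add antipode_scale scale_mult_left scale_mult_right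
        scale_right_diff_distrib distrib_left distrib_right)
  moreover have "lin_ext (scl H) (\<lambda>(a, b). F a * b) (comult H h) = 0" for h
  proof -
    have "lin_ext (scl H) (\<lambda>(a, b). F a * b) (comult H h) =
        lin_ext (scl H) (\<lambda>(a, b). antipode H a * b) (comult H (t * h))
        - lin_ext (scl H) (\<lambda>(a, b). antipode H a * b) (comult H h)"
      unfolding lin_ext_comult_mult[OF vector_space_axioms bilinear_antipode_left t(1)]
      by (simp add: F_def left_diff_distrib mult.assoc case_prod_unfold lin_ext_map_diff)
    then show ?thesis by (simp add: antipode_left counit_mult t(2))
  qed
  ultimately have "F z = 0" by (rule convolution_identity_cancel)
  then show ?thesis by (simp add: F_def)
qed

lemma antipode_skew_primitive_mult:
  assumes y: "tensor_eq (scl H) (comult H y) (tens y 1 + tens t y)" "counit H y = 0"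
  shows "antipode H (y * z) = - (antipode H (t * z) * y)"
proof -
  \<comment> \<open>Its convolution with the identity sums \<open>S(c) d\<close> over the coproduct of \<open>y z\<close>, which
    gives \<open>\<epsilon>(y z) = 0\<close>.\<close>
  define F where "F z = antipode H (y * z) + antipode H (t * z) * y" for z
  have "Vector_Spaces.linear (scl H) (scl H) F"
    by (rule linearI[OF vector_space_axioms vector_space_axioms])
      (simp_all add: F_def antipode_add antipode_scale scale_mult_left scale_mult_right
        scale_right_distrib distrib_left distrib_right)
  moreover have "lin_ext (scl H) (\<lambda>(a, b). F a * b) (comult H h) = 0" for h
  proof -
    have "lin_ext (scl H) (\<lambda>(a, b). F a * b) (comult H h) =
        lin_ext (scl H) (\<lambda>(a, b). antipode H a * b) (comult H (y * h))"
      unfolding lin_ext_comult_mult[OF vector_space_axioms bilinear_antipode_left y(1)]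
      by (simp add: F_def distrib_right mult.assoc case_prod_unfold lin_ext_map_add lin_ext_add)
    then show ?thesis by (simp add: antipode_left counit_mult y(2))
  qed
  ultimately have "F z = 0" by (rule convolution_identity_cancel)
  then show ?thesis by (simp add: F_def eq_neg_iff_add_eq_0)
qed

end

section \<open>Polynomial identities in characteristic p\<close>

lemma of_nat_power_CHAR:
  assumes "prime CHAR('k)"
  shows "(of_nat i :: 'k::comm_semiring_1) ^ CHAR('k) = of_nat i"
  using assms
proof (induction i)
  case 0 then show ?case by (simp add: zero_power prime_gt_0_nat)
next
  case (Suc i) then show ?case
    using freshmans_dream[where x = "1 :: 'k" and y = "of_nat i"] by simp
qed

lemma card_of_nat_CHAR:
  assumes "n \<le> CHAR('k::field)" shows "card (of_nat ` {..<n} :: 'k set) = n"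
proof -
  have "inj_on (of_nat :: nat \<Rightarrow> 'k) {..<n}"
    using assms
    by (intro linorder_inj_onI') (auto simp: of_nat_eq_iff_char_dvd dest: dvd_imp_le)
  then show ?thesis by (simp add: card_image)
qed

text \<open>By the little theorem of Fermat both sides are monic of degree \<open>p\<close> with the elements of the prime
  field as roots.\<close>
lemma prod_X_minus_of_nat:
  assumes "prime CHAR('k::field)"
  shows "(\<Prod>i<CHAR('k). [:0, 1:] - of_nat i) = [:0, 1:] ^ CHAR('k) - [:0, 1 :: 'k:]"
proof -
  let ?p = "CHAR('k)"
  have p: "?p > 1" using assms by (rule prime_gt_1_nat)
  have factor: "[:0, 1:] - of_nat i = [:- of_nat i, 1 :: 'k:]" for i by (simp add: of_nat_poly)
  have deg: "degree (\<Prod>i<n. [:- of_nat i, 1 :: 'k:]) = n" "lead_coeff (\<Prod>i<n. [:- of_nat i, 1 :: 'k:]) = 1" for n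
    by (subst degree_prod_eq_sum_degree; simp) (simp add: lead_coeff_prod)
  have X: "[:0, 1 :: 'k:] ^ ?p = monom 1 ?p" by (simp add: monom_altdef)
  have "[:0, 1 :: 'k:] = monom 1 1" by (simp add: monom_altdef)
  then have deg': "degree ([:0, 1:] ^ ?p - [:0, 1 :: 'k:]) \<le> ?p"
      "coeff ([:0, 1:] ^ ?p - [:0, 1 :: 'k:]) ?p = 1"
    using p unfolding X by (auto intro!: degree_diff_le degree_monom_le[THEN order_trans])
  show ?thesis
    unfolding factor
  proof (rule poly_eqI_degree_lead_coeff[where n = ?p and A = "of_nat ` {..<?p}"])
    show "coeff (\<Prod>i<?p. [:- of_nat i, 1 :: 'k:]) ?p = coeff ([:0, 1:] ^ ?p - [:0, 1 :: 'k:]) ?p"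
      using deg[of ?p] deg' by simp
    show "poly (\<Prod>i<?p. [:- of_nat i, 1:]) z = poly ([:0, 1:] ^ ?p - [:0, 1:]) z"
      if "z \<in> of_nat ` {..<?p}" for z :: 'k
      using that assms by (auto simp: poly_prod of_nat_power_CHAR prod_zero_iff)
  qed (use deg deg' in \<open>auto simp: card_of_nat_CHAR\<close>)
qed

lemma prod_add_of_nat:
  assumes "prime CHAR('k::field)"
  shows "(\<Prod>i<CHAR('k). y + of_nat i) = y ^ CHAR('k) - (y :: 'k)"
proof -
  let ?p = "CHAR('k)"
  have minus: "(- z) ^ ?p = - (z ^ ?p)" for z :: 'k
    by (rule minus_power_prime_CHAR) (use assms in auto)
  have "poly (\<Prod>i<?p. [:0, 1:] - of_nat i) (- y) = (\<Prod>i<?p. - (y + of_nat i))"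
    unfolding poly_prod by (rule prod.cong) (simp_all add: of_nat_poly)
  also have "\<dots> = - (\<Prod>i<?p. y + of_nat i)"
    using minus[of 1] by (simp only: prod_uminus) simp
  finally show ?thesis
    by (simp add: prod_X_minus_of_nat[OF assms] minus) (metis minus_diff_eq minus_minus)
qed

context assoc_algebra
begin

text \<open>Evaluation of a polynomial at an element of a possibly noncommutative algebra. It transports the
  identities of characteristic \<open>p\<close> from the commutative ring of polynomials to operators.\<close>
definition poly_at :: "'r \<Rightarrow> 'k poly \<Rightarrow> 'r" where
  "poly_at a q = fold_coeffs (\<lambda>c r. s c 1 + a * r) q 0"

lemma poly_at_0 [simp]: "poly_at a 0 = 0"
  by (simp add: poly_at_def)

lemma poly_at_pCons [simp]: "poly_at a (pCons c q) = s c 1 + a * poly_at a q"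
  by (cases "q = 0"; cases "c = 0") (simp_all add: poly_at_def)

lemma poly_at_add: "poly_at a (q + r) = poly_at a q + poly_at a r"
  by (induction q r rule: poly_induct2) (simp_all add: scale_left_distrib distrib_left add_ac)

lemma poly_at_smult: "poly_at a (smult c q) = s c (poly_at a q)"
  by (induction q) (simp_all add: scale_right_distrib scale_mult_right)

lemma poly_at_mult: "poly_at a (q * r) = poly_at a q * poly_at a r"
  by (induction q) (simp_all add: poly_at_add poly_at_smult distrib_right scale_mult_left mult.assoc)

lemma poly_at_1 [simp]: "poly_at a 1 = 1"
  by (simp add: one_pCons)

lemma poly_at_X [simp]: "poly_at a [:0, 1:] = a"
  by simp

lemma poly_at_power: "poly_at a (q ^ n) = poly_at a q ^ n"
  by (induction n) (simp_all add: poly_at_mult)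

lemma poly_at_diff: "poly_at a (q - r) = poly_at a q - poly_at a r"
  using poly_at_add[of a "q - r" r] by (simp add: algebra_simps)

lemma poly_at_of_nat: "poly_at a (of_nat n) = of_nat n"
  by (induction n) (simp_all add: poly_at_add)

lemma diff_one_power_CHAR:
  assumes "prime CHAR('k)"
  shows "(a - 1) ^ CHAR('k) = a ^ CHAR('k) - (1 :: 'r)"
proof -
  have "([:0, 1:] + (- 1) :: 'k poly) ^ CHAR('k) = [:0, 1:] ^ CHAR('k) + (- 1) ^ CHAR('k)"
    by (rule freshmans_dream) (use assms in auto)
  also have "(- 1 :: 'k poly) ^ CHAR('k) = - (1 ^ CHAR('k))"
    by (rule minus_power_prime_CHAR) (use assms in auto)
  finally have "([:0, 1:] - 1 :: 'k poly) ^ CHAR('k) = [:0, 1:] ^ CHAR('k) - 1"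
    by (simp only: diff_conv_add_uminus power_one)
  from arg_cong[OF this, of "poly_at a"] show ?thesis
    by (simp only: poly_at_power poly_at_diff poly_at_1 poly_at_X)
qed

lemma prod_minus_of_nat:
  assumes "prime CHAR('k)"
  shows "prod_list (map (\<lambda>i. a - of_nat i) [0..<CHAR('k)]) = a ^ CHAR('k) - (a :: 'r)"
proof -
  have "poly_at a (\<Prod>i<n. [:0, 1:] - of_nat i) = prod_list (map (\<lambda>i. a - of_nat i) [0..<n])" for n
    by (induction n) (simp_all add: poly_at_mult poly_at_diff poly_at_of_nat)
  from this[of "CHAR('k)"] show ?thesis
    unfolding prod_X_minus_of_nat[OF assms] by (simp only: poly_at_power poly_at_diff poly_at_X)
qed

end

section \<open>Right operators on functions\<close>

text \<open>Linear operators on functions, written on the right of their argument: the product \<open>T * U\<close> applies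
  \<open>T\<close> first. With this convention translations \<open>\<phi> \<mapsto> (\<lambda>s. \<phi> (t s))\<close> multiply like group elements.
  Functions rather than formal linear combinations make the operators of the algebra pointwise
  formulas; they are the transposes of left multiplications.\<close>
typedef (overloaded) ('a, 'k) fun_op =
  "{T :: ('a \<Rightarrow> 'k::field) \<Rightarrow> 'a \<Rightarrow> 'k.
     (\<forall>\<phi> \<psi>. T (\<lambda>s. \<phi> s + \<psi> s) = (\<lambda>s. T \<phi> s + T \<psi> s)) \<and>
     (\<forall>c \<phi>. T (\<lambda>s. c * \<phi> s) = (\<lambda>s. c * T \<phi> s))}"
  morphisms op_apply Abs_fun_op
  by (rule exI[of _ "\<lambda>\<phi>. \<phi>"]) simp

setup_lifting type_definition_fun_op

instantiation fun_op :: (type, field) ring_1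
begin

lift_definition zero_fun_op :: "('a, 'b) fun_op" is "\<lambda>\<phi> s. 0" by simp
lift_definition one_fun_op :: "('a, 'b) fun_op" is "\<lambda>\<phi>. \<phi>" by simp
lift_definition plus_fun_op :: "('a, 'b) fun_op \<Rightarrow> ('a, 'b) fun_op \<Rightarrow> ('a, 'b) fun_op"
  is "\<lambda>T U \<phi> s. T \<phi> s + U \<phi> s" by (auto simp: algebra_simps)
lift_definition minus_fun_op :: "('a, 'b) fun_op \<Rightarrow> ('a, 'b) fun_op \<Rightarrow> ('a, 'b) fun_op"
  is "\<lambda>T U \<phi> s. T \<phi> s - U \<phi> s" by (auto simp: algebra_simps)
lift_definition uminus_fun_op :: "('a, 'b) fun_op \<Rightarrow> ('a, 'b) fun_op"
  is "\<lambda>T \<phi> s. - T \<phi> s" by (auto simp: algebra_simps)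
lift_definition times_fun_op :: "('a, 'b) fun_op \<Rightarrow> ('a, 'b) fun_op \<Rightarrow> ('a, 'b) fun_op"
  is "\<lambda>T U \<phi>. U (T \<phi>)" by simp

instance
proof
  show "(0 :: ('a, 'b) fun_op) \<noteq> 1"
    by transfer (metis zero_neq_one)
qed (transfer; auto simp: fun_eq_iff algebra_simps)+

end

lift_definition scale_op :: "'k \<Rightarrow> ('a, 'k::field) fun_op \<Rightarrow> ('a, 'k) fun_op"
  is "\<lambda>c T \<phi> s. c * T \<phi> s" by (auto simp: algebra_simps)

interpretation fun_op: assoc_algebra "scale_op :: 'k::field \<Rightarrow> ('a, 'k) fun_op \<Rightarrow> ('a, 'k) fun_op"
  by unfold_locales (transfer; simp add: fun_eq_iff algebra_simps)+

lemma op_apply_simps [simp]: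
  "op_apply 0 \<phi> s = 0" "op_apply 1 \<phi> = \<phi>" "op_apply (T + U) \<phi> s = op_apply T \<phi> s + op_apply U \<phi> s"
  "op_apply (T - U) \<phi> s = op_apply T \<phi> s - op_apply U \<phi> s" "op_apply (- T) \<phi> s = - op_apply T \<phi> s"
  "op_apply (T * U) \<phi> = op_apply U (op_apply T \<phi>)" "op_apply (scale_op c T) \<phi> s = c * op_apply T \<phi> s"
  by (transfer; simp)+

lemma op_apply_of_nat [simp]: "op_apply (of_nat n) \<phi> s = of_nat n * \<phi> s"
  by (induction n) (simp_all add: algebra_simps)

lemma fun_op_eqI: "(\<And>\<phi> s. op_apply T \<phi> s = op_apply U \<phi> s) \<Longrightarrow> T = U"
  by (metis ext op_apply_inject)

text \<open>Outside the carrier group elements act as the identity and \<open>x\<close> acts as zero, so that the relations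
  of the algebra hold on all functions.\<close>
lift_definition trans_op :: "('a, 'm) monoid_scheme \<Rightarrow> 'a \<Rightarrow> ('a, 'k::field) fun_op"
  is "\<lambda>G t \<phi> s. if s \<in> carrier G then \<phi> (t \<otimes>\<^bsub>G\<^esub> s) else \<phi> s" by auto

lift_definition skew_op :: "('a, 'm) monoid_scheme \<Rightarrow> 'a \<Rightarrow> ('a \<Rightarrow> 'k) \<Rightarrow> ('a, 'k::field) fun_op"
  is "\<lambda>G g f \<phi> s. if s \<in> carrier G then f s * (\<phi> (g \<otimes>\<^bsub>G\<^esub> s) - \<phi> s) else 0" by (auto simp: algebra_simps)

lemma op_apply_trans: "op_apply (trans_op G t) \<phi> s = (if s \<in> carrier G then \<phi> (t \<otimes>\<^bsub>G\<^esub> s) else \<phi> s)"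
  by transfer simp

lemma op_apply_skew:
  "op_apply (skew_op G g f) \<phi> s = (if s \<in> carrier G then f s * (\<phi> (g \<otimes>\<^bsub>G\<^esub> s) - \<phi> s) else 0)"
  by transfer simp

locale skew_datum = group G for G :: "('a, 'm) monoid_scheme" (structure) +
  fixes g :: 'a and f :: "'a \<Rightarrow> 'k::field"
  assumes char_pos: "CHAR('k) > 0" and datum: "third_type_datum G g f"
begin

lemma char_prime: "prime CHAR('k)"
  using char_pos by (rule prime_CHAR_semidom)

lemma finite_G: "finite (carrier G)"
  and g_in [simp]: "g \<in> carrier G"
  and g_central: "t \<in> carrier G \<Longrightarrow> g \<otimes> t = t \<otimes> g"
  and f_mult: "t \<in> carrier G \<Longrightarrow> t' \<in> carrier G \<Longrightarrow> f (t \<otimes> t') = f t + f t'"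
  and f_g [simp]: "f g = 1"
  using datum by (auto simp: third_type_datum_def hom_def)

lemma f_one [simp]: "f \<one> = 0"
  using f_mult[of \<one> \<one>] by (metis add_cancel_right_right l_one one_closed)

lemma g_ne_one: "g \<noteq> \<one>"
  using f_one f_g by force

lemma f_power_or_g_power:
  assumes "t \<in> carrier G"
  shows "f t ^ CHAR('k) = f t \<or> g [^] CHAR('k) = \<one>"
proof (rule disjCI)
  assume "g [^] CHAR('k) \<noteq> \<one>"
  moreover have "fs_scale (f t ^ CHAR('k) - f t)
        (Poly_Mapping.single \<one> 1 - Poly_Mapping.single (g [^] CHAR('k)) 1) = (0 :: 'a \<Rightarrow>\<^sub>0 'k)"
    using datum assms unfolding third_type_datum_def by blast
  from arg_cong[OF this, of "\<lambda>u. Poly_Mapping.lookup u \<one>"]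
  have "(f t ^ CHAR('k) - f t) * (1 - (1 when g [^] CHAR('k) = \<one>)) = 0"
    by (simp add: lookup_minus lookup_single)
  ultimately show "f t ^ CHAR('k) = f t" by simp
qed

abbreviation L :: "'a \<Rightarrow> ('a, 'k) fun_op" where "L \<equiv> trans_op G"
abbreviation X :: "('a, 'k) fun_op" where "X \<equiv> skew_op G g f"

lemma trans_op_mult: "t \<in> carrier G \<Longrightarrow> t' \<in> carrier G \<Longrightarrow> L t * L t' = L (t \<otimes> t')"
  by (rule fun_op_eqI) (auto simp: op_apply_trans m_assoc)

lemma trans_op_one: "L \<one> = 1"
  by (rule fun_op_eqI) (auto simp: op_apply_trans)

lemma trans_op_power: "t \<in> carrier G \<Longrightarrow> L t ^ n = L (t [^] n)"
  by (induction n) (auto simp: trans_op_one trans_op_mult power_Suc2 simp del: power_Suc)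

lemma trans_skew_commutator:
  assumes "t \<in> carrier G"
  shows "L t * X - X * L t = scale_op (f t) (L t * (1 - L g))"
proof (rule fun_op_eqI)
  fix \<phi> :: "'a \<Rightarrow> 'k" and s
  have "t \<otimes> (g \<otimes> s) = g \<otimes> (t \<otimes> s)" if "s \<in> carrier G"
    using that assms by (metis g_central g_in m_assoc)
  then show "op_apply (L t * X - X * L t) \<phi> s = op_apply (scale_op (f t) (L t * (1 - L g))) \<phi> s"
    using assms by (auto simp: op_apply_trans op_apply_skew f_mult algebra_simps)
qed

text \<open>The skew operator is the difference operator \<open>L g - 1\<close> followed by multiplication with \<open>f\<close>. The
  two do not commute: a translation by \<open>g\<close> raises \<open>f\<close> by one. Falling factorials absorb exactly this
  shift, so they separate into a rising factorial of \<open>f\<close> and a power of the difference operator.\<close>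
lemma skew_falling_factorial:
  assumes "s \<in> carrier G"
  shows "op_apply (prod_list (map (\<lambda>i. X - of_nat i) [0..<n])) \<phi> s =
    (\<Prod>i<n. f s + of_nat i) * op_apply ((L g - 1) ^ n) \<phi> s"
  using assms
proof (induction n arbitrary: s)
  case (Suc n)
  let ?F = "\<lambda>s. \<Prod>i<n. f s + of_nat i" and ?\<psi> = "op_apply ((L g - 1) ^ n) \<phi>"
  have shift: "f s * ?F (g \<otimes> s) = (f s + of_nat n) * ?F s"
  proof -
    have "f s * ?F (g \<otimes> s) = (f s + of_nat 0) * (\<Prod>i<n. f s + of_nat (Suc i))"
      using Suc.prems by (simp add: f_mult add_ac)
    also have "\<dots> = (\<Prod>i<Suc n. f s + of_nat i)"
      by (rule prod.lessThan_Suc_shift[symmetric])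
    finally show ?thesis by (simp add: mult.commute)
  qed
  have "op_apply (prod_list (map (\<lambda>i. X - of_nat i) [0..<Suc n])) \<phi> s =
      f s * (?F (g \<otimes> s) * ?\<psi> (g \<otimes> s) - ?F s * ?\<psi> s) - of_nat n * (?F s * ?\<psi> s)"
    using Suc by (simp add: op_apply_skew)
  also have "\<dots> = (f s * ?F (g \<otimes> s)) * ?\<psi> (g \<otimes> s) - (f s + of_nat n) * ?F s * ?\<psi> s"
    by (simp add: algebra_simps)
  also have "\<dots> = (f s + of_nat n) * ?F s * (?\<psi> (g \<otimes> s) - ?\<psi> s)"
    unfolding shift by (simp add: algebra_simps)
  also have "?\<psi> (g \<otimes> s) - ?\<psi> s = op_apply ((L g - 1) ^ Suc n) \<phi> s"
    using Suc.prems by (simp add: power_Suc2 op_apply_trans del: power_Suc)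
  finally show ?case by (simp add: mult.commute)
qed simp

text \<open>For \<open>n = p\<close> the three terms become \<open>X\<^sup>p - X\<close>, \<open>f\<^sup>p - f\<close> and \<open>L (g\<^sup>p) - 1\<close>. By the condition on
  the datum, at each point one of the last two vanishes.\<close>
lemma skew_op_power: "X ^ CHAR('k) = X"
proof (rule fun_op_eqI)
  fix \<phi> :: "'a \<Rightarrow> 'k" and s
  show "op_apply (X ^ CHAR('k)) \<phi> s = op_apply X \<phi> s"
  proof (cases "s \<in> carrier G")
    case True
    have "op_apply (X ^ CHAR('k) - X) \<phi> s = (f s ^ CHAR('k) - f s) * op_apply (L (g [^] CHAR('k)) - 1) \<phi> s"
      unfolding fun_op.prod_minus_of_nat[OF char_prime, symmetric] skew_falling_factorial[OF True]
        prod_add_of_nat[OF char_prime] fun_op.diff_one_power_CHAR[OF char_prime] by (simp add: trans_op_power)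
    also have "\<dots> = 0"
      using f_power_or_g_power[OF True] by (auto simp: trans_op_one)
    finally show ?thesis by simp
  next
    case False
    obtain n where "CHAR('k) = Suc n" using char_pos by (metis not0_implies_Suc less_numeral_extra(3))
    then show ?thesis using False by (simp add: power_Suc2 op_apply_skew del: power_Suc)
  qed
qed

end

section \<open>The algebra of a third-type datum\<close>

lemma (in vector_space) span_image_finite:
  assumes "finite I" shows "span (h ` I) = range (\<lambda>a. \<Sum>i\<in>I. scale (a i) (h i))"
proof
  show "span (h ` I) \<subseteq> range (\<lambda>a. \<Sum>i\<in>I. scale (a i) (h i))"
  proof (rule span_minimal)
    have "h j \<in> range (\<lambda>a. \<Sum>i\<in>I. scale (a i) (h i))" if "j \<in> I" for j
      by (rule range_eqI[where x = "\<lambda>i. if i = j then 1 else 0"])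
        (use assms that in \<open>simp add: if_distrib[of "\<lambda>c. scale c _"] sum.delta cong: if_cong\<close>)
    then show "h ` I \<subseteq> range (\<lambda>a. \<Sum>i\<in>I. scale (a i) (h i))" by auto
    show "subspace (range (\<lambda>a. \<Sum>i\<in>I. scale (a i) (h i)))"
    proof (rule subspaceI)
      have "0 = (\<Sum>i\<in>I. scale (0 :: 'a) (h i))" by simp
      then show "0 \<in> range (\<lambda>a. \<Sum>i\<in>I. scale (a i) (h i))"
        by (rule range_eqI[where x = "\<lambda>i. 0"])
      fix u v c
      assume "u \<in> range (\<lambda>a. \<Sum>i\<in>I. scale (a i) (h i))" "v \<in> range (\<lambda>a. \<Sum>i\<in>I. scale (a i) (h i))"
      then obtain a b where u: "u = (\<Sum>i\<in>I. scale (a i) (h i))" and v: "v = (\<Sum>i\<in>I. scale (b i) (h i))"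
        by blast
      have "u + v = (\<Sum>i\<in>I. scale (a i + b i) (h i))"
        by (simp add: u v scale_left_distrib sum.distrib)
      then show "u + v \<in> range (\<lambda>a. \<Sum>i\<in>I. scale (a i) (h i))"
        by (rule range_eqI[where x = "\<lambda>i. a i + b i"])
      have "scale c u = (\<Sum>i\<in>I. scale (c * a i) (h i))"
        by (simp add: u scale_sum_right)
      then show "scale c u \<in> range (\<lambda>a. \<Sum>i\<in>I. scale (a i) (h i))"
        by (rule range_eqI[where x = "\<lambda>i. c * a i"])
    qed
  qed
  show "range (\<lambda>a. \<Sum>i\<in>I. scale (a i) (h i)) \<subseteq> span (h ` I)"
    by (intro image_subsetI span_sum span_scale span_base imageI)
qed

lemma (in assoc_algebra) of_nat_scale: "of_nat n = s (of_nat n) 1"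
  by (induction n) (simp_all add: scale_left_distrib)

lemma (in assoc_algebra) eval_third_type_relations:
  "(\<forall>r\<in>third_type_relations G g f. eval_free s (case_third_type_gen \<iota> x) r = 0) \<longleftrightarrow>
     (\<forall>t\<in>carrier G. \<forall>t'\<in>carrier G. \<iota> t * \<iota> t' = \<iota> (t \<otimes>\<^bsub>G\<^esub> t')) \<and> \<iota> \<one>\<^bsub>G\<^esub> = 1 \<and>
     (\<forall>t\<in>carrier G. \<iota> t * x - x * \<iota> t = s (f t) (\<iota> t * (1 - \<iota> g))) \<and> x ^ CHAR('k) = x"
proof -
  note hom = alg_hom_eval_free[of "case_third_type_gen \<iota> x"]
  note ev = alg_hom_mult[OF hom] alg_hom_diff[OF hom] alg_hom_one[OF hom] alg_hom_scale[OF hom] alg_hom_power[OF hom]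
  have *: "(\<forall>r\<in>{F t t' | t t'. t \<in> carrier G \<and> t' \<in> carrier G} \<union> {r1} \<union> {F' t | t. t \<in> carrier G} \<union> {r2}. P r) \<longleftrightarrow>
    (\<forall>t\<in>carrier G. \<forall>t'\<in>carrier G. P (F t t')) \<and> P r1 \<and> (\<forall>t\<in>carrier G. P (F' t)) \<and> P r2" for F F' r1 r2 P
    by auto
  show ?thesis
    unfolding third_type_relations_def * ev by simp
qed

lemma presented_relation:
  assumes "presented_by s \<gamma> A R" "r \<in> R" shows "eval_free s \<gamma> r = 0"
proof -
  have "r = 1 * r * 1" by simp
  then have "r \<in> rel_ideal A R"
    unfolding rel_ideal_def using assms(2) free_alg_one by (intro formal.span_base) blast
  then show ?thesis using assms(1) unfolding presented_by_def by blast
qed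

locale third_type = skew_datum G g f
  for G :: "('a, 'm) monoid_scheme" (structure) and g :: 'a and f :: "'a \<Rightarrow> 'k::field" +
  fixes H :: "('k, 'h::ring_1) hopf" and \<iota> :: "'a \<Rightarrow> 'h" and x :: 'h
  assumes third_type: "third_type_hopf_algebra G g f H \<iota> x"
begin

sublocale hopf_algebra H
  using third_type by (simp add: third_type_hopf_algebra_def)

abbreviation teq where "teq \<equiv> tensor_eq (scl H)"

lemma presentation:
  "presented_by (scl H) (case_third_type_gen \<iota> x) (Grp ` carrier G \<union> {Skew}) (third_type_relations G g f)"
  using third_type by (simp add: third_type_hopf_algebra_def)

lemma comult_iota: "t \<in> carrier G \<Longrightarrow> teq (comult H (\<iota> t)) (tens (\<iota> t) (\<iota> t))"
  and counit_iota [simp]: "t \<in> carrier G \<Longrightarrow> counit H (\<iota> t) = 1"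
  and antipode_iota: "t \<in> carrier G \<Longrightarrow> antipode H (\<iota> t) = \<iota> (inv t)"
  and comult_x: "teq (comult H x) (tens x 1 + tens (\<iota> g) x)"
  and counit_x [simp]: "counit H x = 0"
  using third_type by (simp_all add: third_type_hopf_algebra_def)

lemma iota_mult: "t \<in> carrier G \<Longrightarrow> t' \<in> carrier G \<Longrightarrow> \<iota> t * \<iota> t' = \<iota> (t \<otimes> t')"
  and iota_one: "\<iota> \<one> = 1"
  and commutator: "t \<in> carrier G \<Longrightarrow> \<iota> t * x - x * \<iota> t = scl H (f t) (\<iota> t * (1 - \<iota> g))"
  and x_power: "x ^ CHAR('k) = x"
  using eval_third_type_relations[of G g f \<iota> x] presented_relation[OF presentation] by auto

lemma iota_mult_assoc: "t \<in> carrier G \<Longrightarrow> t' \<in> carrier G \<Longrightarrow> \<iota> t * (\<iota> t' * z) = \<iota> (t \<otimes> t') * z"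
  by (simp add: iota_mult flip: mult.assoc)

lemma x_iota: "t \<in> carrier G \<Longrightarrow> x * \<iota> t = \<iota> t * x - scl H (f t) (\<iota> t - \<iota> (t \<otimes> g))"
  using commutator[of t] by (simp add: algebra_simps iota_mult)

lemma algebra_induct [case_names one add scale iota x]:
  assumes "P 1" "\<And>a b. P a \<Longrightarrow> P b \<Longrightarrow> P (a + b)" "\<And>c a. P a \<Longrightarrow> P (scl H c a)"
    and "\<And>t a. t \<in> carrier G \<Longrightarrow> P a \<Longrightarrow> P (\<iota> t * a)" "\<And>a. P a \<Longrightarrow> P (x * a)"
  shows "P z"
  by (rule presented_induct[OF presentation]) (use assms in auto)

lemma algebra_lift:
  assumes "assoc_algebra s'"
    and "\<And>t t'. t \<in> carrier G \<Longrightarrow> t' \<in> carrier G \<Longrightarrow> \<iota>' t * \<iota>' t' = \<iota>' (t \<otimes> t')" "\<iota>' \<one> = 1"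
    and "\<And>t. t \<in> carrier G \<Longrightarrow> \<iota>' t * x' - x' * \<iota>' t = s' (f t) (\<iota>' t * (1 - \<iota>' g))" "x' ^ CHAR('k) = x'"
  shows "\<exists>\<psi>. alg_hom (scl H) s' \<psi> \<and> (\<forall>t\<in>carrier G. \<psi> (\<iota> t) = \<iota>' t) \<and> \<psi> x = x'"
proof -
  interpret S': assoc_algebra s' by fact
  have "eval_free s' (case_third_type_gen \<iota>' x') r = 0" if "r \<in> third_type_relations G g f" for r
    using S'.eval_third_type_relations[of G g f \<iota>' x'] assms(2-) that by auto
  from presented_lift[OF assoc_algebra_axioms assms(1) presentation this]
  obtain \<psi> where "alg_hom (scl H) s' \<psi>"
    and \<psi>: "\<And>i. i \<in> Grp ` carrier G \<union> {Skew} \<Longrightarrow> \<psi> (case_third_type_gen \<iota> x i) = case_third_type_gen \<iota>' x' i"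
    by blast
  then show ?thesis
    using \<psi>[of "Grp _"] \<psi>[of Skew] by (intro exI[of _ \<psi>]) auto
qed

subsection \<open>Coefficient functionals\<close>

text \<open>The representation of \<open>H\<close> on functions; it exists by the universal property.\<close>
definition rep :: "'h \<Rightarrow> ('a, 'k) fun_op" where
  "rep = (SOME \<psi>. alg_hom (scl H) scale_op \<psi> \<and> (\<forall>t\<in>carrier G. \<psi> (\<iota> t) = L t) \<and> \<psi> x = X)"

lemma rep: "alg_hom (scl H) scale_op rep" "t \<in> carrier G \<Longrightarrow> rep (\<iota> t) = L t" "rep x = X"
proof -
  have "\<exists>\<psi>. alg_hom (scl H) scale_op \<psi> \<and> (\<forall>t\<in>carrier G. \<psi> (\<iota> t) = L t) \<and> \<psi> x = X"
    by (rule algebra_lift[OF fun_op.assoc_algebra_axioms])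
      (auto simp: trans_op_mult trans_op_one trans_skew_commutator skew_op_power)
  from someI_ex[OF this, folded rep_def]
  show "alg_hom (scl H) scale_op rep" "t \<in> carrier G \<Longrightarrow> rep (\<iota> t) = L t" "rep x = X" by auto
qed

text \<open>By \<open>coef_iota\<close> and \<open>coef_mult_x\<close> this is the coefficient of \<open>\<iota> t\<close> with respect to the monomials
  \<open>\<iota> t * x ^ n\<close>.\<close>
definition coef :: "'a \<Rightarrow> 'h \<Rightarrow> 'k" where
  "coef t z = op_apply (rep z) (\<lambda>s. if s = t then 1 else 0) \<one>"

lemma linear_coef: "Vector_Spaces.linear (scl H) (*) (coef t)"
  by (rule linearI[OF vector_space_axioms scalars.vector_space_axioms])
    (simp_all add: coef_def alg_hom_add[OF rep(1)] alg_hom_scale[OF rep(1)])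

lemmas coef_add = module_hom.add[OF module_hom_linearI[OF linear_coef]]
  and coef_scale = module_hom.scale[OF module_hom_linearI[OF linear_coef]]
  and coef_diff = module_hom.diff[OF module_hom_linearI[OF linear_coef]]
  and coef_zero [simp] = module_hom.zero[OF module_hom_linearI[OF linear_coef]]
  and coef_sum = module_hom.sum[OF module_hom_linearI[OF linear_coef]]

lemma coef_iota: "r \<in> carrier G \<Longrightarrow> coef t (\<iota> r) = (if r = t then 1 else 0)"
  by (simp add: coef_def rep(2) op_apply_trans)

text \<open>The operator of \<open>x\<close>, applied last, yields a function that vanishes at the neutral element.\<close>
lemma coef_mult_x [simp]: "coef t (a * x) = 0"
  by (simp add: coef_def alg_hom_mult[OF rep(1)] rep(3) op_apply_skew)

lemma iota_eq_iff: "t \<in> carrier G \<Longrightarrow> r \<in> carrier G \<Longrightarrow> \<iota> t = \<iota> r \<longleftrightarrow> t = r"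
  using coef_iota[of t t] coef_iota[of r t] by (auto split: if_splits)

subsection \<open>The winding automorphism\<close>

definition char1 :: "'h \<Rightarrow> 'k" where
  "char1 = (SOME \<psi>. alg_hom (scl H) (*) \<psi> \<and> (\<forall>t\<in>carrier G. \<psi> (\<iota> t) = 1) \<and> \<psi> x = 1)"

lemma char1: "alg_hom (scl H) (*) char1"
  and char1_iota [simp]: "t \<in> carrier G \<Longrightarrow> char1 (\<iota> t) = 1" and char1_x [simp]: "char1 x = 1"
proof -
  have "\<exists>\<psi>. alg_hom (scl H) (*) \<psi> \<and> (\<forall>t\<in>carrier G. \<psi> (\<iota> t) = 1) \<and> \<psi> x = 1"
    by (rule algebra_lift[OF scalars.assoc_algebra_axioms]) auto
  from someI_ex[OF this, folded char1_def]
  show "alg_hom (scl H) (*) char1" "t \<in> carrier G \<Longrightarrow> char1 (\<iota> t) = 1" "char1 x = 1" by auto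
qed

text \<open>Convolution of the identity with a character, known as a (left) winding automorphism.\<close>
definition wind :: "'h \<Rightarrow> 'h" where
  "wind z = lin_ext (scl H) (\<lambda>(a, b). scl H (char1 a) b) (comult H z)"

lemma bilinear_wind: "bilinear_mod (scl H) (scl H) {0} (\<lambda>a b. scl H (char1 a) b)"
  by (rule bilinearI)
    (simp_all add: alg_hom_add[OF char1] alg_hom_scale[OF char1] scale_left_distrib scale_right_distrib scale_left_commute)

lemma wind_eq: "teq (comult H z) u \<Longrightarrow> wind z = lin_ext (scl H) (\<lambda>(a, b). scl H (char1 a) b) u"
  unfolding wind_def by (rule tensor_eq_lin_ext[OF vector_space_axioms bilinear_wind])

lemma wind_hom: "alg_hom (scl H) (scl H) wind"
  unfolding alg_hom_def
proof (intro conjI allI)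
  show "Vector_Spaces.linear (scl H) (scl H) wind"
  proof (rule linearI[OF vector_space_axioms vector_space_axioms])
    show "wind (a + b) = wind a + wind b" for a b
      by (subst wind_eq[OF comult_add]) (simp add: wind_def lin_ext_add)
    show "wind (scl H c a) = scl H c (wind a)" for c a
      by (subst wind_eq[OF comult_scl]) (simp add: wind_def lin_ext_scale)
  qed
  show "wind 1 = 1"
    using wind_eq[OF comult_one] by (simp add: alg_hom_one[OF char1])
  show "wind (a * b) = wind a * wind b" for a b
  proof -
    have "wind (a * b) = lin_ext (scl H) (\<lambda>(p, q). lin_ext (scl H)
        (\<lambda>(c, d). scl H (char1 (p * c)) (q * d)) (comult H b)) (comult H a)"
      by (subst wind_eq[OF comult_mult], subst lin_ext_tensor_mult) (rule refl)
    also have "\<dots> = lin_ext (scl H) (\<lambda>(p, q). scl H (char1 p) q * wind b) (comult H a)"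
      unfolding wind_def lin_ext_mult_left case_prod_unfold
      by (simp add: alg_hom_mult[OF char1] scale_mult_left scale_mult_right mult.commute)
    also have "\<dots> = wind a * wind b"
      unfolding wind_def[of a] lin_ext_mult_right case_prod_unfold ..
    finally show ?thesis .
  qed
qed

lemma wind_iota: "t \<in> carrier G \<Longrightarrow> wind (\<iota> t) = \<iota> t"
  by (simp add: wind_eq[OF comult_iota])

lemma wind_x: "wind x = x + 1"
  by (simp add: wind_eq[OF comult_x] lin_ext_add)

lemma wind_pow_hom: "alg_hom (scl H) (scl H) (wind ^^ n)"
proof (induction n)
  case 0 show ?case by (simp add: alg_hom_def linear_ident)
next
  case (Suc n) then show ?case using alg_hom_compose[OF _ wind_hom] by (simp add: o_def)
qed

lemma wind_pow_iota: "t \<in> carrier G \<Longrightarrow> (wind ^^ n) (\<iota> t) = \<iota> t"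
  by (induction n) (simp_all add: wind_iota)

lemma wind_pow_x: "(wind ^^ n) x = x + of_nat n"
proof (induction n)
  case (Suc n)
  have "wind (of_nat n) = of_nat n"
    by (simp add: of_nat_scale alg_hom_scale[OF wind_hom] alg_hom_one[OF wind_hom])
  then show ?case by (simp add: Suc alg_hom_add[OF wind_hom] wind_x)
qed simp

lemma wind_pow_CHAR: "(wind ^^ CHAR('k)) z = z"
proof (induction z rule: algebra_induct)
  case one show ?case by (simp add: alg_hom_one[OF wind_pow_hom])
next
  case (x a)
  have "(of_nat CHAR('k) :: 'h) = 0" by (simp add: of_nat_scale)
  with x show ?case by (simp add: alg_hom_mult[OF wind_pow_hom] wind_pow_x)
qed (simp_all add: alg_hom_mult[OF wind_pow_hom] alg_hom_add[OF wind_pow_hom] alg_hom_scale[OF wind_pow_hom] wind_pow_iota)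

subsection \<open>The standard basis\<close>

text \<open>For a subgroup \<open>U\<close> containing \<open>g\<close> this is the rank-one factor of \<open>U\<close>; cosets of \<open>U\<close> are also needed.\<close>
definition monomial_span :: "'a set \<Rightarrow> 'h set" where
  "monomial_span U = span {\<iota> u * x ^ n | u n. u \<in> U}"

lemma monomial_span_base: "u \<in> U \<Longrightarrow> \<iota> u * x ^ n \<in> monomial_span U"
  unfolding monomial_span_def by (rule span_base) blast

lemma subspace_monomial_span: "subspace (monomial_span U)"
  by (simp add: monomial_span_def)

lemma monomial_span_mono: "U \<subseteq> V \<Longrightarrow> monomial_span U \<subseteq> monomial_span V"
  unfolding monomial_span_def by (rule span_mono) blast

lemma monomial_span_minimal:
  "subspace W \<Longrightarrow> (\<And>u n. u \<in> U \<Longrightarrow> \<iota> u * x ^ n \<in> W) \<Longrightarrow> monomial_span U \<subseteq> W"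
  unfolding monomial_span_def by (rule span_minimal) auto

lemma iota_in_monomial_span: "u \<in> U \<Longrightarrow> \<iota> u \<in> monomial_span U"
  using monomial_span_base[of u U 0] by simp

lemma iota_mult_monomial_span:
  assumes "t \<in> carrier G" "U \<subseteq> carrier G" "z \<in> monomial_span U"
  shows "\<iota> t * z \<in> monomial_span ((\<lambda>u. t \<otimes> u) ` U)"
proof -
  have "monomial_span U \<subseteq> {z. \<iota> t * z \<in> monomial_span ((\<lambda>u. t \<otimes> u) ` U)}"
  proof (rule monomial_span_minimal)
    show "subspace {z. \<iota> t * z \<in> monomial_span ((\<lambda>u. t \<otimes> u) ` U)}"
      by (rule module_hom.subspace_linear_preimage[OF module_hom_linearI[OF linear_mult_left] subspace_monomial_span])
    show "\<iota> u * x ^ n \<in> {z. \<iota> t * z \<in> monomial_span ((\<lambda>u. t \<otimes> u) ` U)}" if "u \<in> U" for u n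
      using that assms(1,2) monomial_span_base[of "t \<otimes> u" "(\<lambda>u. t \<otimes> u) ` U" n]
      by (auto simp: iota_mult_assoc subset_iff)
  qed
  then show ?thesis using assms by blast
qed

lemma x_mult_monomial_span:
  assumes "U \<subseteq> carrier G" "\<And>u. u \<in> U \<Longrightarrow> u \<otimes> g \<in> U" "z \<in> monomial_span U"
  shows "x * z \<in> monomial_span U"
proof -
  have "monomial_span U \<subseteq> {z. x * z \<in> monomial_span U}"
  proof (rule monomial_span_minimal)
    show "subspace {z. x * z \<in> monomial_span U}"
      by (rule module_hom.subspace_linear_preimage[OF module_hom_linearI[OF linear_mult_left] subspace_monomial_span])
    fix u n assume u: "u \<in> U"
    with assms(1) have "x * (\<iota> u * x ^ n) =
        \<iota> u * x ^ Suc n - scl H (f u) (\<iota> u * x ^ n - \<iota> (u \<otimes> g) * x ^ n)"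
      by (simp add: x_iota subset_iff left_diff_distrib scale_mult_left mult.assoc flip: mult.assoc[of x "\<iota> u"])
    also have "\<dots> \<in> monomial_span U"
      by (intro subspace_diff subspace_scale subspace_monomial_span monomial_span_base u assms(2))
    finally show "\<iota> u * x ^ n \<in> {z. x * z \<in> monomial_span U}" by simp
  qed
  then show ?thesis using assms by blast
qed

text \<open>Moving \<open>x\<close> past \<open>v\<close> produces \<open>v\<close> and \<open>v \<otimes> g\<close>, so the product of monomials with group parts \<open>u\<close>
  and \<open>v\<close> involves only the group parts \<open>u \<otimes> v \<otimes> g [^] j\<close>.\<close>
lemma monomial_span_mult:
  assumes UVW: "U \<subseteq> carrier G" "V \<subseteq> carrier G" "W \<subseteq> carrier G"
    and W: "\<And>u v. u \<in> U \<Longrightarrow> v \<in> V \<Longrightarrow> u \<otimes> v \<in> W" "\<And>w. w \<in> W \<Longrightarrow> w \<otimes> g \<in> W"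
    and ab: "a \<in> monomial_span U" "b \<in> monomial_span V"
  shows "a * b \<in> monomial_span W"
  using subspace_monomial_span ab[unfolded monomial_span_def]
proof (rule mult_in_subspace)
  fix p q assume "p \<in> {\<iota> u * x ^ n |u n. u \<in> U}" "q \<in> {\<iota> u * x ^ n |u n. u \<in> V}"
  then obtain u n v m where u: "u \<in> U" "p = \<iota> u * x ^ n" and v: "v \<in> V" "q = \<iota> v * x ^ m" by blast
  let ?V = "range (\<lambda>j :: nat. v \<otimes> g [^] j)"
  have [simp]: "u \<in> carrier G" "v \<in> carrier G" using u v UVW by auto
  have V: "?V \<subseteq> carrier G" by auto
  have Vg: "w \<otimes> g \<in> ?V" if w: "w \<in> ?V" for w
  proof -
    from w obtain j :: nat where "w = v \<otimes> g [^] j" by blast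
    then show ?thesis by (intro range_eqI[of _ _ "Suc j"]) (simp add: m_assoc)
  qed
  have "v \<in> ?V" by (rule range_eqI[of _ _ 0]) simp
  then have "q \<in> monomial_span ?V" unfolding v by (rule monomial_span_base)
  then have "x ^ n * q \<in> monomial_span ?V"
    by (induction n) (auto simp: mult.assoc intro: x_mult_monomial_span[OF V Vg])
  then have "p * q \<in> monomial_span ((\<lambda>w. u \<otimes> w) ` ?V)"
    unfolding u mult.assoc by (intro iota_mult_monomial_span V) auto
  moreover have "u \<otimes> (v \<otimes> g [^] j) \<in> W" for j :: nat
  proof (induction j)
    case 0 then show ?case using W(1) u v by simp
  next
    case (Suc j)
    then show ?case using W(2)[OF Suc] by (simp add: m_assoc)
  qed
  ultimately show "p * q \<in> monomial_span W"
    using monomial_span_mono[of "(\<lambda>w. u \<otimes> w) ` ?V" W] by blast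
qed

lemma monomial_span_carrier: "monomial_span (carrier G) = UNIV"
proof -
  have "z \<in> monomial_span (carrier G)" for z
  proof (induction z rule: algebra_induct)
    case one then show ?case using iota_in_monomial_span[of \<one> "carrier G"] by (simp add: iota_one)
  next
    case (iota t a)
    then show ?case
      using iota_mult_monomial_span[of t "carrier G" a] monomial_span_mono[of "(\<lambda>u. t \<otimes> u) ` carrier G" "carrier G"] by auto
  next
    case (x a) then show ?case by (intro x_mult_monomial_span) auto
  qed (auto intro: subspace_add subspace_scale subspace_monomial_span)
  then show ?thesis by auto
qed

lemma x_power_reduce: "\<exists>m<CHAR('k). x ^ n = x ^ m"
proof (induction n rule: less_induct)
  case (less n)
  have p: "1 < CHAR('k)" using char_prime by (rule prime_gt_1_nat)
  show ?case
  proof (cases "n < CHAR('k)")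
    case False
    then have "x ^ n = x ^ CHAR('k) * x ^ (n - CHAR('k))" by (simp flip: power_add)
    also have "\<dots> = x ^ Suc (n - CHAR('k))" by (simp only: x_power power_Suc)
    finally show ?thesis using less.IH[of "Suc (n - CHAR('k))"] False p by auto
  qed auto
qed

lemma expansion: "\<exists>a. z = (\<Sum>(t, n)\<in>carrier G \<times> {..<CHAR('k)}. scl H (a t n) (\<iota> t * x ^ n))"
proof -
  let ?I = "carrier G \<times> {..<CHAR('k)}"
  let ?h = "\<lambda>(t, n). \<iota> t * x ^ n"
  have "monomial_span (carrier G) \<subseteq> span (?h ` ?I)"
  proof (rule monomial_span_minimal)
    fix u n assume "u \<in> carrier G"
    with x_power_reduce[of n] show "\<iota> u * x ^ n \<in> span (?h ` ?I)"
      by (intro span_base) force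
  qed simp
  then have "z \<in> span (?h ` ?I)" by (auto simp: monomial_span_carrier)
  then obtain a where "z = (\<Sum>i\<in>?I. scl H (a i) (?h i))"
    using span_image_finite[of ?I ?h] finite_G by auto
  then show ?thesis
    by (intro exI[of _ "\<lambda>t n. a (t, n)"]) (simp add: case_prod_unfold)
qed

text \<open>A nonzero polynomial of degree less than \<open>p\<close> cannot vanish on the whole prime field.\<close>
lemma vanishing_power_sums:
  assumes "\<And>c. c < CHAR('k) \<Longrightarrow> (\<Sum>n<CHAR('k). a n * of_nat c ^ n) = (0 :: 'k)" "n < CHAR('k)"
  shows "a n = 0"
proof -
  let ?q = "\<Sum>n<CHAR('k). monom (a n) n"
  have coeff: "coeff ?q i = (if i < CHAR('k) then a i else 0)" for i
    by (simp add: coeff_sum)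
  have "degree ?q < CHAR('k)"
    by (rule le_less_trans[OF degree_le[of "CHAR('k) - 1"]]) (use char_pos in \<open>auto simp: coeff\<close>)
  then have "?q = 0"
    by (intro poly_eqI_degree[where A = "of_nat ` {..<CHAR('k)}"])
      (use assms(1) char_pos in \<open>auto simp: card_of_nat_CHAR poly_sum poly_monom\<close>)
  with coeff[of n] assms(2) show ?thesis by simp
qed

text \<open>If \<open>z\<close> is the sum of the \<open>a t n \<iota> t x\<^sup>n\<close>, this is the value at \<open>c\<close> of the polynomial with
  coefficients \<open>a t n\<close>.\<close>
definition shifted_coef :: "'a \<Rightarrow> nat \<Rightarrow> 'h \<Rightarrow> 'k" where
  "shifted_coef t c z = coef t ((wind ^^ c) z)"

lemma linear_shifted_coef: "Vector_Spaces.linear (scl H) (*) (shifted_coef t c)"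
  unfolding shifted_coef_def by (rule linear_compose[OF alg_hom_linear[OF wind_pow_hom] linear_coef])

lemmas shifted_coef_scale = module_hom.scale[OF module_hom_linearI[OF linear_shifted_coef]]
  and shifted_coef_diff = module_hom.diff[OF module_hom_linearI[OF linear_shifted_coef]]
  and shifted_coef_sum = module_hom.sum[OF module_hom_linearI[OF linear_shifted_coef]]

lemma shifted_coef_monomial:
  assumes "u \<in> carrier G"
  shows "shifted_coef t c (\<iota> u * x ^ n) = (if u = t then of_nat c ^ n else 0)"
proof -
  have "coef t (a * (x + of_nat c)) = of_nat c * coef t a" for a
    by (simp add: distrib_left coef_add of_nat_scale scale_mult_right coef_scale)
  then have "coef t (\<iota> u * (x + of_nat c) ^ n) = (if u = t then of_nat c ^ n else 0)"
    by (induction n) (simp_all add: coef_iota assms power_Suc2 del: power_Suc flip: mult.assoc)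
  then show ?thesis
    using assms by (simp add: shifted_coef_def alg_hom_mult[OF wind_pow_hom] alg_hom_power[OF wind_pow_hom]
        wind_pow_iota wind_pow_x)
qed

lemma shifted_coef_monomial_span: "U \<subseteq> carrier G \<Longrightarrow> t \<notin> U \<Longrightarrow> z \<in> monomial_span U \<Longrightarrow> shifted_coef t c z = 0"
  using module_hom.eq_0_on_span[OF module_hom_linearI[OF linear_shifted_coef], of "{\<iota> u * x ^ n | u n. u \<in> U}" t c z]
  by (fastforce simp: shifted_coef_monomial monomial_span_def)

lemma coef_monomial_span: "U \<subseteq> carrier G \<Longrightarrow> t \<notin> U \<Longrightarrow> z \<in> monomial_span U \<Longrightarrow> coef t z = 0"
  using shifted_coef_monomial_span[of U t z 0] by (simp add: shifted_coef_def)

text \<open>This contains the linear independence of the monomials \<open>\<iota> t * x ^ n\<close> with \<open>n < p\<close>.\<close>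
lemma shifted_coef_separate:
  assumes "\<And>t c. t \<in> carrier G \<Longrightarrow> shifted_coef t c z = 0"
  shows "z = 0"
proof -
  obtain a where z: "z = (\<Sum>(t, n)\<in>carrier G \<times> {..<CHAR('k)}. scl H (a t n) (\<iota> t * x ^ n))"
    using expansion by blast
  have "a t n = 0" if "t \<in> carrier G" "n < CHAR('k)" for t n
  proof (rule vanishing_power_sums[OF _ that(2)])
    fix c
    have "shifted_coef t c z = (\<Sum>s\<in>carrier G. \<Sum>n<CHAR('k). a s n * (if s = t then of_nat c ^ n else 0))"
      unfolding z sum.cartesian_product shifted_coef_sum
      by (rule sum.cong) (auto simp: shifted_coef_scale shifted_coef_monomial)
    also have "\<dots> = (\<Sum>s\<in>carrier G. if s = t then \<Sum>n<CHAR('k). a t n * of_nat c ^ n else 0)"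
      by (intro sum.cong) auto
    also have "\<dots> = (\<Sum>n<CHAR('k). a t n * of_nat c ^ n)"
      using that finite_G by simp
    finally show "(\<Sum>n<CHAR('k). a t n * of_nat c ^ n) = 0" using assms that by simp
  qed
  then show ?thesis unfolding z by (intro sum.neutral) auto
qed

text \<open>For a fixed point the coefficient polynomials are constant on the prime field, so they agree with
  those of its component in the group algebra.\<close>
lemma wind_fixed:
  assumes "wind z = z"
  shows "z = (\<Sum>t\<in>carrier G. scl H (coef t z) (\<iota> t))"
proof -
  let ?w = "\<Sum>t\<in>carrier G. scl H (coef t z) (\<iota> t)"
  have pow: "(wind ^^ c) z = z" for c by (induction c) (simp_all add: assms)
  have "shifted_coef t c (z - ?w) = 0" if "t \<in> carrier G" for t c
  proof -
    have "shifted_coef t c ?w = (\<Sum>s\<in>carrier G. if s = t then coef t z else 0)"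
      unfolding shifted_coef_sum
      by (intro sum.cong) (use shifted_coef_monomial[of _ t c 0] in \<open>auto simp: shifted_coef_scale\<close>)
    then show ?thesis
      using that finite_G by (simp add: shifted_coef_diff) (simp add: shifted_coef_def pow)
  qed
  then have "z - ?w = 0" by (rule shifted_coef_separate)
  then show ?thesis by simp
qed

lemma wind_x_neq: "wind x \<noteq> x"
  by (simp add: wind_x)

lemma wind_span_iota:
  assumes "U \<subseteq> carrier G" "z \<in> span (\<iota> ` U)" shows "wind z = z"
proof -
  have "subspace {z. wind z = z}"
    by (rule subspaceI) (simp_all add: alg_hom_zero[OF wind_hom] alg_hom_add[OF wind_hom] alg_hom_scale[OF wind_hom])
  then have "span (\<iota> ` U) \<subseteq> {z. wind z = z}"
    using assms(1) by (intro span_minimal) (auto simp: wind_iota)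
  then show ?thesis using assms(2) by blast
qed

section \<open>Group-like and skew-primitive elements\<close>

definition pairing :: "('h \<Rightarrow> 'k) \<Rightarrow> ('h \<Rightarrow> 'k) \<Rightarrow> 'h \<Rightarrow> 'k" where
  "pairing \<alpha> \<beta> z = lin_ext (*) (\<lambda>(a, b). \<alpha> a * \<beta> b) (comult H z)"

lemma bilinear_product:
  assumes "Vector_Spaces.linear (scl H) (*) \<alpha>" "Vector_Spaces.linear (scl H) (*) \<beta>"
  shows "bilinear_mod (scl H) (*) {0} (\<lambda>a b. \<alpha> a * \<beta> b)"
proof -
  interpret \<alpha>: Vector_Spaces.linear "scl H" "(*)" \<alpha> by fact
  interpret \<beta>: Vector_Spaces.linear "scl H" "(*)" \<beta> by fact
  show ?thesis
    by (rule bilinearI) (simp_all add: \<alpha>.add \<beta>.add \<alpha>.scale \<beta>.scale algebra_simps)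
qed

context
  fixes \<alpha> \<beta> :: "'h \<Rightarrow> 'k"
  assumes \<alpha>: "Vector_Spaces.linear (scl H) (*) \<alpha>" and \<beta>: "Vector_Spaces.linear (scl H) (*) \<beta>"
begin

lemma pairing_eq: "teq (comult H z) u \<Longrightarrow> pairing \<alpha> \<beta> z = lin_ext (*) (\<lambda>(a, b). \<alpha> a * \<beta> b) u"
  unfolding pairing_def
  by (rule tensor_eq_lin_ext[OF scalars.vector_space_axioms bilinear_product[OF \<alpha> \<beta>]])

lemma linear_pairing: "Vector_Spaces.linear (scl H) (*) (pairing \<alpha> \<beta>)"
proof (rule linearI[OF vector_space_axioms scalars.vector_space_axioms])
  show "pairing \<alpha> \<beta> (a + b) = pairing \<alpha> \<beta> a + pairing \<alpha> \<beta> b" for a b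
    by (subst pairing_eq[OF comult_add]) (simp add: pairing_def scalars.lin_ext_add)
  show "pairing \<alpha> \<beta> (scl H c a) = c * pairing \<alpha> \<beta> a" for c a
    by (subst pairing_eq[OF comult_scl]) (simp add: pairing_def scalars.lin_ext_scale)
qed

lemmas pairing_add = module_hom.add[OF module_hom_linearI[OF linear_pairing]]
  and pairing_scale = module_hom.scale[OF module_hom_linearI[OF linear_pairing]]
  and pairing_sum = module_hom.sum[OF module_hom_linearI[OF linear_pairing]]

lemma pairing_iota: "t \<in> carrier G \<Longrightarrow> pairing \<alpha> \<beta> (\<iota> t) = \<alpha> (\<iota> t) * \<beta> (\<iota> t)"
  by (simp add: pairing_eq[OF comult_iota])

lemma pairing_wind_fixed:
  assumes "wind z = z"
  shows "pairing \<alpha> \<beta> z = (\<Sum>t\<in>carrier G. coef t z * (\<alpha> (\<iota> t) * \<beta> (\<iota> t)))"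
  by (subst wind_fixed[OF assms], subst pairing_sum) (simp add: pairing_scale pairing_iota)

end

text \<open>The coproduct of an element of the group algebra is diagonal.\<close>
lemma pairing_coef_wind_fixed:
  assumes "wind z = z" "s \<in> carrier G" "t \<in> carrier G"
  shows "pairing (coef s) (coef t) z = (if s = t then coef t z else 0)"
proof -
  have "pairing (coef s) (coef t) z = (\<Sum>r\<in>carrier G. if r = t then (if s = t then coef t z else 0) else 0)"
    unfolding pairing_wind_fixed[OF linear_coef linear_coef assms(1)]
    by (intro sum.cong) (auto simp: coef_iota)
  then show ?thesis using assms(3) finite_G by simp
qed

text \<open>A group-like \<open>z\<close> is an eigenvector of the winding automorphism. As the latter has order \<open>p\<close>, the
  eigenvalue is a \<open>p\<close>-th root of unity, which is one in characteristic \<open>p\<close>. Thus \<open>z\<close> lies in the group algebra, where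
  the coefficients of \<open>z\<close> are orthogonal idempotents.\<close>
lemma grouplike_eq_iota:
  assumes z: "teq (comult H z) (tens z z)" "z \<noteq> 0"
  obtains t where "t \<in> carrier G" "z = \<iota> t"
proof -
  have w: "wind z = scl H (char1 z) z"
    by (simp add: wind_eq[OF z(1)])
  have "(wind ^^ n) z = scl H (char1 z ^ n) z" for n
    by (induction n) (simp_all add: w alg_hom_scale[OF wind_hom] mult.commute)
  from this[of "CHAR('k)"] have "scl H (char1 z ^ CHAR('k)) z = scl H 1 z"
    by (simp add: wind_pow_CHAR)
  then have "char1 z ^ CHAR('k) = 1"
    using z(2) scale_right_imp_eq by blast
  then have "(char1 z - 1) ^ CHAR('k) = 0"
    using scalars.diff_one_power_CHAR[OF char_prime, of "char1 z"] by simp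
  then have "char1 z = 1" by simp
  with w have fixed: "wind z = z" by simp
  have orth: "coef s z * coef t z = (if s = t then coef t z else 0)" if "s \<in> carrier G" "t \<in> carrier G" for s t
    using pairing_coef_wind_fixed[OF fixed that] pairing_eq[OF linear_coef linear_coef z(1), of s t] by simp
  have "\<exists>t\<in>carrier G. coef t z \<noteq> 0"
  proof (rule ccontr)
    assume "\<not> ?thesis"
    then have "z = 0" by (subst wind_fixed[OF fixed]) simp
    with z(2) show False by simp
  qed
  then obtain t where t: "t \<in> carrier G" "coef t z \<noteq> 0" by blast
  have "coef s z = (if s = t then 1 else 0)" if "s \<in> carrier G" for s
    using orth[OF that t(1)] t(2) by (auto split: if_splits)
  then have "z = (\<Sum>s\<in>carrier G. if s = t then \<iota> t else 0)"
    by (subst wind_fixed[OF fixed]) (auto intro!: sum.cong)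
  then have "z = \<iota> t" using t finite_G by simp
  with t(1) show ?thesis by (rule that)
qed

text \<open>Winding adds the constant \<open>char1 y\<close> to \<open>y\<close>, just as it adds one to \<open>x\<close>.\<close>
lemma skew_primitive_form:
  assumes h: "h \<in> carrier G" and y: "teq (comult H y) (tens y 1 + tens (\<iota> h) y)"
  obtains w where "wind w = w" "y = scl H (char1 y) x + w" "char1 y \<noteq> 0 \<Longrightarrow> h = g"
proof -
  define w where "w = y - scl H (char1 y) x"
  have "wind y = y + scl H (char1 y) 1"
    using h by (simp add: wind_eq[OF y] lin_ext_add)
  then have fixed: "wind w = w"
    by (simp add: w_def alg_hom_diff[OF wind_hom] alg_hom_scale[OF wind_hom] wind_x scale_right_distrib)
  have yw: "y = scl H (char1 y) x + w" by (simp add: w_def)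
  \<comment> \<open>A functional that kills the group algebra and is one at \<open>x\<close>. Applied to the right tensor factor of
    the coproduct of \<open>y\<close> it gives \<open>char1 y\<close> times \<open>\<iota> h\<close>, applied to that of \<open>char1 y\<close> times \<open>x\<close> plus \<open>w\<close>
    it gives \<open>char1 y\<close> times \<open>\<iota> g\<close>.\<close>
  define \<beta> where "\<beta> z = char1 z - counit H z" for z
  have \<beta>: "Vector_Spaces.linear (scl H) (*) \<beta>"
    by (rule linearI[OF vector_space_axioms scalars.vector_space_axioms])
      (simp_all add: \<beta>_def alg_hom_add[OF char1] alg_hom_scale[OF char1]
        alg_hom_add[OF counit_alg_hom] alg_hom_scale[OF counit_alg_hom] algebra_simps)
  have \<beta>_simps: "\<beta> 1 = 0" "\<beta> x = 1" "\<And>t. t \<in> carrier G \<Longrightarrow> \<beta> (\<iota> t) = 0"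
    by (simp_all add: \<beta>_def alg_hom_one[OF char1] counit_one)
  have pw: "pairing (coef s) \<beta> w = 0" for s
    by (simp add: pairing_wind_fixed[OF linear_coef \<beta> fixed] \<beta>_simps)
  have px: "pairing (coef s) \<beta> x = (if g = s then 1 else 0)" for s
    by (simp add: pairing_eq[OF linear_coef \<beta> comult_x] scalars.lin_ext_add \<beta>_simps coef_iota)
  have "\<beta> w = 0"
    by (subst wind_fixed[OF fixed])
      (simp add: module_hom.sum[OF module_hom_linearI[OF \<beta>]] module_hom.scale[OF module_hom_linearI[OF \<beta>]] \<beta>_simps)
  then have "\<beta> y = char1 y"
    using yw module_hom.add[OF module_hom_linearI[OF \<beta>]] module_hom.scale[OF module_hom_linearI[OF \<beta>]]
    by (metis \<beta>_simps(2) add.right_neutral mult.right_neutral)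
  then have "pairing (coef h) \<beta> y = char1 y"
    using h by (simp add: pairing_eq[OF linear_coef \<beta> y] scalars.lin_ext_add \<beta>_simps coef_iota)
  moreover have "pairing (coef h) \<beta> y = (if g = h then char1 y else 0)"
    by (subst yw, subst pairing_add[OF linear_coef \<beta>]) (simp add: pairing_scale[OF linear_coef \<beta>] pw px)
  ultimately have "h = g" if "char1 y \<noteq> 0" using that by (auto split: if_splits)
  with fixed yw show ?thesis by (rule that)
qed

section \<open>Hopf automorphisms\<close>

lemma alg_hom_automorphism: "hopf_automorphism H \<Phi> \<Longrightarrow> alg_hom (scl H) (scl H) \<Phi>"
  by (simp add: hopf_automorphism_def alg_hom_def)

text \<open>Members of \<open>auto G\<close> are extensional, which explains the restriction.\<close>
lemma hom_group_automorphism: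
  assumes "\<And>t. t \<in> carrier G \<Longrightarrow> \<sigma> t \<in> carrier G" "inj_on \<sigma> (carrier G)"
    and "\<And>t t'. t \<in> carrier G \<Longrightarrow> t' \<in> carrier G \<Longrightarrow> \<sigma> (t \<otimes> t') = \<sigma> t \<otimes> \<sigma> t'"
  shows "restrict \<sigma> (carrier G) \<in> auto G"
proof -
  have "\<sigma> ` carrier G = carrier G"
    using assms(1,2) finite_G by (intro endo_inj_surj) auto
  then have "bij_betw (restrict \<sigma> (carrier G)) (carrier G) (carrier G)"
    using assms(2) by (simp add: bij_betw_def inj_on_def)
  then show ?thesis
    using assms by (auto simp: auto_def Bij_def hom_def)
qed

text \<open>The image of \<open>x\<close> has the form \<open>a x + w\<close> with \<open>w\<close> in the group algebra. In the image of the
  commutator relation for \<open>t\<close>, the coefficient of \<open>\<sigma> t\<close> does not see \<open>w\<close> and yields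
  \<open>a f(\<sigma> t) = f t\<close>; the choice \<open>t = g\<close> then shows \<open>a = 1\<close>.\<close>
lemma automorphism_induces:
  assumes \<Phi>: "hopf_automorphism H \<Phi>"
  obtains \<sigma> where "\<sigma> \<in> aut_gf G g f" "\<And>t. t \<in> carrier G \<Longrightarrow> \<Phi> (\<iota> t) = \<iota> (\<sigma> t)"
proof -
  note hom = alg_hom_automorphism[OF \<Phi>]
  have inj: "\<Phi> a = \<Phi> b \<longleftrightarrow> a = b" for a b
    using \<Phi> by (auto simp: hopf_automorphism_def bij_def inj_def)
  have \<Phi>_comult: "teq (comult H (\<Phi> a)) (tensor_map \<Phi> u)" if "teq (comult H a) u" for a u
    using \<Phi> tensor_map_cong[OF alg_hom_linear[OF hom] that] unfolding hopf_automorphism_def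
    by (blast intro: tensor_eq_trans)
  have "\<exists>r\<in>carrier G. \<Phi> (\<iota> t) = \<iota> r" if t: "t \<in> carrier G" for t
  proof -
    have "counit H (\<Phi> (\<iota> t)) = 1"
      using \<Phi> t by (simp add: hopf_automorphism_def)
    then have "\<Phi> (\<iota> t) \<noteq> 0" using alg_hom_zero[OF counit_alg_hom] by auto
    moreover have "teq (comult H (\<Phi> (\<iota> t))) (tens (\<Phi> (\<iota> t)) (\<Phi> (\<iota> t)))"
      using \<Phi>_comult[OF comult_iota[OF t]] by simp
    ultimately show ?thesis by (metis grouplike_eq_iota)
  qed
  then obtain \<sigma>0 where \<sigma>0: "\<And>t. t \<in> carrier G \<Longrightarrow> \<sigma>0 t \<in> carrier G \<and> \<Phi> (\<iota> t) = \<iota> (\<sigma>0 t)" by metis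
  define \<sigma> where "\<sigma> = restrict \<sigma>0 (carrier G)"
  have \<sigma>_in: "\<sigma> t \<in> carrier G" and \<sigma>: "\<Phi> (\<iota> t) = \<iota> (\<sigma> t)" if "t \<in> carrier G" for t
    using \<sigma>0[OF that] that by (simp_all add: \<sigma>_def)
  have auto: "\<sigma> \<in> auto G"
    unfolding \<sigma>_def
  proof (rule hom_group_automorphism)
    show "inj_on \<sigma>0 (carrier G)"
      using \<sigma>0 by (intro inj_onI) (metis inj iota_eq_iff)
    show "\<sigma>0 (t \<otimes> t') = \<sigma>0 t \<otimes> \<sigma>0 t'" if "t \<in> carrier G" "t' \<in> carrier G" for t t'
    proof -
      have "\<iota> (\<sigma>0 (t \<otimes> t')) = \<iota> (\<sigma>0 t \<otimes> \<sigma>0 t')"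
        using \<sigma>0 that by (metis alg_hom_mult[OF hom] iota_mult m_closed)
      then show ?thesis using \<sigma>0 that by (simp add: iota_eq_iff)
    qed
  qed (use \<sigma>0 in auto)
  then have surj: "\<sigma> ` carrier G = carrier G"
    by (auto simp: auto_def Bij_def bij_betw_def)
  have "teq (comult H (\<Phi> x)) (tens (\<Phi> x) 1 + tens (\<iota> (\<sigma> g)) (\<Phi> x))"
    using \<Phi>_comult[OF comult_x] by (simp add: tensor_map_add alg_hom_one[OF hom] \<sigma>)
  from skew_primitive_form[OF \<sigma>_in[OF g_in] this]
  obtain w where w: "wind w = w" and \<Phi>x: "\<Phi> x = scl H (char1 (\<Phi> x)) x + w"
    and g_fix: "char1 (\<Phi> x) \<noteq> 0 \<Longrightarrow> \<sigma> g = g" by blast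
  define a where "a = char1 (\<Phi> x)"
  \<comment> \<open>Otherwise \<open>x\<close> would lie in the group algebra, which \<open>\<Phi>\<close> maps onto itself.\<close>
  have "a \<noteq> 0"
  proof
    assume "a = 0"
    then have "\<Phi> x = w" using \<Phi>x by (simp add: a_def)
    also have "w \<in> \<Phi> ` span (\<iota> ` carrier G)"
    proof -
      have "w \<in> span (\<iota> ` carrier G)"
        by (subst wind_fixed[OF w]) (intro span_sum span_scale span_base imageI)
      also have "\<iota> ` carrier G = \<Phi> ` \<iota> ` carrier G"
      proof -
        have "\<Phi> ` \<iota> ` carrier G = \<iota> ` \<sigma> ` carrier G"
          unfolding image_image by (rule image_cong) (simp_all add: \<sigma>)
        then show ?thesis by (simp add: surj)
      qed
      also have "span (\<Phi> ` \<iota> ` carrier G) = \<Phi> ` span (\<iota> ` carrier G)"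
        by (rule module_hom.span_image[OF module_hom_linearI[OF alg_hom_linear[OF hom]]])
      finally show ?thesis .
    qed
    finally have "x \<in> span (\<iota> ` carrier G)" using inj by auto
    then show False using wind_span_iota[of "carrier G" x] wind_x_neq by auto
  qed
  then have g_fix: "\<sigma> g = g" using g_fix by (simp add: a_def)
  have af: "a * f (\<sigma> t) = f t" if t: "t \<in> carrier G" for t
  proof -
    let ?r = "\<sigma> t"
    have r [simp]: "?r \<in> carrier G" using \<sigma>_in t by simp
    have rg: "?r \<otimes> g \<noteq> ?r" using g_ne_one r by simp
    have coef_w: "coef ?r (\<iota> ?r * w - w * \<iota> ?r) = 0"
    proof -
      have "\<iota> ?r * w = (\<Sum>s\<in>carrier G. scl H (coef s w) (\<iota> (?r \<otimes> s)))"
        by (subst wind_fixed[OF w], unfold sum_distrib_left, rule sum.cong)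
          (simp_all add: scale_mult_right iota_mult)
      moreover have "w * \<iota> ?r = (\<Sum>s\<in>carrier G. scl H (coef s w) (\<iota> (s \<otimes> ?r)))"
        by (subst wind_fixed[OF w], unfold sum_distrib_right, rule sum.cong)
          (simp_all add: scale_mult_left iota_mult)
      ultimately show ?thesis
        by (simp add: coef_diff coef_sum coef_scale coef_iota)
    qed
    have "\<Phi> (\<iota> t * x - x * \<iota> t) = \<Phi> (scl H (f t) (\<iota> t * (1 - \<iota> g)))"
      using t by (simp add: commutator)
    then have "\<iota> ?r * \<Phi> x - \<Phi> x * \<iota> ?r = scl H (f t) (\<iota> ?r * (1 - \<iota> g))"
      using t by (simp add: alg_hom_mult[OF hom] alg_hom_diff[OF hom] alg_hom_scale[OF hom] alg_hom_one[OF hom] \<sigma> g_fix)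
    moreover have "\<iota> ?r * \<Phi> x - \<Phi> x * \<iota> ?r = scl H a (\<iota> ?r * x - x * \<iota> ?r) + (\<iota> ?r * w - w * \<iota> ?r)"
      by (subst (1 2) \<Phi>x) (simp add: a_def algebra_simps scale_mult_left scale_mult_right)
    ultimately have "scl H a (scl H (f ?r) (\<iota> ?r * (1 - \<iota> g))) + (\<iota> ?r * w - w * \<iota> ?r)
        = scl H (f t) (\<iota> ?r * (1 - \<iota> g))"
      by (simp add: commutator)
    from arg_cong[OF this, of "coef ?r"] show ?thesis
      using rg coef_w by (simp add: coef_add coef_scale right_diff_distrib coef_diff iota_mult coef_iota)
  qed
  from af[of g] have "a = 1" by (simp add: g_fix)
  with af auto g_fix have "\<sigma> \<in> aut_gf G g f" by (simp add: aut_gf_def)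
  with \<sigma> show ?thesis by (rule that[rotated])
qed

lemma aut_gf_props:
  assumes "\<sigma> \<in> aut_gf G g f"
  shows "t \<in> carrier G \<Longrightarrow> \<sigma> t \<in> carrier G"
    and "t \<in> carrier G \<Longrightarrow> t' \<in> carrier G \<Longrightarrow> \<sigma> (t \<otimes> t') = \<sigma> t \<otimes> \<sigma> t'"
    and "\<sigma> g = g" "t \<in> carrier G \<Longrightarrow> f (\<sigma> t) = f t" "bij_betw \<sigma> (carrier G) (carrier G)"
    and "\<sigma> \<one> = \<one>" "t \<in> carrier G \<Longrightarrow> \<sigma> (inv t) = inv (\<sigma> t)"
proof -
  have "\<sigma> \<in> hom G G" and bij: "bij_betw \<sigma> (carrier G) (carrier G)"
    using assms by (auto simp: aut_gf_def auto_def Bij_def)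
  then interpret group_hom G G \<sigma> by unfold_locales
  show "t \<in> carrier G \<Longrightarrow> \<sigma> t \<in> carrier G"
    and "t \<in> carrier G \<Longrightarrow> t' \<in> carrier G \<Longrightarrow> \<sigma> (t \<otimes> t') = \<sigma> t \<otimes> \<sigma> t'"
    and "\<sigma> \<one> = \<one>" "t \<in> carrier G \<Longrightarrow> \<sigma> (inv t) = inv (\<sigma> t)" by auto
  show "\<sigma> g = g" "t \<in> carrier G \<Longrightarrow> f (\<sigma> t) = f t" "bij_betw \<sigma> (carrier G) (carrier G)"
    using assms bij by (auto simp: aut_gf_def)
qed

lemma antipode_one: "antipode H 1 = 1"
  using antipode_iota[of \<one>] by (simp add: iota_one)

lemma antipode_iota_mult: "t \<in> carrier G \<Longrightarrow> antipode H (\<iota> t * z) = antipode H z * \<iota> (inv t)"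
proof -
  assume t: "t \<in> carrier G"
  have "antipode H (\<iota> t * z) * \<iota> t * \<iota> (inv t) = antipode H z * \<iota> (inv t)"
    using antipode_grouplike_mult[OF comult_iota[OF t]] t by simp
  then show ?thesis using t by (simp add: mult.assoc iota_mult iota_one)
qed

lemma antipode_x_mult: "antipode H (x * z) = - (antipode H z * \<iota> (inv g) * x)"
  using antipode_skew_primitive_mult[OF comult_x] by (simp add: antipode_iota_mult)

lemma endomorphism_of_aut_gf:
  assumes \<sigma>: "\<sigma> \<in> aut_gf G g f"
  obtains \<Phi> where "alg_hom (scl H) (scl H) \<Phi>" "\<And>t. t \<in> carrier G \<Longrightarrow> \<Phi> (\<iota> t) = \<iota> (\<sigma> t)" "\<Phi> x = x"
proof -
  note \<sigma>' = aut_gf_props[OF \<sigma>]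
  have "\<exists>\<Phi>. alg_hom (scl H) (scl H) \<Phi> \<and> (\<forall>t\<in>carrier G. \<Phi> (\<iota> t) = \<iota> (\<sigma> t)) \<and> \<Phi> x = x"
    by (rule algebra_lift[OF assoc_algebra_axioms]) (simp_all add: \<sigma>' iota_mult iota_one commutator x_power)
  then show ?thesis using that by blast
qed

lemma algebra_hom_eqI:
  assumes "alg_hom (scl H) s' \<Phi>" "alg_hom (scl H) s' \<Psi>"
    and "\<And>t. t \<in> carrier G \<Longrightarrow> \<Phi> (\<iota> t) = \<Psi> (\<iota> t)" "\<Phi> x = \<Psi> x"
  shows "\<Phi> z = \<Psi> z"
proof (induction z rule: algebra_induct)
  case one show ?case by (simp add: assms(1,2)[THEN alg_hom_one])
next
  case (add a b) then show ?case by (simp add: assms(1,2)[THEN alg_hom_add])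
next
  case (scale c a) then show ?case by (simp add: assms(1,2)[THEN alg_hom_scale])
next
  case (iota t a) then show ?case by (simp add: assms(1,2)[THEN alg_hom_mult] assms(3))
next
  case (x a) then show ?case by (simp add: assms(1,2)[THEN alg_hom_mult] assms(4))
qed

lemma aut_gf_inverse:
  assumes \<sigma>: "\<sigma> \<in> aut_gf G g f"
  obtains \<sigma>' where "\<sigma>' \<in> aut_gf G g f" "\<And>t. t \<in> carrier G \<Longrightarrow> \<sigma>' (\<sigma> t) = t"
    "\<And>t. t \<in> carrier G \<Longrightarrow> \<sigma> (\<sigma>' t) = t"
proof -
  note p = aut_gf_props[OF \<sigma>]
  define \<sigma>0 where "\<sigma>0 = inv_into (carrier G) \<sigma>"
  have bij: "bij_betw \<sigma>0 (carrier G) (carrier G)"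
    unfolding \<sigma>0_def by (rule bij_betw_inv_into[OF p(5)])
  have l: "\<sigma>0 (\<sigma> t) = t" and r: "\<sigma> (\<sigma>0 t) = t" and in0: "\<sigma>0 t \<in> carrier G" if "t \<in> carrier G" for t
    using that p(5) bij by (auto simp: \<sigma>0_def bij_betw_inv_into_left bij_betw_inv_into_right bij_betw_apply)
  define \<sigma>' where "\<sigma>' = restrict \<sigma>0 (carrier G)"
  have "\<sigma>' \<in> auto G"
    unfolding \<sigma>'_def
  proof (rule hom_group_automorphism)
    show "\<sigma>0 (t \<otimes> t') = \<sigma>0 t \<otimes> \<sigma>0 t'" if "t \<in> carrier G" "t' \<in> carrier G" for t t'
      using l[of "\<sigma>0 t \<otimes> \<sigma>0 t'"] that by (simp add: p(2) r in0)
  qed (use bij in0 in \<open>auto simp: bij_betw_def\<close>)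
  moreover have "f (\<sigma>0 t) = f t" if "t \<in> carrier G" for t
    using p(4)[OF in0[OF that]] r[OF that] by simp
  moreover have "\<sigma>0 g = g" using l[of g] by (simp add: p(3))
  ultimately have "\<sigma>' \<in> aut_gf G g f" by (simp add: aut_gf_def \<sigma>'_def)
  then show ?thesis
    by (rule that) (simp_all add: \<sigma>'_def l r p(1))
qed

lemma automorphism_of_aut_gf:
  assumes \<sigma>: "\<sigma> \<in> aut_gf G g f"
  obtains \<Phi> where "hopf_automorphism H \<Phi>" "\<And>t. t \<in> carrier G \<Longrightarrow> \<Phi> (\<iota> t) = \<iota> (\<sigma> t)" "\<Phi> x = x"
proof -
  note p = aut_gf_props[OF \<sigma>]
  obtain \<Phi> where hom: "alg_hom (scl H) (scl H) \<Phi>" and \<Phi>: "\<And>t. t \<in> carrier G \<Longrightarrow> \<Phi> (\<iota> t) = \<iota> (\<sigma> t)" "\<Phi> x = x"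
    using endomorphism_of_aut_gf[OF \<sigma>] by blast
  obtain \<sigma>' where \<sigma>': "\<sigma>' \<in> aut_gf G g f" and inv: "\<And>t. t \<in> carrier G \<Longrightarrow> \<sigma>' (\<sigma> t) = t"
    "\<And>t. t \<in> carrier G \<Longrightarrow> \<sigma> (\<sigma>' t) = t"
    using aut_gf_inverse[OF \<sigma>] by blast
  obtain \<Phi>' where hom': "alg_hom (scl H) (scl H) \<Phi>'" and \<Phi>': "\<And>t. t \<in> carrier G \<Longrightarrow> \<Phi>' (\<iota> t) = \<iota> (\<sigma>' t)" "\<Phi>' x = x"
    using endomorphism_of_aut_gf[OF \<sigma>'] by blast
  have id: "alg_hom (scl H) (scl H) (\<lambda>z. z)" by (simp add: alg_hom_def linear_ident)
  have "\<Phi>' (\<Phi> z) = z" for z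
    by (rule algebra_hom_eqI[OF alg_hom_compose[OF hom hom'] id]) (simp_all add: \<Phi> \<Phi>' p(1) inv)
  moreover have "\<Phi> (\<Phi>' z) = z" for z
    by (rule algebra_hom_eqI[OF alg_hom_compose[OF hom' hom] id])
      (simp_all add: \<Phi> \<Phi>' aut_gf_props(1)[OF \<sigma>'] inv)
  ultimately have bij: "bij \<Phi>" by (metis bijI injI surjI)
  have counit: "counit H (\<Phi> z) = counit H z" for z
    by (rule algebra_hom_eqI[OF alg_hom_compose[OF hom counit_alg_hom] counit_alg_hom]) (simp_all add: \<Phi> p(1))
  have antipode: "antipode H (\<Phi> z) = \<Phi> (antipode H z)" for z
  proof (induction z rule: algebra_induct)
    case one show ?case by (simp add: alg_hom_one[OF hom] antipode_one)
  next
    case (x a)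
    have "\<Phi> (- b) = - \<Phi> b" for b
      using alg_hom_diff[OF hom, of 0 b] by (simp add: alg_hom_zero[OF hom])
    with x show ?case by (simp add: alg_hom_mult[OF hom] \<Phi> antipode_x_mult p)
  qed (simp_all add: alg_hom_mult[OF hom] alg_hom_add[OF hom] alg_hom_scale[OF hom] antipode_add antipode_scale
      \<Phi> antipode_iota_mult p)
  have comult: "teq (comult H (\<Phi> z)) (tensor_map \<Phi> (comult H z))" for z
  proof -
    have step: "teq (comult H (\<Phi> (b * a))) (tensor_map \<Phi> (comult H (b * a)))"
      if "teq (comult H (\<Phi> b)) (tensor_map \<Phi> (comult H b))" "teq (comult H (\<Phi> a)) (tensor_map \<Phi> (comult H a))" for a b
    proof -
      have "teq (comult H (\<Phi> (b * a))) (tensor_mult (comult H (\<Phi> b)) (comult H (\<Phi> a)))"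
        by (simp add: alg_hom_mult[OF hom] comult_mult)
      also have "teq \<dots> (tensor_mult (tensor_map \<Phi> (comult H b)) (tensor_map \<Phi> (comult H a)))"
        by (rule tensor_mult_cong[OF that])
      also have "\<dots> = tensor_map \<Phi> (tensor_mult (comult H b) (comult H a))"
        by (simp add: tensor_map_mult alg_hom_mult[OF hom])
      also have "teq \<dots> (tensor_map \<Phi> (comult H (b * a)))"
        by (rule tensor_map_cong[OF alg_hom_linear[OF hom] tensor_eq_sym[OF comult_mult]])
      finally show ?thesis .
    qed
    have gen: "teq (comult H (\<Phi> b)) (tensor_map \<Phi> (comult H b))"
      if "teq (comult H b) u" "teq (comult H (\<Phi> b)) (tensor_map \<Phi> u)" for b u
      using that(2) tensor_map_cong[OF alg_hom_linear[OF hom] tensor_eq_sym[OF that(1)]] by (rule tensor_eq_trans)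
    show ?thesis
    proof (induction z rule: algebra_induct)
      case one show ?case by (rule gen[OF comult_one]) (simp add: alg_hom_one[OF hom] comult_one)
    next
      case (add a b)
      have "teq (comult H (\<Phi> (a + b))) (comult H (\<Phi> a) + comult H (\<Phi> b))"
        by (simp add: alg_hom_add[OF hom] comult_add)
      also have "teq \<dots> (tensor_map \<Phi> (comult H a + comult H b))"
        unfolding tensor_map_add by (rule tensor_eq_add[OF add])
      also have "teq \<dots> (tensor_map \<Phi> (comult H (a + b)))"
        by (rule tensor_map_cong[OF alg_hom_linear[OF hom] tensor_eq_sym[OF comult_add]])
      finally show ?case .
    next
      case (scale c a)
      have "teq (comult H (\<Phi> (scl H c a))) (fs_scale c (comult H (\<Phi> a)))"
        by (simp add: alg_hom_scale[OF hom] comult_scl)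
      also have "teq \<dots> (tensor_map \<Phi> (fs_scale c (comult H a)))"
        unfolding tensor_map_scale by (rule tensor_eq_scale[OF scale])
      also have "teq \<dots> (tensor_map \<Phi> (comult H (scl H c a)))"
        by (rule tensor_map_cong[OF alg_hom_linear[OF hom] tensor_eq_sym[OF comult_scl]])
      finally show ?case .
    next
      case (iota t a)
      show ?case
        by (rule step[OF gen[OF comult_iota] iota(2)]) (use iota(1) in \<open>simp_all add: \<Phi> comult_iota p(1)\<close>)
    next
      case (x a)
      show ?case
        by (rule step[OF gen[OF comult_x] x])
          (simp add: tensor_map_add \<Phi> alg_hom_one[OF hom] comult_x p(3))
    qed
  qed
  have "hopf_automorphism H \<Phi>"
    using bij hom counit antipode comult by (simp add: hopf_automorphism_def alg_hom_def)
  then show ?thesis using \<Phi> by (rule that)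
qed

end

context hopf_algebra
begin

section \<open>Hopf subalgebras and exact factorizations\<close>

lemma tens_in_formal: "a \<in> B \<Longrightarrow> b \<in> T \<Longrightarrow> tens a b \<in> tensor_formal B T"
  by (simp add: tensor_formal_def)

lemma subspace_comult_restricts:
  "subspace {b. \<exists>u\<in>tensor_formal B T. tensor_eq (scl H) (comult H b) u}"
proof (rule subspaceI)
  have "tensor_eq (scl H) (comult H (scl H 0 0)) (fs_scale 0 (comult H 0))" by (rule comult_scl)
  then show "0 \<in> {b. \<exists>u\<in>tensor_formal B T. tensor_eq (scl H) (comult H b) u}"
    using formal.subspace_0[OF subspace_tensor_formal] by fastforce
next
  fix a b c
  assume "a \<in> {b. \<exists>u\<in>tensor_formal B T. tensor_eq (scl H) (comult H b) u}"
  then obtain u where u: "u \<in> tensor_formal B T" "tensor_eq (scl H) (comult H a) u" by blast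
  have "tensor_eq (scl H) (comult H (scl H c a)) (fs_scale c u)"
    using comult_scl tensor_eq_scale[OF u(2)] by (rule tensor_eq_trans)
  then show "scl H c a \<in> {b. \<exists>u\<in>tensor_formal B T. tensor_eq (scl H) (comult H b) u}"
    using formal.subspace_scale[OF subspace_tensor_formal u(1)] by blast
  assume "b \<in> {b. \<exists>u\<in>tensor_formal B T. tensor_eq (scl H) (comult H b) u}"
  then obtain v where v: "v \<in> tensor_formal B T" "tensor_eq (scl H) (comult H b) v" by blast
  have "tensor_eq (scl H) (comult H (a + b)) (u + v)"
    using comult_add tensor_eq_add[OF u(2) v(2)] by (rule tensor_eq_trans)
  then show "a + b \<in> {b. \<exists>u\<in>tensor_formal B T. tensor_eq (scl H) (comult H b) u}"
    using formal.subspace_add[OF subspace_tensor_formal u(1) v(1)] by blast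
qed

lemma comult_restricts_mult:
  assumes "\<exists>u\<in>tensor_formal B B. tensor_eq (scl H) (comult H a) u" "\<exists>u\<in>tensor_formal B B. tensor_eq (scl H) (comult H b) u"
    and "\<And>a b. a \<in> B \<Longrightarrow> b \<in> B \<Longrightarrow> a * b \<in> B"
  shows "\<exists>u\<in>tensor_formal B B. tensor_eq (scl H) (comult H (a * b)) u"
proof -
  obtain u v where "u \<in> tensor_formal B B" "tensor_eq (scl H) (comult H a) u"
    "v \<in> tensor_formal B B" "tensor_eq (scl H) (comult H b) v" using assms(1,2) by blast
  then show ?thesis
    using tensor_eq_trans[OF comult_mult tensor_mult_cong] tensor_mult_in_formal[of u B B v] assms(3) by blast
qed

abbreviation mult_map :: "('h \<times> 'h \<Rightarrow>\<^sub>0 'k) \<Rightarrow> 'h" where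
  "mult_map \<equiv> lin_ext (scl H) (\<lambda>(b, t). b * t)"

lemma mult_map_null: "u \<in> tensor_null (scl H) B T \<Longrightarrow> mult_map u = 0"
  by (rule tensor_null_lin_ext[OF vector_space_axioms bilinearI])
    (simp_all add: distrib_left distrib_right scale_mult_left scale_mult_right)

text \<open>Bijectivity of the multiplication map, without the quotient: its image on representatives, and its
  kernel.\<close>
lemma exact_factorization_iff:
  "exact_factorization H B T \<longleftrightarrow> hopf_subalgebra H B \<and> hopf_subalgebra H T \<and>
     mult_map ` tensor_formal B T = UNIV \<and>
     (\<forall>u\<in>tensor_formal B T. mult_map u = 0 \<longrightarrow> u \<in> tensor_null (scl H) B T)"
proof -
  let ?R = "tensor_rel (scl H) B T" and ?F = "tensor_formal B T"
  let ?m = "\<lambda>X. the_elem (mult_map ` X)"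
  have rel: "(u, v) \<in> ?R \<longleftrightarrow> u \<in> ?F \<and> v \<in> ?F \<and> u - v \<in> tensor_null (scl H) B T" for u v
    by (simp add: tensor_rel_def)
  have refl: "u \<in> ?F \<Longrightarrow> (u, u) \<in> ?R" for u
    by (simp add: rel formal.subspace_0[OF subspace_tensor_null])
  have m: "?m (?R `` {u}) = mult_map u" if "u \<in> ?F" for u
  proof -
    have "mult_map v = mult_map u" if "(u, v) \<in> ?R" for v
      using that mult_map_null[of "u - v" B T] by (simp add: rel lin_ext_diff)
    then have "mult_map ` (?R `` {u}) = {mult_map u}"
      using refl[OF that] by blast
    then show ?thesis by simp
  qed
  have "?m ` (?F // ?R) = mult_map ` ?F"
    using m by (force simp: quotient_def image_iff)
  moreover have "inj_on ?m (?F // ?R) \<longleftrightarrow> (\<forall>u\<in>?F. mult_map u = 0 \<longrightarrow> u \<in> tensor_null (scl H) B T)"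
  proof
    assume inj: "inj_on ?m (?F // ?R)"
    have 0: "0 \<in> ?F" by (rule formal.subspace_0[OF subspace_tensor_formal])
    show "\<forall>u\<in>?F. mult_map u = 0 \<longrightarrow> u \<in> tensor_null (scl H) B T"
    proof (intro ballI impI)
      fix u assume u: "u \<in> ?F" "mult_map u = 0"
      then have "?R `` {u} = ?R `` {0}"
        using m[OF u(1)] m[OF 0] by (intro inj_onD[OF inj] quotientI u(1) 0) simp_all
      then have "(u, 0) \<in> ?R" using refl[OF 0] by blast
      then show "u \<in> tensor_null (scl H) B T" by (simp add: rel)
    qed
  next
    assume ker: "\<forall>u\<in>?F. mult_map u = 0 \<longrightarrow> u \<in> tensor_null (scl H) B T"
    show "inj_on ?m (?F // ?R)"
    proof (rule inj_onI)
      fix X Y assume "X \<in> ?F // ?R" "Y \<in> ?F // ?R" and eq: "?m X = ?m Y"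
      then obtain u v where u: "u \<in> ?F" "X = ?R `` {u}" and v: "v \<in> ?F" "Y = ?R `` {v}"
        by (auto simp: quotient_def)
      have "u - v \<in> tensor_null (scl H) B T"
        using eq m u v ker formal.subspace_diff[OF subspace_tensor_formal u(1) v(1)] by (simp add: lin_ext_diff)
      then have uv: "u - v \<in> tensor_null (scl H) B T" "v - u \<in> tensor_null (scl H) B T"
        using formal.subspace_neg[OF subspace_tensor_null, of "u - v"] by fastforce+
      have "(u, w) \<in> ?R \<longleftrightarrow> (v, w) \<in> ?R" for w
        using formal.subspace_add[OF subspace_tensor_null uv(2), of "u - w"]
          formal.subspace_add[OF subspace_tensor_null uv(1), of "v - w"] u v by (auto simp: rel)
      then show "X = Y" using u v by blast
    qed
  qed
  ultimately show ?thesis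
    unfolding exact_factorization_def bij_betw_def by auto
qed

text \<open>For \<open>z\<close> in both factors, \<open>z \<otimes> 1\<close> and \<open>1 \<otimes> z\<close> have the same product, so they are equal. This says
  that \<open>z\<close> is a scalar, in the form in which it is tested on bilinear forms.\<close>
lemma exact_factorization_inter:
  assumes ex: "exact_factorization H B T" and z: "z \<in> B" "z \<in> T"
    and \<beta>: "bilinear_mod (scl H) (*) {0} \<beta>"
  shows "\<beta> z 1 = \<beta> 1 z"
proof -
  let ?u = "tens z 1 - tens 1 z :: 'h \<times> 'h \<Rightarrow>\<^sub>0 'k"
  have one: "1 \<in> B" "1 \<in> T"
    using ex by (auto simp: exact_factorization_def hopf_subalgebra_def)
  have "?u \<in> tensor_formal B T"
    by (rule formal.subspace_diff[OF subspace_tensor_formal]) (use one z in \<open>auto simp: tensor_formal_def\<close>)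
  moreover have "mult_map ?u = 0" by (simp add: lin_ext_diff)
  ultimately have "?u \<in> tensor_null (scl H) B T"
    using ex by (auto simp: exact_factorization_iff)
  from tensor_null_lin_ext[OF scalars.vector_space_axioms \<beta> this] show ?thesis
    by (simp add: scalars.lin_ext_diff)
qed

text \<open>A Hopf subalgebra contains the coproduct components of its elements, as seen through functionals. In
  particular it is stable under the winding automorphism.\<close>
lemma slice_in_subalgebra:
  assumes T: "hopf_subalgebra H T" "z \<in> T" and \<alpha>: "Vector_Spaces.linear (scl H) (*) \<alpha>"
  shows "lin_ext (scl H) (\<lambda>(a, b). scl H (\<alpha> a) b) (comult H z) \<in> T"
    and "lin_ext (scl H) (\<lambda>(a, b). scl H (\<alpha> b) a) (comult H z) \<in> T"
proof -
  interpret \<alpha>: Vector_Spaces.linear "scl H" "(*)" \<alpha> by fact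
  obtain u where u: "u \<in> tensor_formal T T" "tensor_eq (scl H) (comult H z) u"
    using T by (auto simp: hopf_subalgebra_def)
  have sub: "subspace T" using T by (simp add: hopf_subalgebra_def)
  have "bilinear_mod (scl H) (scl H) {0} (\<lambda>a b. scl H (\<alpha> a) b)"
    and "bilinear_mod (scl H) (scl H) {0} (\<lambda>a b. scl H (\<alpha> b) a)"
    by (rule bilinearI; simp add: \<alpha>.add \<alpha>.scale scale_left_distrib scale_right_distrib mult.commute)+
  note this[THEN tensor_eq_lin_ext[OF vector_space_axioms _ u(2)]]
  moreover have "lin_ext (scl H) (\<lambda>(a, b). scl H (\<alpha> a) b) u \<in> T" "lin_ext (scl H) (\<lambda>(a, b). scl H (\<alpha> b) a) u \<in> T"
    by (rule lin_ext_in_subspace[OF sub]; use u(1) sub in \<open>auto simp: tensor_formal_def intro!: subspace_scale\<close>)+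
  ultimately show "lin_ext (scl H) (\<lambda>(a, b). scl H (\<alpha> a) b) (comult H z) \<in> T"
    and "lin_ext (scl H) (\<lambda>(a, b). scl H (\<alpha> b) a) (comult H z) \<in> T" by simp_all
qed

end

context third_type
begin

lemma iota_in_monomial_span_iff: "U \<subseteq> carrier G \<Longrightarrow> t \<in> carrier G \<Longrightarrow> \<iota> t \<in> monomial_span U \<longleftrightarrow> t \<in> U"
  using coef_monomial_span[of U t "\<iota> t"] iota_in_monomial_span[of t U] by (auto simp: coef_iota)

lemma span_iota_monomial_span: "span (\<iota> ` U) \<subseteq> monomial_span U"
  by (rule span_minimal[OF _ subspace_monomial_span]) (auto intro: iota_in_monomial_span)

lemma iota_in_span_iff: "U \<subseteq> carrier G \<Longrightarrow> t \<in> carrier G \<Longrightarrow> \<iota> t \<in> span (\<iota> ` U) \<longleftrightarrow> t \<in> U"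
  using span_iota_monomial_span[of U] iota_in_monomial_span_iff[of U t] by (auto intro: span_base)

lemma x_notin_span_iota: "U \<subseteq> carrier G \<Longrightarrow> x \<notin> span (\<iota> ` U)"
  using wind_span_iota[of U x] wind_x_neq by auto

lemma hopf_subalgebra_monomial_span:
  assumes U: "subgroup U G" "g \<in> U"
  shows "hopf_subalgebra H (monomial_span U)"
  unfolding hopf_subalgebra_def
proof (intro conjI ballI image_subsetI)
  interpret U: subgroup U G by fact
  let ?B = "monomial_span U"
  note sub = U.subset
  have iota: "\<iota> t \<in> ?B" if "t \<in> U" for t using that by (rule iota_in_monomial_span)
  show "subspace ?B" by (rule subspace_monomial_span)
  show one: "1 \<in> ?B" using iota[OF U.one_closed] by (simp add: iota_one)
  show mult: "a * b \<in> ?B" if "a \<in> ?B" "b \<in> ?B" for a b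
    by (rule monomial_span_mult[OF sub sub sub _ _ that]) (use U in auto)
  have x: "x \<in> ?B" using monomial_span_base[OF U.one_closed, of 1] by (simp add: iota_one)
  have power: "a ^ n \<in> ?B" if "a \<in> ?B" for a n
    by (induction n) (use one mult that in auto)
  show "\<exists>u\<in>tensor_formal ?B ?B. teq (comult H b) u" if "b \<in> ?B" for b
  proof -
    let ?C = "{b. \<exists>u\<in>tensor_formal ?B ?B. teq (comult H b) u}"
    have C_mult: "a * b \<in> ?C" if "a \<in> ?C" "b \<in> ?C" for a b
      using comult_restricts_mult[of ?B a b] that mult by blast
    have C_one: "1 \<in> ?C"
      using comult_one tens_in_formal[OF one one] by blast
    have C_iota: "\<iota> t \<in> ?C" if "t \<in> U" for t
      using comult_iota[of t] that sub tens_in_formal[OF iota iota] by blast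
    have "tens x 1 + tens (\<iota> g) x \<in> tensor_formal ?B ?B"
      by (rule formal.subspace_add[OF subspace_tensor_formal])
        (use x one iota U in \<open>auto simp: tensor_formal_def\<close>)
    then have C_x: "x \<in> ?C" using comult_x by blast
    have "x ^ n \<in> ?C" for n
      by (induction n) (use C_one C_mult[OF C_x] in auto)
    then have "?B \<subseteq> ?C"
      by (intro monomial_span_minimal subspace_comult_restricts C_mult C_iota)
    then show ?thesis using that by blast
  qed
  show "antipode H b \<in> ?B" if "b \<in> ?B" for b
  proof -
    have "?B \<subseteq> {b. antipode H b \<in> ?B}"
    proof (rule monomial_span_minimal)
      show "subspace {b. antipode H b \<in> ?B}"
        by (rule module_hom.subspace_linear_preimage[OF module_hom_linearI[OF antipode_linear] subspace_monomial_span])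
      have "antipode H (x ^ n) \<in> ?B" for n
      proof (induction n)
        case (Suc n)
        then show ?case
          using iota[OF U.m_inv_closed[OF U(2)]] x mult subspace_neg[OF subspace_monomial_span]
          by (simp add: antipode_x_mult)
      qed (simp add: antipode_one one)
      then show "\<iota> u * x ^ n \<in> {b. antipode H b \<in> ?B}" if "u \<in> U" for u n
        using that sub mult iota[OF U.m_inv_closed[OF that]] by (auto simp: antipode_iota_mult)
    qed
    then show ?thesis using that by blast
  qed
qed

lemma rank_one_factor_eq:
  assumes U: "subgroup U G" "g \<in> U"
  shows "rank_one_factor H \<iota> x U = monomial_span U"
  unfolding rank_one_factor_def
proof (rule hull_unique)
  interpret U: subgroup U G by fact
  show "\<iota> ` U \<union> {x} \<subseteq> monomial_span U"
    using monomial_span_base[OF U.one_closed, of 1] by (auto simp: iota_one intro: iota_in_monomial_span)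
  show "hopf_subalgebra H (monomial_span U)" by (rule hopf_subalgebra_monomial_span[OF U])
  fix B assume B: "\<iota> ` U \<union> {x} \<subseteq> B" "hopf_subalgebra H B"
  then have "x ^ n \<in> B" for n
    by (induction n) (auto simp: hopf_subalgebra_def)
  with B show "monomial_span U \<subseteq> B"
    by (intro monomial_span_minimal) (auto simp: hopf_subalgebra_def)
qed

lemma hopf_subalgebra_group:
  assumes U: "subgroup U G"
  shows "hopf_subalgebra H (span (\<iota> ` U))"
  unfolding hopf_subalgebra_def
proof (intro conjI ballI image_subsetI)
  interpret U: subgroup U G by fact
  let ?B = "span (\<iota> ` U)"
  have iota: "\<iota> t \<in> ?B" if "t \<in> U" for t using that by (intro span_base imageI)
  show "subspace ?B" by simp
  show "1 \<in> ?B" using iota[OF U.one_closed] by (simp add: iota_one)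
  show "a * b \<in> ?B" if "a \<in> ?B" "b \<in> ?B" for a b
    by (rule mult_in_subspace[OF _ that]) (auto simp: iota_mult iota)
  show "\<exists>u\<in>tensor_formal ?B ?B. teq (comult H b) u" if "b \<in> ?B" for b
  proof -
    have "\<iota> t \<in> {b. \<exists>u\<in>tensor_formal ?B ?B. teq (comult H b) u}" if "t \<in> U" for t
      using comult_iota[of t] that U.subset tens_in_formal[OF iota iota] by blast
    then have "?B \<subseteq> {b. \<exists>u\<in>tensor_formal ?B ?B. teq (comult H b) u}"
      by (intro span_minimal subspace_comult_restricts image_subsetI)
    then show ?thesis using that by blast
  qed
  show "antipode H b \<in> ?B" if "b \<in> ?B" for b
  proof -
    have "?B \<subseteq> {b. antipode H b \<in> ?B}"
      by (intro span_minimal image_subsetI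
          module_hom.subspace_linear_preimage[OF module_hom_linearI[OF antipode_linear] subspace_span])
        (simp add: antipode_iota iota)
    then show ?thesis using that by blast
  qed
qed

section \<open>Exact factorizations and group factorizations\<close>

lemma tens_scale_sum_right_null:
  assumes T: "subspace T" and b: "b \<in> B" and F: "finite F" "\<And>r. r \<in> F \<Longrightarrow> y r \<in> T"
    and B: "subspace B"
  shows "tens b (\<Sum>r\<in>F. scl H (c r) (y r)) - (\<Sum>r\<in>F. tens (scl H (c r) b) (y r)) \<in> tensor_null (scl H) B T"
  using F
proof (induction F rule: finite_induct)
  case empty
  have "tens b (scl H 0 0) - fs_scale 0 (tens b 0) \<in> tensor_null (scl H) B T"
    by (rule tens_scale_right_null) (use b T in \<open>auto intro: subspace_0\<close>)
  then show ?case by simp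
next
  case (insert r F)
  let ?N = "tensor_null (scl H) B T" and ?s = "\<Sum>r\<in>F. scl H (c r) (y r)"
  note add = formal.subspace_add[OF subspace_tensor_null]
  note diff = formal.subspace_diff[OF subspace_tensor_null]
  have y: "y r \<in> T" "scl H (c r) (y r) \<in> T" using insert.prems T by (auto intro: subspace_scale)
  have s: "?s \<in> T" using insert.prems T by (auto intro: subspace_sum subspace_scale)
  have "tens b (scl H (c r) (y r) + ?s) - tens b (scl H (c r) (y r)) - tens b ?s \<in> ?N"
    by (rule tens_add_right_null[OF b y(2) s])
  from add[OF this add[OF insert.IH diff[OF tens_scale_right_null[OF b y(1), of "scl H" "c r"]
        tens_scale_left_null[OF b y(1), of "scl H" "c r"]]]]
  show ?case using insert by (simp add: algebra_simps)
qed

text \<open>Modulo the bilinearity relations, an element of the tensor product with a group algebra has a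
  single left coefficient for each group element, as the group elements form a basis.\<close>
lemma tensor_group_normal_form:
  assumes B: "subspace B" and \<Gamma>: "\<Gamma> \<subseteq> carrier G" and u: "u \<in> tensor_formal B (span (\<iota> ` \<Gamma>))"
  shows "u - (\<Sum>r\<in>\<Gamma>. tens (lin_ext (scl H) (\<lambda>(b, t). scl H (coef r t) b) u) (\<iota> r))
    \<in> tensor_null (scl H) B (span (\<iota> ` \<Gamma>))"
proof -
  let ?T = "span (\<iota> ` \<Gamma>)"
  let ?F = "tensor_formal B ?T" and ?N = "tensor_null (scl H) B ?T"
  define b where "b r u = lin_ext (scl H) (\<lambda>(b, t). scl H (coef r t) b) u" for r u
  define W where "W = {u \<in> ?F. u - (\<Sum>r\<in>\<Gamma>. tens (b r u) (\<iota> r)) \<in> ?N}"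
  note add = formal.subspace_add[OF subspace_tensor_null, of _ "scl H" B ?T]
  note sum = formal.subspace_sum[OF subspace_tensor_null, of _ _ "scl H" B ?T]
  have fin: "finite \<Gamma>" using \<Gamma> finite_G finite_subset by blast
  have iota: "\<iota> r \<in> ?T" if "r \<in> \<Gamma>" for r using that by (intro span_base imageI)
  have bB: "b r u \<in> B" if "u \<in> ?F" for r u
    unfolding b_def by (rule lin_ext_in_subspace[OF B])
      (use that in \<open>auto simp: tensor_formal_def intro!: subspace_scale[OF B]\<close>)
  have b_add: "b r (u + v) = b r u + b r v" and b_scale: "b r (fs_scale c u) = scl H c (b r u)" for r u v c
    by (simp_all add: b_def lin_ext_add lin_ext_scale)
  have W: "formal.subspace W"
  proof (rule formal.subspaceI)
    have "tens 0 (\<iota> r) \<in> ?N" if "r \<in> \<Gamma>" for r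
      using tens_scale_left_null[OF subspace_0[OF B] iota[OF that], of "scl H" 0] by simp
    then have "(\<Sum>r\<in>\<Gamma>. tens 0 (\<iota> r)) \<in> ?N" by (rule sum)
    from formal.subspace_neg[OF subspace_tensor_null this]
    show "0 \<in> W"
      using formal.subspace_0[OF subspace_tensor_formal] by (simp add: W_def b_def)
  next
    fix u v c assume "u \<in> W"
    then have u: "u \<in> ?F" "u - (\<Sum>r\<in>\<Gamma>. tens (b r u) (\<iota> r)) \<in> ?N" by (auto simp: W_def)
    have "(\<Sum>r\<in>\<Gamma>. tens (scl H c (b r u)) (\<iota> r) - fs_scale c (tens (b r u) (\<iota> r))) \<in> ?N"
      by (rule sum) (intro tens_scale_left_null bB u iota)
    from formal.subspace_diff[OF subspace_tensor_null formal.subspace_scale[OF subspace_tensor_null u(2), of c] this]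
    show "fs_scale c u \<in> W"
      using formal.subspace_scale[OF subspace_tensor_formal u(1)]
      by (simp add: W_def b_scale formal.scale_right_diff_distrib formal.scale_sum_right sum_subtractf)
    assume "v \<in> W"
    then have v: "v \<in> ?F" "v - (\<Sum>r\<in>\<Gamma>. tens (b r v) (\<iota> r)) \<in> ?N" by (auto simp: W_def)
    have "(\<Sum>r\<in>\<Gamma>. tens (b r u + b r v) (\<iota> r) - tens (b r u) (\<iota> r) - tens (b r v) (\<iota> r)) \<in> ?N"
      by (rule sum) (intro tens_add_left_null bB u v iota)
    from formal.subspace_diff[OF subspace_tensor_null add[OF u(2) v(2)] this]
    show "u + v \<in> W"
      using formal.subspace_add[OF subspace_tensor_formal u(1) v(1)]
      by (simp add: W_def b_add sum_subtractf sum.distrib algebra_simps)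
  qed
  have tens_W: "tens b' t \<in> W" if bt: "b' \<in> B" "t \<in> ?T" for b' t
  proof -
    have "wind t = t" using wind_span_iota[OF \<Gamma> bt(2)] .
    have zero: "coef r t = 0" if "r \<in> carrier G - \<Gamma>" for r
      using coef_monomial_span[OF \<Gamma>, of r t] that bt(2) span_iota_monomial_span by auto
    have "t = (\<Sum>r\<in>carrier G. scl H (coef r t) (\<iota> r))" by (rule wind_fixed) fact
    also have "\<dots> = (\<Sum>r\<in>\<Gamma>. scl H (coef r t) (\<iota> r))"
      by (rule sum.mono_neutral_right) (use \<Gamma> finite_G zero in auto)
    finally have t: "t = (\<Sum>r\<in>\<Gamma>. scl H (coef r t) (\<iota> r))" .
    have "tens b' (\<Sum>r\<in>\<Gamma>. scl H (coef r t) (\<iota> r)) - (\<Sum>r\<in>\<Gamma>. tens (scl H (coef r t) b') (\<iota> r)) \<in> ?N"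
      by (rule tens_scale_sum_right_null[OF subspace_span bt(1) fin iota B])
    then have "tens b' t - (\<Sum>r\<in>\<Gamma>. tens (scl H (coef r t) b') (\<iota> r)) \<in> ?N"
      by (simp only: t[symmetric])
    then show ?thesis by (simp add: W_def b_def tens_in_formal bt)
  qed
  have "u \<in> W"
    by (rule formal_in_subspace[OF W]) (use u tens_W in \<open>auto simp: tensor_formal_def\<close>)
  then show ?thesis by (simp add: W_def b_def)
qed

text \<open>The commutator relation reads \<open>t x = (x + f(t) (1 - g)) t\<close>. It brings the monomials of \<open>H\<close> into the
  form of a product of the rank-one factor with the group algebra of the complement.\<close>
lemma iota_x_power:
  assumes "t \<in> carrier G"
  shows "\<iota> t * x ^ n = (x + scl H (f t) (1 - \<iota> g)) ^ n * \<iota> t"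
proof (induction n)
  case (Suc n)
  have "\<iota> t * \<iota> g = \<iota> g * \<iota> t" using assms by (simp add: iota_mult g_central)
  then have "\<iota> t * x = (x + scl H (f t) (1 - \<iota> g)) * \<iota> t"
    using commutator[OF assms] by (simp add: algebra_simps scale_mult_left)
  then have "\<iota> t * x ^ Suc n = (x + scl H (f t) (1 - \<iota> g)) * (\<iota> t * x ^ n)"
    by (simp flip: mult.assoc)
  then show ?case by (simp only: Suc power_Suc mult.assoc)
qed simp

text \<open>Injectivity: the product of the normal form is the sum of the \<open>b r * \<iota> r\<close>, whose group parts lie in
  the cosets \<open>U #> r\<close>. These are pairwise disjoint since \<open>U\<close> and \<open>\<Gamma>\<close> meet trivially, so the shifted
  coefficients show that each summand vanishes.\<close>
lemma group_factorization_exact: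
  assumes "(U, \<Gamma>) \<in> group_factorizations G g"
  shows "exact_factorization H (monomial_span U) (span (\<iota> ` \<Gamma>))"
  unfolding exact_factorization_iff
proof (intro conjI ballI impI)
  have U: "subgroup U G" "g \<in> U" and \<Gamma>: "subgroup \<Gamma> G" and prod: "U <#> \<Gamma> = carrier G"
    and int: "U \<inter> \<Gamma> = {\<one>}"
    using assms by (auto simp: group_factorizations_def)
  interpret U: subgroup U G by fact
  interpret \<Gamma>: subgroup \<Gamma> G by fact
  let ?B = "monomial_span U" and ?T = "span (\<iota> ` \<Gamma>)"
  note subs = U.subset \<Gamma>.subset
  show B: "hopf_subalgebra H ?B" by (rule hopf_subalgebra_monomial_span[OF U])
  show "hopf_subalgebra H ?T" by (rule hopf_subalgebra_group[OF \<Gamma>])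
  have iota_B: "\<iota> t \<in> ?B" if "t \<in> U" for t using that by (rule iota_in_monomial_span)
  have iota_T: "\<iota> t \<in> ?T" if "t \<in> \<Gamma>" for t using that by (intro span_base imageI)
  have one: "1 \<in> ?B" and mult_B: "\<And>a b. a \<in> ?B \<Longrightarrow> b \<in> ?B \<Longrightarrow> a * b \<in> ?B"
    using B by (auto simp: hopf_subalgebra_def)
  have x_B: "x \<in> ?B" using monomial_span_base[OF U.one_closed, of 1] by (simp add: iota_one)
  have power_B: "a \<in> ?B \<Longrightarrow> a ^ n \<in> ?B" for a n by (induction n) (auto simp: one mult_B)
  have "monomial_span (carrier G) \<subseteq> mult_map ` tensor_formal ?B ?T"
  proof (rule monomial_span_minimal)
    show "subspace (mult_map ` tensor_formal ?B ?T)"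
      by (rule module_hom.subspace_image[OF module_hom_linearI[OF linear_lin_ext] subspace_tensor_formal])
    fix t n assume "t \<in> carrier G"
    then have "t \<in> U <#> \<Gamma>" by (simp add: prod)
    then obtain b c where bc: "b \<in> U" "c \<in> \<Gamma>" "t = b \<otimes> c"
      unfolding set_mult_def by blast
    define a where "a = \<iota> b * (x + scl H (f c) (1 - \<iota> g)) ^ n"
    have "a \<in> ?B"
      unfolding a_def by (intro mult_B iota_B bc power_B subspace_add[OF subspace_monomial_span] x_B
          subspace_scale[OF subspace_monomial_span] subspace_diff[OF subspace_monomial_span] one U)
    then have "tens a (\<iota> c) \<in> tensor_formal ?B ?T" by (intro tens_in_formal iota_T bc)
    moreover have "\<iota> t * x ^ n = mult_map (tens a (\<iota> c))"
      using bc subs by (simp add: a_def mult.assoc iota_x_power[symmetric] iota_mult_assoc subset_iff)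
    ultimately show "\<iota> t * x ^ n \<in> mult_map ` tensor_formal ?B ?T" by blast
  qed
  then show "mult_map ` tensor_formal ?B ?T = UNIV" by (auto simp: monomial_span_carrier)
  fix u assume u: "u \<in> tensor_formal ?B ?T" and mult0: "mult_map u = 0"
  define b where "b r = lin_ext (scl H) (\<lambda>(b, t). scl H (coef r t) b) u" for r
  let ?v = "\<Sum>r\<in>\<Gamma>. tens (b r) (\<iota> r)"
  have nf: "u - ?v \<in> tensor_null (scl H) ?B ?T"
    unfolding b_def by (rule tensor_group_normal_form[OF subspace_monomial_span \<Gamma>.subset u])
  have b_B: "b r \<in> ?B" for r
    unfolding b_def by (rule lin_ext_in_subspace[OF subspace_monomial_span])
      (use u in \<open>auto simp: tensor_formal_def intro!: subspace_scale[OF subspace_monomial_span]\<close>)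
  have sum0: "(\<Sum>r\<in>\<Gamma>. b r * \<iota> r) = 0"
    using mult_map_null[OF nf] mult0 by (simp add: lin_ext_diff lin_ext_sum)
  have coset: "b r * \<iota> r \<in> monomial_span (U #> r)" "U #> r \<subseteq> carrier G" if r: "r \<in> \<Gamma>" for r
  proof -
    have rG: "r \<in> carrier G" using r subs by auto
    show sub: "U #> r \<subseteq> carrier G" using rG subs r_coset_subset_G by blast
    have "w \<otimes> g \<in> U #> r" if w: "w \<in> U #> r" for w
    proof -
      from w obtain s where s: "s \<in> U" "w = s \<otimes> r" by (auto simp: r_coset_def)
      then have "w \<otimes> g = (s \<otimes> g) \<otimes> r"
        using rG subs g_central[OF rG] by (auto simp: m_assoc)
      then show ?thesis using s U by (auto simp: r_coset_def)
    qed
    then show "b r * \<iota> r \<in> monomial_span (U #> r)"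
      using rG by (intro monomial_span_mult[OF subs(1) _ sub _ _ b_B iota_in_monomial_span[of r "{r}"]])
        (auto simp: r_coset_def)
  qed
  have disj: "r = r'" if "r \<in> \<Gamma>" "r' \<in> \<Gamma>" "t \<in> U #> r" "t \<in> U #> r'" for r r' t
  proof -
    from that obtain s s' where s: "s \<in> U" "s' \<in> U" "s \<otimes> r = s' \<otimes> r'" by (auto simp: r_coset_def)
    have G: "s \<in> carrier G" "s' \<in> carrier G" "r \<in> carrier G" "r' \<in> carrier G" using that s subs by auto
    then have "inv s' \<otimes> s = r' \<otimes> inv r"
      using s(3) by (metis inv_solve_left inv_solve_right' inv_closed m_assoc m_closed)
    moreover have "inv s' \<otimes> s \<in> U" "r' \<otimes> inv r \<in> \<Gamma>" using that s by auto
    ultimately have "r' \<otimes> inv r = \<one>" using int by auto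
    then show ?thesis using G by (metis inv_equality inv_inv inv_closed)
  qed
  have "b r = 0" if r: "r \<in> \<Gamma>" for r
  proof -
    have "b r * \<iota> r = 0"
    proof (rule shifted_coef_separate)
      fix t c
      show "shifted_coef t c (b r * \<iota> r) = 0"
      proof (cases "t \<in> U #> r")
        case True
        have "0 = (\<Sum>q\<in>\<Gamma>. shifted_coef t c (b q * \<iota> q))"
          unfolding shifted_coef_sum[symmetric] sum0 by (simp add: shifted_coef_def alg_hom_zero[OF wind_pow_hom])
        also have "\<dots> = (\<Sum>q\<in>\<Gamma>. if q = r then shifted_coef t c (b r * \<iota> r) else 0)"
        proof (rule sum.cong[OF refl])
          fix q assume q: "q \<in> \<Gamma>"
          have "shifted_coef t c (b q * \<iota> q) = 0" if "q \<noteq> r"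
            by (rule shifted_coef_monomial_span[OF coset(2)[OF q] _ coset(1)[OF q]]) (use disj[OF r q True] that in blast)
          then show "shifted_coef t c (b q * \<iota> q) = (if q = r then shifted_coef t c (b r * \<iota> r) else 0)" by simp
        qed
        also have "\<dots> = shifted_coef t c (b r * \<iota> r)"
          using r finite_subset[OF subs(2) finite_G] by simp
        finally show ?thesis by simp
      next
        case False
        then show ?thesis by (rule shifted_coef_monomial_span[OF coset(2)[OF r] _ coset(1)[OF r]])
      qed
    qed
    then have "b r * (\<iota> r * \<iota> (inv r)) = 0" by (simp flip: mult.assoc)
    then show ?thesis using r subs by (simp add: iota_mult iota_one subset_iff)
  qed
  moreover have "tens 0 (\<iota> r) \<in> tensor_null (scl H) ?B ?T" if "r \<in> \<Gamma>" for r
    using tens_scale_left_null[OF subspace_0[OF subspace_monomial_span[of U]] iota_T[OF that], of "scl H" 0] by simp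
  ultimately have "?v \<in> tensor_null (scl H) ?B ?T"
    by (intro formal.subspace_sum[OF subspace_tensor_null]) simp
  then show "u \<in> tensor_null (scl H) ?B ?T"
    using formal.subspace_add[OF subspace_tensor_null nf] by fastforce
qed

lemma group_factorization_oriented:
  assumes "(U, \<Gamma>) \<in> group_factorizations G g"
  shows "(rank_one_factor H \<iota> x U, group_subalgebra H \<iota> \<Gamma>) \<in> oriented_factorizations G g H \<iota> x"
proof -
  have U: "subgroup U G" "g \<in> U" and \<Gamma>: "subgroup \<Gamma> G" and int: "U \<inter> \<Gamma> = {\<one>}" and "\<Gamma> \<noteq> {\<one>}"
    using assms by (auto simp: group_factorizations_def)
  then obtain r where r: "r \<in> \<Gamma>" "r \<noteq> \<one>"
    using subgroup.one_closed by blast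
  then have "r \<notin> U" "r \<in> carrier G" using int subgroup.subset[OF \<Gamma>] by auto
  then have "\<iota> r \<notin> monomial_span U"
    using iota_in_monomial_span_iff subgroup.subset[OF U(1)] by blast
  then have "monomial_span U \<noteq> UNIV" by blast
  moreover have "span (\<iota> ` \<Gamma>) \<noteq> UNIV"
    using x_notin_span_iota[OF subgroup.subset[OF \<Gamma>]] by blast
  ultimately show ?thesis
    using group_factorization_exact[OF assms] U
    by (auto simp: oriented_factorizations_def group_subalgebra_def rank_one_factor_eq)
qed

text \<open>The operator \<open>\<tau> - id\<close> lowers the degree in \<open>x\<close>. In terms of generators: it commutes with \<open>\<iota> t\<close>,
  and \<open>(\<tau> - id)(x a) = x (\<tau> - id)(a) + \<tau> a\<close>.\<close>
lemma wind_defect_nilpotent: "\<exists>n. ((\<lambda>z. wind z - z) ^^ n) z = 0"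
proof -
  define N where "N z = wind z - z" for z
  have N_add: "(N ^^ n) (a + b) = (N ^^ n) a + (N ^^ n) b" and N_scale: "(N ^^ n) (scl H c a) = scl H c ((N ^^ n) a)"
    and N_iota: "t \<in> carrier G \<Longrightarrow> (N ^^ n) (\<iota> t * a) = \<iota> t * (N ^^ n) a"
    and N_wind: "(N ^^ n) (wind a) = wind ((N ^^ n) a)" for n a b c t
    by (induction n) (simp_all add: N_def alg_hom_add[OF wind_hom] alg_hom_scale[OF wind_hom] alg_hom_mult[OF wind_hom]
        alg_hom_diff[OF wind_hom] wind_iota scale_right_diff_distrib right_diff_distrib)
  have N_0: "(N ^^ n) 0 = 0" for n
    using N_scale[of n 0 0] by simp
  have mono: "(N ^^ m) a = 0" if "(N ^^ n) a = 0" "n \<le> m" for n m a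
  proof -
    have "(N ^^ m) a = (N ^^ (m - n)) ((N ^^ n) a)"
      using that(2) funpow_add[of "m - n" n N] by (simp add: o_def)
    then show ?thesis by (simp add: that N_0)
  qed
  have N_x: "\<exists>m. (N ^^ m) (x * a) = 0" if "(N ^^ n) a = 0" for n a
    using that
  proof (induction n arbitrary: a)
    case 0 then show ?case by (intro exI[of _ 0]) simp
  next
    case (Suc n)
    then have "(N ^^ n) (N a) = 0" by (simp add: funpow_swap1)
    from Suc.IH[OF this] obtain m where m: "(N ^^ m) (x * N a) = 0" by blast
    define k where "k = max m (Suc n)"
    have "(N ^^ k) (x * N a) = 0" "(N ^^ k) (wind a) = 0"
      using mono[OF m, of k] mono[OF Suc.prems, of k] by (simp_all add: k_def N_wind alg_hom_zero[OF wind_hom])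
    moreover have "N (x * a) = x * N a + wind a"
      by (simp add: N_def alg_hom_mult[OF wind_hom] wind_x algebra_simps)
    ultimately have "(N ^^ Suc k) (x * a) = 0"
      by (simp add: N_add funpow_Suc_right del: funpow.simps(2))
    then show ?case by blast
  qed
  have "\<exists>n. (N ^^ n) z = 0"
  proof (induction z rule: algebra_induct)
    case one show ?case by (intro exI[of _ 1]) (simp add: N_def alg_hom_one[OF wind_hom])
  next
    case (add a b)
    then obtain n m where "(N ^^ n) a = 0" "(N ^^ m) b = 0" by blast
    then have "(N ^^ max n m) (a + b) = 0"
      using mono[of n a "max n m"] mono[of m b "max n m"] by (simp add: N_add)
    then show ?case by blast
  next
    case (x a) then show ?case using N_x by blast
  next
    case (iota t a)
    then obtain n where "(N ^^ n) a = 0" by blast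
    then show ?case using iota by (intro exI[of _ n]) (simp add: N_iota)
  qed (auto simp: N_scale)
  then show ?thesis unfolding N_def .
qed

definition right_slice :: "'a \<Rightarrow> 'h \<Rightarrow> 'h" where
  "right_slice r z = lin_ext (scl H) (\<lambda>(a, b). scl H (coef r b) a) (comult H z)"

lemma right_slice_eq: "teq (comult H z) u \<Longrightarrow> right_slice r z = lin_ext (scl H) (\<lambda>(a, b). scl H (coef r b) a) u"
  unfolding right_slice_def
  by (rule tensor_eq_lin_ext[OF vector_space_axioms bilinearI])
    (simp_all add: coef_add coef_scale scale_left_distrib scale_right_distrib mult.commute)

lemma linear_right_slice: "Vector_Spaces.linear (scl H) (scl H) (right_slice r)"
proof (rule linearI[OF vector_space_axioms vector_space_axioms])
  show "right_slice r (a + b) = right_slice r a + right_slice r b" for a b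
    by (subst right_slice_eq[OF comult_add]) (simp add: right_slice_def lin_ext_add)
  show "right_slice r (scl H c a) = scl H c (right_slice r a)" for c a
    by (subst right_slice_eq[OF comult_scl]) (simp add: right_slice_def lin_ext_scale)
qed

lemmas right_slice_add = module_hom.add[OF module_hom_linearI[OF linear_right_slice]]
  and right_slice_scale = module_hom.scale[OF module_hom_linearI[OF linear_right_slice]]
  and right_slice_sum = module_hom.sum[OF module_hom_linearI[OF linear_right_slice]]

lemma right_slice_iota: "t \<in> carrier G \<Longrightarrow> right_slice r (\<iota> t) = (if t = r then \<iota> t else 0)"
  by (simp add: right_slice_eq[OF comult_iota] coef_iota)

lemma right_slice_iota_x:
  assumes "t \<in> carrier G"
  shows "right_slice r (\<iota> t * x) = (if t = r then \<iota> t * x else 0)"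
proof -
  have "teq (comult H (\<iota> t * x)) (tensor_mult (tens (\<iota> t) (\<iota> t)) (tens x 1 + tens (\<iota> g) x))"
    using comult_mult tensor_mult_cong[OF comult_iota[OF assms] comult_x] by (rule tensor_eq_trans)
  then have "teq (comult H (\<iota> t * x)) (tens (\<iota> t * x) (\<iota> t) + tens (\<iota> t * \<iota> g) (\<iota> t * x))"
    by (simp add: tensor_mult_def formal.lin_ext_add)
  from right_slice_eq[OF this] show ?thesis
    by (simp add: lin_ext_add coef_iota assms)
qed

lemma right_slice_wind_fixed:
  assumes "wind w = w" "r \<in> carrier G"
  shows "right_slice r w = scl H (coef r w) (\<iota> r)"
    and "right_slice r (w * x) = scl H (coef r w) (\<iota> r * x)"
proof -
  have "right_slice r w = (\<Sum>t\<in>carrier G. if t = r then scl H (coef r w) (\<iota> r) else 0)"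
    by (subst wind_fixed[OF assms(1)], subst right_slice_sum, rule sum.cong)
      (auto simp: right_slice_scale right_slice_iota)
  then show "right_slice r w = scl H (coef r w) (\<iota> r)" using assms(2) finite_G by simp
  have "right_slice r (w * x) = (\<Sum>t\<in>carrier G. if t = r then scl H (coef r w) (\<iota> r * x) else 0)"
    by (subst wind_fixed[OF assms(1)], unfold sum_distrib_right, subst right_slice_sum, rule sum.cong)
      (auto simp: scale_mult_left right_slice_scale right_slice_iota_x)
  then show "right_slice r (w * x) = scl H (coef r w) (\<iota> r * x)" using assms(2) finite_G by simp
qed

text \<open>If \<open>T\<close> is not contained in the group algebra, then repeated application of \<open>\<tau> - id\<close> to an element
  outside ends in some \<open>y\<close> in \<open>T\<close> of degree one, \<open>y = v x + w\<close> with \<open>v \<noteq> 0\<close> and \<open>v\<close>, \<open>w\<close> in the group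
  algebra. For \<open>r\<close> in the support of \<open>v\<close> the slice of \<open>y\<close> at \<open>r\<close> is a combination of \<open>r x\<close> and \<open>r\<close>
  in which \<open>r x\<close> occurs, and \<open>r\<close> is in \<open>T\<close>. So \<open>x\<close> is in \<open>T\<close>.\<close>
lemma hopf_subalgebra_without_x:
  assumes T: "hopf_subalgebra H T" and x: "x \<notin> T"
  shows "T = span (\<iota> ` {t \<in> carrier G. \<iota> t \<in> T})"
proof
  let ?\<Gamma> = "{t \<in> carrier G. \<iota> t \<in> T}"
  have sub: "subspace T" and mult: "\<And>a b. a \<in> T \<Longrightarrow> b \<in> T \<Longrightarrow> a * b \<in> T"
    and anti: "\<And>a. a \<in> T \<Longrightarrow> antipode H a \<in> T"
    using T by (auto simp: hopf_subalgebra_def)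
  show "span (\<iota> ` ?\<Gamma>) \<subseteq> T"
    by (rule span_minimal[OF _ sub]) auto
  have slice: "right_slice r z \<in> T" if "z \<in> T" for r z
    unfolding right_slice_def by (rule slice_in_subalgebra(2)[OF T that linear_coef])
  have wind: "wind z \<in> T" if "z \<in> T" for z
    unfolding wind_def by (rule slice_in_subalgebra(1)[OF T that alg_hom_linear[OF char1]])
  have unscale: "a \<in> T" if "scl H c a \<in> T" "c \<noteq> 0" for a c
    using subspace_scale[OF sub that(1), of "inverse c"] that(2) by simp
  have supp: "\<iota> r \<in> T" if w: "wind w = w" "w \<in> T" and r: "r \<in> carrier G" "coef r w \<noteq> 0" for w r
    using slice[OF w(2), of r] right_slice_wind_fixed(1)[OF w(1) r(1)] r(2) unscale by simp
  have fixed: "z \<in> span (\<iota> ` ?\<Gamma>)" if z: "wind z = z" "z \<in> T" for z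
  proof -
    have "scl H (coef t z) (\<iota> t) \<in> span (\<iota> ` ?\<Gamma>)" if "t \<in> carrier G" for t
    proof (cases "coef t z = 0")
      case False
      then show ?thesis using supp[OF z that] that by (intro span_scale span_base) auto
    qed (simp add: span_zero)
    then have "(\<Sum>t\<in>carrier G. scl H (coef t z) (\<iota> t)) \<in> span (\<iota> ` ?\<Gamma>)" by (rule span_sum)
    then show ?thesis using wind_fixed[OF z(1)] by simp
  qed
  define N where "N z = wind z - z" for z
  have N_T: "(N ^^ n) z \<in> T" if "z \<in> T" for n z
    by (induction n) (auto simp: that N_def intro: subspace_diff[OF sub] wind)
  show "T \<subseteq> span (\<iota> ` ?\<Gamma>)"
  proof
    fix z assume z: "z \<in> T"
    have "wind z = z"
    proof (rule ccontr)
      assume neq: "wind z \<noteq> z"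
      \<comment> \<open>As \<open>N z \<noteq> 0\<close> this is at least two; then \<open>y\<close> is taken two steps before the end.\<close>
      define n where "n = (LEAST n. (N ^^ n) z = 0)"
      have n: "(N ^^ n) z = 0"
        unfolding n_def by (rule LeastI_ex) (use wind_defect_nilpotent[of z] in \<open>unfold N_def\<close>)
      have less: "(N ^^ m) z \<noteq> 0" if "m < n" for m
        using that not_less_Least[of m "\<lambda>n. (N ^^ n) z = 0"] by (simp add: n_def)
      have "z \<noteq> 0" using neq by (auto simp: alg_hom_zero[OF wind_hom])
      then obtain m where m: "n = Suc (Suc m)"
        using n neq by (cases n; cases "n - 1") (auto simp: N_def)
      define y where "y = (N ^^ m) z"
      define v where "v = N y"
      have yT: "y \<in> T" and vT: "v \<in> T" and v0: "v \<noteq> 0" and v: "wind v = v"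
        using N_T[OF z, of m] N_T[OF z, of "Suc m"] less[of "Suc m"] n
        by (simp_all add: y_def v_def m N_def)
      define w where "w = y - v * x"
      have yv: "wind y = y + v" by (simp add: v_def N_def)
      have w: "wind w = w"
        by (simp add: w_def alg_hom_diff[OF wind_hom] alg_hom_mult[OF wind_hom] wind_x v yv algebra_simps)
      have "\<exists>r\<in>carrier G. coef r v \<noteq> 0"
      proof (rule ccontr)
        assume "\<not> ?thesis"
        then have "v = 0" by (subst wind_fixed[OF v]) simp
        with v0 show False by simp
      qed
      then obtain r where r: "r \<in> carrier G" "coef r v \<noteq> 0" by blast
      have rT: "\<iota> r \<in> T" by (rule supp[OF v vT r])
      have "right_slice r y = right_slice r (v * x) + right_slice r w"
        by (simp add: w_def flip: right_slice_add)
      also have "\<dots> = scl H (coef r v) (\<iota> r * x) + scl H (coef r w) (\<iota> r)"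
        using right_slice_wind_fixed v w r by simp
      finally have "scl H (coef r v) (\<iota> r * x) = right_slice r y - scl H (coef r w) (\<iota> r)" by simp
      also have "\<dots> \<in> T" by (intro subspace_diff[OF sub] subspace_scale[OF sub] slice yT rT)
      finally have "\<iota> r * x \<in> T" using r(2) unscale by blast
      then have "\<iota> (inv r) * (\<iota> r * x) \<in> T"
        using mult anti[OF rT] r by (simp add: antipode_iota)
      then show False using x r by (simp add: iota_mult_assoc iota_one)
    qed
    then show "z \<in> span (\<iota> ` ?\<Gamma>)" using fixed z by blast
  qed
qed

text \<open>Elements common to both factors are scalars, so \<open>x\<close> is not in \<open>T\<close> and the groups meet trivially.
  Products of elements of the factors have their group parts in \<open>U <#> \<Gamma>\<close>, which is therefore all of
  \<open>G\<close>.\<close>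
lemma oriented_factorization_group:
  assumes "(B, T) \<in> oriented_factorizations G g H \<iota> x"
  obtains U \<Gamma> where "(U, \<Gamma>) \<in> group_factorizations G g"
    "B = rank_one_factor H \<iota> x U" "T = group_subalgebra H \<iota> \<Gamma>"
proof -
  obtain U where ex: "exact_factorization H B T" and BU: "B \<noteq> UNIV"
    and U: "subgroup U G" "g \<in> U" and B: "B = rank_one_factor H \<iota> x U"
    using assms by (auto simp: oriented_factorizations_def)
  note B' = B[unfolded rank_one_factor_eq[OF U]]
  interpret U: subgroup U G by fact
  have T: "hopf_subalgebra H T" using ex by (simp add: exact_factorization_def)
  have sub: "subspace T" and one: "1 \<in> T" and mult: "\<And>a b. a \<in> T \<Longrightarrow> b \<in> T \<Longrightarrow> a * b \<in> T"
    and anti: "\<And>a. a \<in> T \<Longrightarrow> antipode H a \<in> T"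
    using T by (auto simp: hopf_subalgebra_def)
  define \<Gamma> where "\<Gamma> = {t \<in> carrier G. \<iota> t \<in> T}"
  have x_B: "x \<in> B" using monomial_span_base[OF U.one_closed, of 1] by (simp add: B' iota_one)
  have "x \<notin> T"
  proof
    assume "x \<in> T"
    have "char1 x * counit H 1 = char1 1 * counit H x"
      by (rule exact_factorization_inter[OF ex x_B \<open>x \<in> T\<close> bilinear_product[OF alg_hom_linear[OF char1] counit_linear]])
    then show False by (simp add: counit_one)
  qed
  from hopf_subalgebra_without_x[OF T this] have T\<Gamma>: "T = span (\<iota> ` \<Gamma>)" by (simp add: \<Gamma>_def)
  have sub\<Gamma>: "\<Gamma> \<subseteq> carrier G" by (auto simp: \<Gamma>_def)
  have subgroup: "subgroup \<Gamma> G"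
  proof
    show "t \<otimes> t' \<in> \<Gamma>" if "t \<in> \<Gamma>" "t' \<in> \<Gamma>" for t t'
      using that mult[of "\<iota> t" "\<iota> t'"] by (simp add: \<Gamma>_def iota_mult)
    show "inv t \<in> \<Gamma>" if "t \<in> \<Gamma>" for t
      using that anti[of "\<iota> t"] by (simp add: \<Gamma>_def antipode_iota)
  qed (use sub\<Gamma> one in \<open>auto simp: \<Gamma>_def iota_one\<close>)
  have int: "U \<inter> \<Gamma> = {\<one>}"
  proof -
    have "t = \<one>" if t: "t \<in> U" "t \<in> \<Gamma>" for t
    proof (rule ccontr)
      assume "t \<noteq> \<one>"
      have tG: "t \<in> carrier G" using t sub\<Gamma> by auto
      have tBT: "\<iota> t \<in> B" "\<iota> t \<in> T"
        using t by (auto simp: B' \<Gamma>_def intro: iota_in_monomial_span)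
      have "coef t (\<iota> t) * coef \<one> 1 = coef t 1 * coef \<one> (\<iota> t)"
        by (rule exact_factorization_inter[OF ex tBT bilinear_product[OF linear_coef linear_coef]])
      with \<open>t \<noteq> \<one>\<close> show False
        using tG coef_iota[of \<one> \<one>] coef_iota[of \<one> t] by (simp add: coef_iota iota_one split: if_splits)
    qed
    then show ?thesis using U.one_closed subgroup.one_closed[OF subgroup] by blast
  qed
  have prod: "U <#> \<Gamma> = carrier G"
  proof
    show UG: "U <#> \<Gamma> \<subseteq> carrier G" by (rule set_mult_closed[OF U.subset sub\<Gamma>])
    have closed: "w \<otimes> g \<in> U <#> \<Gamma>" if w: "w \<in> U <#> \<Gamma>" for w
    proof -
      from w obtain u r where ur: "u \<in> U" "r \<in> \<Gamma>" "w = u \<otimes> r" unfolding set_mult_def by blast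
      then have "w \<otimes> g = (u \<otimes> g) \<otimes> r"
        using sub\<Gamma> U.subset g_central[of r] by (auto simp: m_assoc)
      then show ?thesis using ur U unfolding set_mult_def by blast
    qed
    have BT: "b * t \<in> monomial_span (U <#> \<Gamma>)" if "b \<in> B" "t \<in> T" for b t
      by (rule monomial_span_mult[OF U.subset sub\<Gamma> UG _ closed])
        (use that span_iota_monomial_span[of \<Gamma>] in \<open>auto simp: B' T\<Gamma> set_mult_def\<close>)
    show "carrier G \<subseteq> U <#> \<Gamma>"
    proof
      fix t assume t: "t \<in> carrier G"
      have "\<iota> t \<in> mult_map ` tensor_formal B T" using ex by (simp add: exact_factorization_iff)
      then obtain u where u: "u \<in> tensor_formal B T" "\<iota> t = mult_map u" by blast
      have "mult_map u \<in> monomial_span (U <#> \<Gamma>)"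
        by (rule lin_ext_in_subspace[OF subspace_monomial_span]) (use u(1) BT in \<open>auto simp: tensor_formal_def\<close>)
      then show "t \<in> U <#> \<Gamma>" using u(2) iota_in_monomial_span_iff[OF UG t] by simp
    qed
  qed
  have "\<Gamma> \<noteq> {\<one>}"
  proof
    assume "\<Gamma> = {\<one>}"
    then have "U = carrier G" using prod U.subset by (auto simp: set_mult_def)
    then show False using BU by (simp add: B' monomial_span_carrier)
  qed
  then have "(U, \<Gamma>) \<in> group_factorizations G g"
    using U subgroup prod int by (simp add: group_factorizations_def)
  then show ?thesis using B T\<Gamma> by (intro that) (simp_all add: group_subalgebra_def)
qed

section \<open>Equivalence of factorizations\<close>

lemma image_monomial_span:
  assumes "alg_hom (scl H) (scl H) \<Phi>" "\<And>t. t \<in> carrier G \<Longrightarrow> \<Phi> (\<iota> t) = \<iota> (\<sigma> t)" "\<Phi> x = x" "U \<subseteq> carrier G"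
  shows "\<Phi> ` monomial_span U = monomial_span (\<sigma> ` U)"
proof -
  have "\<Phi> (\<iota> u * x ^ n) = \<iota> (\<sigma> u) * x ^ n" if "u \<in> U" for u n
    using that assms by (auto simp: alg_hom_mult[OF assms(1)] alg_hom_power[OF assms(1)])
  then have "\<Phi> ` (\<lambda>(u, n). \<iota> u * x ^ n) ` (U \<times> UNIV) = (\<lambda>(u, n). \<iota> u * x ^ n) ` (\<sigma> ` U \<times> UNIV)"
    by (force simp: image_iff)
  moreover have "{\<iota> u * x ^ n | u n. u \<in> V} = (\<lambda>(u, n). \<iota> u * x ^ n) ` (V \<times> UNIV)" for V
    by auto
  ultimately have "\<Phi> ` {\<iota> u * x ^ n | u n. u \<in> U} = {\<iota> u * x ^ n | u n. u \<in> \<sigma> ` U}"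
    by simp
  then show ?thesis
    unfolding monomial_span_def module_hom.span_image[OF module_hom_linearI[OF alg_hom_linear[OF assms(1)]], symmetric]
    by simp
qed

lemma image_span_iota:
  assumes "alg_hom (scl H) (scl H) \<Phi>" "\<And>t. t \<in> carrier G \<Longrightarrow> \<Phi> (\<iota> t) = \<iota> (\<sigma> t)" "U \<subseteq> carrier G"
  shows "\<Phi> ` span (\<iota> ` U) = span (\<iota> ` \<sigma> ` U)"
proof -
  have "\<Phi> ` \<iota> ` U = \<iota> ` \<sigma> ` U"
    unfolding image_image by (rule image_cong) (use assms in auto)
  then show ?thesis
    unfolding module_hom.span_image[OF module_hom_linearI[OF alg_hom_linear[OF assms(1)]], symmetric] by simp
qed

text \<open>Each factor determines its group, as the set of the \<open>t\<close> for which it contains \<open>\<iota> t\<close>. So the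
  automorphism of \<open>G\<close> induced by an equivalence maps groups to groups, even though the equivalence
  need not fix \<open>x\<close>.\<close>
lemma hopf_equivalent_iff:
  assumes U: "subgroup U\<^sub>1 G" "g \<in> U\<^sub>1" "subgroup U\<^sub>2 G" "g \<in> U\<^sub>2"
    and \<Gamma>: "\<Gamma>\<^sub>1 \<subseteq> carrier G" "\<Gamma>\<^sub>2 \<subseteq> carrier G"
  shows "hopf_equivalent H (rank_one_factor H \<iota> x U\<^sub>1, group_subalgebra H \<iota> \<Gamma>\<^sub>1)
      (rank_one_factor H \<iota> x U\<^sub>2, group_subalgebra H \<iota> \<Gamma>\<^sub>2) \<longleftrightarrow>
    (\<exists>\<sigma>\<in>aut_gf G g f. \<sigma> ` U\<^sub>1 = U\<^sub>2 \<and> \<sigma> ` \<Gamma>\<^sub>1 = \<Gamma>\<^sub>2)"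
proof -
  have sub: "U\<^sub>1 \<subseteq> carrier G" "U\<^sub>2 \<subseteq> carrier G" using U subgroup.subset by blast+
  have eq: "rank_one_factor H \<iota> x U\<^sub>1 = monomial_span U\<^sub>1" "rank_one_factor H \<iota> x U\<^sub>2 = monomial_span U\<^sub>2"
    using U by (simp_all add: rank_one_factor_eq)
  show ?thesis
  proof
    assume "hopf_equivalent H (rank_one_factor H \<iota> x U\<^sub>1, group_subalgebra H \<iota> \<Gamma>\<^sub>1)
      (rank_one_factor H \<iota> x U\<^sub>2, group_subalgebra H \<iota> \<Gamma>\<^sub>2)"
    then obtain \<Phi> where \<Phi>: "hopf_automorphism H \<Phi>" and img: "\<Phi> ` monomial_span U\<^sub>1 = monomial_span U\<^sub>2"
      "\<Phi> ` span (\<iota> ` \<Gamma>\<^sub>1) = span (\<iota> ` \<Gamma>\<^sub>2)"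
      by (auto simp: hopf_equivalent_def eq group_subalgebra_def)
    obtain \<sigma> where \<sigma>: "\<sigma> \<in> aut_gf G g f" "\<And>t. t \<in> carrier G \<Longrightarrow> \<Phi> (\<iota> t) = \<iota> (\<sigma> t)"
      using automorphism_induces[OF \<Phi>] by blast
    note p = aut_gf_props[OF \<sigma>(1)]
    have inj: "\<Phi> a = \<Phi> b \<Longrightarrow> a = b" for a b
      using \<Phi> by (auto simp: hopf_automorphism_def bij_def inj_def)
    have restrict: "\<sigma> ` V = V'"
      if V: "V \<subseteq> carrier G" "V' \<subseteq> carrier G" and W: "\<And>t. t \<in> carrier G \<Longrightarrow> \<iota> t \<in> W \<longleftrightarrow> t \<in> V"
        and W': "\<And>t. t \<in> carrier G \<Longrightarrow> \<iota> t \<in> W' \<longleftrightarrow> t \<in> V'" and img: "\<Phi> ` W = W'" for V V' W W'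
    proof
      show "\<sigma> ` V \<subseteq> V'"
      proof (rule image_subsetI)
        fix t assume t: "t \<in> V"
        then have "\<Phi> (\<iota> t) \<in> W'" using V W img by blast
        then show "\<sigma> t \<in> V'" using t V W' \<sigma>(2) p(1) by (metis subsetD)
      qed
      show "V' \<subseteq> \<sigma> ` V"
      proof
        fix t assume t: "t \<in> V'"
        then have tG: "t \<in> carrier G" using V by blast
        then have "t \<in> \<sigma> ` carrier G" using p(5) by (simp add: bij_betw_def)
        then obtain s where s: "s \<in> carrier G" "\<sigma> s = t" by blast
        have "\<iota> t \<in> \<Phi> ` W" using img W'[OF tG] t by simp
        then obtain b where b: "b \<in> W" "\<Phi> b = \<iota> t" by auto
        then have "b = \<iota> s" using \<sigma>(2)[OF s(1)] s(2) inj by simp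
        then have "s \<in> V" using b(1) W[OF s(1)] by simp
        then show "t \<in> \<sigma> ` V" using s(2) by blast
      qed
    qed
    have "\<sigma> ` U\<^sub>1 = U\<^sub>2"
      by (rule restrict[OF sub _ _ img(1)]) (simp_all add: iota_in_monomial_span_iff sub)
    moreover have "\<sigma> ` \<Gamma>\<^sub>1 = \<Gamma>\<^sub>2"
      by (rule restrict[OF \<Gamma> _ _ img(2)]) (simp_all add: iota_in_span_iff \<Gamma>)
    ultimately show "\<exists>\<sigma>\<in>aut_gf G g f. \<sigma> ` U\<^sub>1 = U\<^sub>2 \<and> \<sigma> ` \<Gamma>\<^sub>1 = \<Gamma>\<^sub>2" using \<sigma>(1) by blast
  next
    assume "\<exists>\<sigma>\<in>aut_gf G g f. \<sigma> ` U\<^sub>1 = U\<^sub>2 \<and> \<sigma> ` \<Gamma>\<^sub>1 = \<Gamma>\<^sub>2"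
    then obtain \<sigma> where \<sigma>: "\<sigma> \<in> aut_gf G g f" "\<sigma> ` U\<^sub>1 = U\<^sub>2" "\<sigma> ` \<Gamma>\<^sub>1 = \<Gamma>\<^sub>2" by blast
    obtain \<Phi> where \<Phi>: "hopf_automorphism H \<Phi>" "\<And>t. t \<in> carrier G \<Longrightarrow> \<Phi> (\<iota> t) = \<iota> (\<sigma> t)" "\<Phi> x = x"
      using automorphism_of_aut_gf[OF \<sigma>(1)] by blast
    note hom = alg_hom_automorphism[OF \<Phi>(1)]
    show "hopf_equivalent H (rank_one_factor H \<iota> x U\<^sub>1, group_subalgebra H \<iota> \<Gamma>\<^sub>1)
      (rank_one_factor H \<iota> x U\<^sub>2, group_subalgebra H \<iota> \<Gamma>\<^sub>2)"
      unfolding hopf_equivalent_def eq group_subalgebra_def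
      using \<Phi>(1) image_monomial_span[OF hom \<Phi>(2,3) sub(1)] image_span_iota[OF hom \<Phi>(2) \<Gamma>(1)] \<sigma> by auto
  qed
qed

lemma group_factorization_image:
  assumes \<sigma>: "\<sigma> \<in> aut_gf G g f" and P: "(U, \<Gamma>) \<in> group_factorizations G g"
  shows "(\<sigma> ` U, \<sigma> ` \<Gamma>) \<in> group_factorizations G g"
proof -
  note p = aut_gf_props[OF \<sigma>]
  have U: "subgroup U G" "g \<in> U" and \<Gamma>: "subgroup \<Gamma> G" and prod: "U <#> \<Gamma> = carrier G"
    and int: "U \<inter> \<Gamma> = {\<one>}" and ne: "\<Gamma> \<noteq> {\<one>}"
    using P by (auto simp: group_factorizations_def)
  interpret \<sigma>: group_hom G G \<sigma>
    by unfold_locales (use \<sigma> in \<open>simp add: aut_gf_def auto_def\<close>)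
  have sub: "U \<subseteq> carrier G" "\<Gamma> \<subseteq> carrier G" using U \<Gamma> subgroup.subset by blast+
  have inj: "inj_on \<sigma> (carrier G)" and surj: "\<sigma> ` carrier G = carrier G"
    using p(5) by (auto simp: bij_betw_def)
  have "\<sigma> ` U <#> \<sigma> ` \<Gamma> = \<sigma> ` (U <#> \<Gamma>)"
  proof -
    have "\<sigma> (h \<otimes> k) = \<sigma> h \<otimes> \<sigma> k" if "h \<in> U" "k \<in> \<Gamma>" for h k
      using that sub p(2) by blast
    then show ?thesis by (simp add: set_mult_def image_UN)
  qed
  moreover have "\<sigma> ` U \<inter> \<sigma> ` \<Gamma> = \<sigma> ` (U \<inter> \<Gamma>)"
    using inj_on_image_Int[OF inj sub] by simp
  moreover have "\<sigma> ` \<Gamma> \<noteq> {\<one>}"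
  proof
    assume "\<sigma> ` \<Gamma> = {\<one>}"
    then have "\<sigma> ` \<Gamma> = \<sigma> ` {\<one>}" by simp
    then have "\<Gamma> = {\<one>}" using inj_on_image_eq_iff[OF inj sub(2), of "{\<one>}"] by blast
    with ne show False by simp
  qed
  moreover have "g \<in> \<sigma> ` U" using U(2) p(3) by (metis imageI)
  ultimately show ?thesis
    using \<sigma>.subgroup_img_is_subgroup[OF U(1)] \<sigma>.subgroup_img_is_subgroup[OF \<Gamma>] prod int surj
    by (simp add: group_factorizations_def)
qed

definition factors :: "'a set \<times> 'a set \<Rightarrow> 'h set \<times> 'h set" where
  "factors = (\<lambda>(U, \<Gamma>). (rank_one_factor H \<iota> x U, group_subalgebra H \<iota> \<Gamma>))"

lemma bij_betw_factors:
  "bij_betw factors (group_factorizations G g) (oriented_factorizations G g H \<iota> x)"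
  unfolding bij_betw_def
proof
  show "inj_on factors (group_factorizations G g)"
  proof (rule inj_onI, clarify)
    fix U \<Gamma> U' \<Gamma>'
    assume P: "(U, \<Gamma>) \<in> group_factorizations G g" "(U', \<Gamma>') \<in> group_factorizations G g"
      and eq: "factors (U, \<Gamma>) = factors (U', \<Gamma>')"
    have sub: "U \<subseteq> carrier G" "U' \<subseteq> carrier G" "\<Gamma> \<subseteq> carrier G" "\<Gamma>' \<subseteq> carrier G"
      using P subgroup.subset by (auto simp: group_factorizations_def)
    have "monomial_span U = monomial_span U'" "span (\<iota> ` \<Gamma>) = span (\<iota> ` \<Gamma>')"
      using eq P by (auto simp: factors_def group_factorizations_def rank_one_factor_eq group_subalgebra_def)
    then have "t \<in> U \<longleftrightarrow> t \<in> U'" "t \<in> \<Gamma> \<longleftrightarrow> t \<in> \<Gamma>'" if "t \<in> carrier G" for t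
      using iota_in_monomial_span_iff[OF sub(1) that] iota_in_monomial_span_iff[OF sub(2) that]
        iota_in_span_iff[OF sub(3) that] iota_in_span_iff[OF sub(4) that] by simp_all
    then show "U = U' \<and> \<Gamma> = \<Gamma>'" using sub by blast
  qed
  show "factors ` group_factorizations G g = oriented_factorizations G g H \<iota> x"
  proof
    show "factors ` group_factorizations G g \<subseteq> oriented_factorizations G g H \<iota> x"
      using group_factorization_oriented by (auto simp: factors_def)
    show "oriented_factorizations G g H \<iota> x \<subseteq> factors ` group_factorizations G g"
    proof clarify
      fix B T assume "(B, T) \<in> oriented_factorizations G g H \<iota> x"
      then show "(B, T) \<in> factors ` group_factorizations G g"
        by (rule oriented_factorization_group) (auto simp: factors_def intro!: image_eqI)
    qed
  qed
qed

text \<open>The bijection \<open>factors\<close> carries the orbit of a group factorization onto the equivalence class of its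
  image.\<close>
lemma bij_betw_orbits:
  "bij_betw (\<lambda>X. factors ` X)
     (orbits (aut_gf_group G g f) (group_factorizations G g) (\<lambda>\<sigma> (U, \<Gamma>). (\<sigma> ` U, \<sigma> ` \<Gamma>)))
     (oriented_factorizations G g H \<iota> x // factorization_equiv G g H \<iota> x)"
proof -
  let ?E = "group_factorizations G g" and ?F = "oriented_factorizations G g H \<iota> x"
  let ?act = "\<lambda>\<sigma> (U, \<Gamma>). (\<sigma> ` U, \<sigma> ` \<Gamma>)"
  let ?orb = "orbit (aut_gf_group G g f) ?act"
  have orb: "?orb P = {?act \<sigma> P | \<sigma>. \<sigma> \<in> aut_gf G g f}" for P
    by (simp add: orbit_def aut_gf_group_def)
  have orb_sub: "?orb P \<subseteq> ?E" if "P \<in> ?E" for P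
    using that group_factorization_image by (cases P) (auto simp: orb)
  have equiv: "hopf_equivalent H (factors P) (factors Q) \<longleftrightarrow> Q \<in> ?orb P" if "P \<in> ?E" "Q \<in> ?E" for P Q
  proof -
    obtain U \<Gamma> U' \<Gamma>' where PQ: "P = (U, \<Gamma>)" "Q = (U', \<Gamma>')" by (cases P, cases Q) blast
    have "hopf_equivalent H (factors P) (factors Q) \<longleftrightarrow> (\<exists>\<sigma>\<in>aut_gf G g f. \<sigma> ` U = U' \<and> \<sigma> ` \<Gamma> = \<Gamma>')"
      unfolding factors_def PQ prod.case
      by (rule hopf_equivalent_iff) (use that in \<open>auto simp: PQ group_factorizations_def dest: subgroup.subset\<close>)
    then show ?thesis unfolding orb PQ prod.case by blast
  qed
  have cls: "factorization_equiv G g H \<iota> x `` {factors P} = factors ` ?orb P" if P: "P \<in> ?E" for P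
  proof -
    have "factorization_equiv G g H \<iota> x `` {factors P} = {Q \<in> ?F. hopf_equivalent H (factors P) Q}"
      using bij_betw_factors P by (auto simp: factorization_equiv_def bij_betw_def)
    also have "\<dots> = factors ` {Q \<in> ?E. hopf_equivalent H (factors P) (factors Q)}"
      unfolding bij_betw_imp_surj_on[OF bij_betw_factors, symmetric] by blast
    also have "\<dots> = factors ` ?orb P"
      using equiv[OF P] orb_sub[OF P] by (intro arg_cong[of _ _ "image factors"]) auto
    finally show ?thesis .
  qed
  show ?thesis
    unfolding bij_betw_def
  proof
    show "inj_on (\<lambda>X. factors ` X) (orbits (aut_gf_group G g f) ?E ?act)"
    proof (rule inj_onI)
      fix X Y assume "X \<in> orbits (aut_gf_group G g f) ?E ?act" "Y \<in> orbits (aut_gf_group G g f) ?E ?act"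
        and eq: "factors ` X = factors ` Y"
      then have "X \<subseteq> ?E" "Y \<subseteq> ?E" using orb_sub by (auto simp: orbits_def)
      then show "X = Y"
        using eq bij_betw_factors inj_on_image_eq_iff by (metis bij_betw_def)
    qed
    have "?F // factorization_equiv G g H \<iota> x = (\<lambda>P. factorization_equiv G g H \<iota> x `` {factors P}) ` ?E"
      unfolding bij_betw_imp_surj_on[OF bij_betw_factors, symmetric] quotient_def by blast
    also have "\<dots> = (\<lambda>P. factors ` ?orb P) ` ?E"
      by (rule image_cong[OF refl cls])
    also have "\<dots> = (\<lambda>X. factors ` X) ` orbits (aut_gf_group G g f) ?E ?act"
      by (auto simp: orbits_def)
    finally show "(\<lambda>X. factors ` X) ` orbits (aut_gf_group G g f) ?E ?act = ?F // factorization_equiv G g H \<iota> x"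
      by simp
  qed
qed

end

theorem corollary4p5:
  fixes G :: "('a, 'm) monoid_scheme"
    and g :: 'a
    and f :: "'a \<Rightarrow> 'k::alg_closed_field"
    and H :: "('k, 'h::ring_1) hopf"
    and \<iota> :: "'a \<Rightarrow> 'h"
    and x :: 'h
  assumes "CHAR('k) > 0"
    and "third_type_datum G g f"
    and "third_type_hopf_algebra G g f H \<iota> x"
  shows "(\<forall>GB\<^sub>1 \<Gamma>\<^sub>1 GB\<^sub>2 \<Gamma>\<^sub>2.
            subgroup GB\<^sub>1 G \<and> g \<in> GB\<^sub>1 \<and> subgroup \<Gamma>\<^sub>1 G \<and>
            (rank_one_factor H \<iota> x GB\<^sub>1, group_subalgebra H \<iota> \<Gamma>\<^sub>1)
              \<in> oriented_factorizations G g H \<iota> x \<and>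
            subgroup GB\<^sub>2 G \<and> g \<in> GB\<^sub>2 \<and> subgroup \<Gamma>\<^sub>2 G \<and>
            (rank_one_factor H \<iota> x GB\<^sub>2, group_subalgebra H \<iota> \<Gamma>\<^sub>2)
              \<in> oriented_factorizations G g H \<iota> x \<longrightarrow>
            (hopf_equivalent H
               (rank_one_factor H \<iota> x GB\<^sub>1, group_subalgebra H \<iota> \<Gamma>\<^sub>1)
               (rank_one_factor H \<iota> x GB\<^sub>2, group_subalgebra H \<iota> \<Gamma>\<^sub>2) \<longleftrightarrow>
             (\<exists>\<sigma>\<in>aut_gf G g f. \<sigma> ` GB\<^sub>1 = GB\<^sub>2 \<and> \<sigma> ` \<Gamma>\<^sub>1 = \<Gamma>\<^sub>2))) \<and>
         bij_betw
           (\<lambda>X. (\<lambda>(GB, \<Gamma>). (rank_one_factor H \<iota> x GB, group_subalgebra H \<iota> \<Gamma>)) ` X)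
           (orbits (aut_gf_group G g f) (group_factorizations G g)
             (\<lambda>\<sigma> (GB, \<Gamma>). (\<sigma> ` GB, \<sigma> ` \<Gamma>)))
           (oriented_factorizations G g H \<iota> x // factorization_equiv G g H \<iota> x)"
proof -
  interpret group G using assms(2) by (simp add: third_type_datum_def)
  interpret third_type G g f H \<iota> x
    by unfold_locales (fact assms)+
  show ?thesis
    by (intro conjI allI impI bij_betw_orbits[unfolded factors_def] hopf_equivalent_iff)
      (elim conjE; simp add: subgroup.subset)+
qed

end
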